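(* Let $\mathbb{H}$ be the sub-Finsler Heisenberg group equipped with a $C^1$ and strongly convex norm $\|\cdot\|$ and with a smooth measure $\mathfrak{m}$. Then $(\mathbb{H},\mathsf{d},\mathfrak{m})$ does not satisfy the Brunn–Minkowski inequality $\mathsf{BM}(K,N)$ for any $K\in\mathbb{R}$ and any $N\in(1,\infty)$.
   Context: Fix a norm $\|\cdot\|$ on $\mathbb{R}^2$. The sub-Finsler Heisenberg group $\mathbb{H}$ is $\mathbb{R}^3$ with group law $(x,y,z)\star(x',y',z')=(x+x',y+y',z+z'+\tfrac12(xy'-x'y))$, identity $\mathrm{e}=(0,0,0)$, and left-invariant vector fields $X_1=\partial_x-\tfrac{y}{2}\partial_z$, $X_2=\partial_y+\tfrac{x}{2}\partial_z$. A curve $\gamma:[0,1]\to\mathbb{R}^3$ is admissible if it is absolutely continuous and there is $u=(u_1,u_2)\in L^2([0,1];\mathbb{R}^2)$ with $\dot\gamma(t)=u_1(t)X_1(\gamma(t))+u_2(t)X_2(\gamma(t))$ for a.e. $t$; its length is $\int_0^1\|u(t)\|\,dt$. The sub-Finsler distance $\mathsf{d}(p,q)$ is the infimum of the lengths of admissible curves from $p$ to $q$. $\mathscr{L}^3$ denotes Lebesgue measure on $\mathbb{R}^3$; a Borel measure $\mathfrak{m}$ on $\mathbb{H}$ is smooth if $\mathfrak{m}=\rho\,\mathscr{L}^3$ with $\rho$ smooth and strictly positive. A geodesic in a metric space $(X,\mathsf{d})$ is a curve $\gamma:[0,1]\to X$ with $\mathsf{d}(\gamma(s),\gamma(t))=|t-s|\,\mathsf{d}(\gamma(0),\gamma(1))$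 for all $s,t\in[0,1]$. Regularity/convexity of the norm: with $f(x)=\tfrac12\|x\|^2$, the norm is called $C^1$ (resp. $C^2$) if it is of class $C^1$ (resp. $C^2$) on $\mathbb{R}^2\setminus\{0\}$, $C^{1,1}$ if $f$ is $C^1$ with Lipschitz gradient, strictly convex if $f$ is strictly convex, and strongly convex if there is $\alpha>0$ with $f(tx+(1-t)y)\le tf(x)+(1-t)f(y)-\tfrac{\alpha}{2}t(1-t)\|x-y\|^2$ for all $x,y\in\mathbb{R}^2$, $t\in[0,1]$. Brunn–Minkowski inequality: for $K\in\mathbb{R}$, $N\in(1,\infty)$, $t\in[0,1]$, $\theta\ge0$, let $\sigma^{(t)}_{K,N}(\theta)=+\infty$ if $N\pi^2\le K\theta^2$, $\sigma^{(t)}_{K,N}(\theta)=\sin(t\theta\sqrt{K/N})/\sin(\theta\sqrt{K/N})$ if $0<K\theta^2<N\pi^2$, $\sigma^{(t)}_{K,N}(\theta)=t$ if $K=0$, $\sigma^{(t)}_{K,N}(\theta)=\sinh(t\theta\sqrt{-K/N})/\sinh(\theta\sqrt{-K/N})$ if $K<0$; and $\tau^{(t)}_{K,N}(\theta)=t^{1/N}[\sigma^{(t)}_{K,N-1}(\theta)]^{1-1/N}$. For Borel sets $A,B$ and $t\in(0,1)$, $M_t(A,B)$ is the set of points $\gamma(t)$ where $\gamma$ is a geodesic with $\gamma(0)\in A$, $\gamma(1)\in B$. A metric measure space $(X,\mathsf d,\mathfrak m)$ satisfies $\mathsf{BM}(K,N)$ if for all nonempty Borel $A,B\subset\mathrm{spt}\,\mathfrak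 m$ and all $t\in(0,1)$, $\mathfrak m(M_t(A,B))^{1/N}\ge\tau^{(1-t)}_{K,N}(\Theta(A,B))\,\mathfrak m(A)^{1/N}+\tau^{(t)}_{K,N}(\Theta(A,B))\,\mathfrak m(B)^{1/N}$, where $\Theta(A,B)=\inf_{x\in A,y\in B}\mathsf d(x,y)$ if $K\ge0$ and $\Theta(A,B)=\sup_{x\in A,y\in B}\mathsf d(x,y)$ if $K<0$. *)

theory Defs
  imports "HOL-Analysis.Analysis"
begin

type_synonym R2 = "real \<times> real"
type_synonym R3 = "real \<times> real \<times> real"

definition is_norm :: "(R2 \<Rightarrow> real) \<Rightarrow> bool" where
  "is_norm nrm \<longleftrightarrow>
     (\<forall>x. 0 \<le> nrm x) \<and> (\<forall>x. nrm x = 0 \<longleftrightarrow> x = 0) \<and>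
     (\<forall>c x. nrm (c *\<^sub>R x) = \<bar>c\<bar> * nrm x) \<and>
     (\<forall>x y. nrm (x + y) \<le> nrm x + nrm y)"

definition C1_norm :: "(R2 \<Rightarrow> real) \<Rightarrow> bool" where
  "C1_norm nrm \<longleftrightarrow>
     (\<exists>D :: R2 \<Rightarrow> (R2 \<Rightarrow>\<^sub>L real).
        (\<forall>x. x \<noteq> 0 \<longrightarrow> (nrm has_derivative blinfun_apply (D x)) (at x)) \<and>
        continuous_on (- {0}) D)"

definition strongly_convex_norm :: "(R2 \<Rightarrow> real) \<Rightarrow> bool" where
  "strongly_convex_norm nrm \<longleftrightarrow>
     (\<exists>\<alpha>>0. \<forall>x y. \<forall>t\<in>{0..1}.
        (1/2) * (nrm (t *\<^sub>R x + (1 - t) *\<^sub>R y))\<^sup>2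
          \<le> t * ((1/2) * (nrm x)\<^sup>2) + (1 - t) * ((1/2) * (nrm y)\<^sup>2)
             - \<alpha> / 2 * t * (1 - t) * (nrm (x - y))\<^sup>2)"

fun Ck :: "nat \<Rightarrow> ('a::euclidean_space \<Rightarrow> real) \<Rightarrow> bool" where
  "Ck 0 f \<longleftrightarrow> continuous_on UNIV f"
| "Ck (Suc k) f \<longleftrightarrow> (\<forall>x. f differentiable (at x)) \<and>
                      (\<forall>i\<in>Basis. Ck k (\<lambda>x. frechet_derivative f (at x) i))"

definition smooth_fun :: "('a::euclidean_space \<Rightarrow> real) \<Rightarrow> bool" where
  "smooth_fun f \<longleftrightarrow> (\<forall>k. Ck k f)"

definition heis_mult :: "R3 \<Rightarrow> R3 \<Rightarrow> R3" where
  "heis_mult p q = (case p of (x, y, z) \<Rightarrow> case q of (x', y', z') \<Rightarrow>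
      (x + x', y + y', z + z' + (1/2) * (x * y' - x' * y)))"

definition X1 :: "R3 \<Rightarrow> R3" where
  "X1 p = (case p of (x, y, z) \<Rightarrow> (1, 0, - y / 2))"

definition X2 :: "R3 \<Rightarrow> R3" where
  "X2 p = (case p of (x, y, z) \<Rightarrow> (0, 1, x / 2))"

definition abs_cont_01 :: "(real \<Rightarrow> R3) \<Rightarrow> bool" where
  "abs_cont_01 \<gamma> \<longleftrightarrow>
     (\<forall>\<epsilon>>0. \<exists>\<delta>>0. \<forall>(n::nat) (a::nat \<Rightarrow> real) (b::nat \<Rightarrow> real).
        (\<forall>i<n. 0 \<le> a i \<and> a i \<le> b i \<and> b i \<le> 1) \<and>
        (\<forall>i j. i < j \<and> j < n \<longrightarrow> b i \<le> a j) \<and>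
        (\<Sum>i<n. b i - a i) < \<delta>
        \<longrightarrow> (\<Sum>i<n. norm (\<gamma> (b i) - \<gamma> (a i))) < \<epsilon>)"

definition admissible :: "(real \<Rightarrow> R3) \<Rightarrow> (real \<Rightarrow> R2) \<Rightarrow> bool" where
  "admissible \<gamma> u \<longleftrightarrow>
     abs_cont_01 \<gamma> \<and>
     u \<in> borel_measurable (lebesgue_on {0..1}) \<and>
     integrable (lebesgue_on {0..1}) (\<lambda>t. (norm (u t))\<^sup>2) \<and>
     (AE t in lebesgue_on {0..1}.
        (\<gamma> has_vector_derivative (fst (u t) *\<^sub>R X1 (\<gamma> t) + snd (u t) *\<^sub>R X2 (\<gamma> t)))
          (at t within {0..1}))"

definition sf_length :: "(R2 \<Rightarrow> real) \<Rightarrow> (real \<Rightarrow> R2) \<Rightarrow> real" where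
  "sf_length nrm u = integral\<^sup>L (lebesgue_on {0..1}) (\<lambda>t. nrm (u t))"

definition sf_dist :: "(R2 \<Rightarrow> real) \<Rightarrow> R3 \<Rightarrow> R3 \<Rightarrow> real" where
  "sf_dist nrm p q =
     Inf {sf_length nrm u | \<gamma> u. admissible \<gamma> u \<and> \<gamma> 0 = p \<and> \<gamma> 1 = q}"

text \<open>Outer measure (used for possibly non-measurable sets such as M_t(A,B)).\<close>
definition outer_meas :: "'a measure \<Rightarrow> 'a set \<Rightarrow> ennreal" where
  "outer_meas M S = (INF U \<in> {U \<in> sets M. S \<subseteq> U}. emeasure M U)"

definition spt :: "('a \<Rightarrow> 'a \<Rightarrow> real) \<Rightarrow> 'a measure \<Rightarrow> 'a set" where
  "spt d M = {x. \<forall>e>0. outer_meas M {y. d x y < e} > 0}"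

definition geodesic :: "('a \<Rightarrow> 'a \<Rightarrow> real) \<Rightarrow> (real \<Rightarrow> 'a) \<Rightarrow> bool" where
  "geodesic d \<gamma> \<longleftrightarrow>
     (\<forall>s\<in>{0..1}. \<forall>t\<in>{0..1}. d (\<gamma> s) (\<gamma> t) = \<bar>t - s\<bar> * d (\<gamma> 0) (\<gamma> 1))"

definition Mt :: "('a \<Rightarrow> 'a \<Rightarrow> real) \<Rightarrow> real \<Rightarrow> 'a set \<Rightarrow> 'a set \<Rightarrow> 'a set" where
  "Mt d t A B = {\<gamma> t | \<gamma>. geodesic d \<gamma> \<and> \<gamma> 0 \<in> A \<and> \<gamma> 1 \<in> B}"

definition sigma_KN :: "real \<Rightarrow> real \<Rightarrow> real \<Rightarrow> real \<Rightarrow> ereal" where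
  "sigma_KN K N t \<theta> =
     (if N * pi\<^sup>2 \<le> K * \<theta>\<^sup>2 then \<infinity>
      else if K * \<theta>\<^sup>2 = 0 then ereal t
      else if K > 0 then ereal (sin (t * \<theta> * sqrt (K / N)) / sin (\<theta> * sqrt (K / N)))
      else ereal (sinh (t * \<theta> * sqrt (- K / N)) / sinh (\<theta> * sqrt (- K / N))))"

definition tau_KN :: "real \<Rightarrow> real \<Rightarrow> real \<Rightarrow> real \<Rightarrow> ereal" where
  "tau_KN K N t \<theta> =
     (if sigma_KN K (N - 1) t \<theta> = \<infinity> then \<infinity>
      else ereal (t powr (1 / N) * (real_of_ereal (sigma_KN K (N - 1) t \<theta>)) powr (1 - 1 / N)))"

definition meas_root :: "real \<Rightarrow> ennreal \<Rightarrow> ereal" where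
  "meas_root N x = (if x = \<infinity> then \<infinity> else ereal (enn2real x powr (1 / N)))"

definition Theta :: "('a \<Rightarrow> 'a \<Rightarrow> real) \<Rightarrow> real \<Rightarrow> 'a set \<Rightarrow> 'a set \<Rightarrow> ereal" where
  "Theta d K A B =
     (if K \<ge> 0 then (INF p \<in> A \<times> B. ereal (d (fst p) (snd p)))
      else (SUP p \<in> A \<times> B. ereal (d (fst p) (snd p))))"

definition BM :: "('a::topological_space \<Rightarrow> 'a \<Rightarrow> real) \<Rightarrow> 'a measure \<Rightarrow> real \<Rightarrow> real \<Rightarrow> bool" where
  "BM d M K N \<longleftrightarrow>
     (\<forall>A B t. A \<in> sets borel \<and> B \<in> sets borel \<and> A \<noteq> {} \<and> B \<noteq> {} \<and>
        A \<subseteq> spt d M \<and> B \<subseteq> spt d M \<and> 0 < t \<and> t < 1 \<and> Theta d K A B < \<infinity> \<longrightarrow>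
        meas_root N (outer_meas M (Mt d t A B)) \<ge>
          tau_KN K N (1 - t) (real_of_ereal (Theta d K A B)) * meas_root N (emeasure M A)
          + tau_KN K N t (real_of_ereal (Theta d K A B)) * meas_root N (emeasure M B))"

end

theory Submission
  imports Defs
begin

text \<open>
  Both sets are small boxes around the points \<open>\<plusminus>v\<close> on a horizontal line through the origin, dilated by \<open>S\<close>.
  In coordinates \<open>(x, y, z)\<close> adapted to a direction \<open>v\<close> near which the norm is almost quadratic, the distance
  between points near \<open>(-1, 0, 0)\<close> and \<open>(1, 0, 0)\<close> is, up to higher order, \<open>L x + (c/2) (y^2 / x + 12 z^2 / x^3)\<close>, where
  \<open>x, y, z\<close> are the coordinates of the group displacement. The upper bound comes from parabolas; the lower bound from
  calibrations \<open>h dx + (b + k x) dy\<close>. Comparing the two bounds for a metric midpoint \<open>m\<close> of \<open>p\<close> and \<open>q\<close> yields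
  \<open>m_x \<approx> (p_x + q_x)/2\<close>, \<open>m_y \<approx> (p_y + q_y)/8 - (3/4) (q_z - p_z)\<close>, \<open>m_z \<approx> (p_z + q_z)/2\<close>. If the boxes are much
  shorter in \<open>z\<close> than in \<open>y\<close>, the midpoints therefore fill a box of less than half the extent in \<open>y\<close>, so at
  time \<open>1/2\<close> the volume drops by a definite factor. Letting \<open>S\<close> tend to 0 makes the density almost constant and the
  distortion coefficients almost \<open>1/2\<close>, whatever \<open>K\<close> and \<open>N\<close> are.

  The norm need not be twice differentiable in any prescribed direction. Strong convexity bounds the slopes of its first
  derivative along an affine line away from 0, and on an interval whose slope nearly attains the infimum the
  derivative is almost affine; this interval provides the direction \<open>v\<close>.
\<close>

section \<open>Absolutely continuous functions\<close>

text \<open>At time 1/2 both distortion coefficients are close to 1/2, so for two sets of about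
  equal volume the inequality says that the midpoint set has almost that volume, for every
  \<open>N\<close>; a single volume drop therefore excludes all exponents at once. For a norm that
  is only C1 there is neither a Hessian nor a geodesic equation, so midpoints are located by
  comparing distance estimates from above and below. The leading term \<open>L x\<close> cancels
  when the two halves of a pair are added, and what remains is an energy of order
  \<open>K * R^2\<close> for boxes of size \<open>R\<close>. The error \<open>e\<close> of the
  expansion must be small against \<open>K * R^2\<close>, not just against a constant; hence the
  expansion is sought on a window whose size is proportional to \<open>R\<close>. The half side
  \<open>R/10\<close> in z comes from the formula for the y-coordinate of midpoints: it is then at
  most R/4 + (3/4)(R/5) = (4/10) R up to errors, and the remaining gap below R/2 pays for all
  errors.\<close>

lemma abs_cont_01_family:
  assumes "abs_cont_01 \<gamma>" "\<epsilon> > 0"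
  obtains \<delta> where "\<delta> > 0"
    "\<And>P. \<lbrakk>finite P; \<And>u v. (u,v) \<in> P \<Longrightarrow> 0 \<le> u \<and> u < v \<and> v \<le> 1;
       \<And>u v u' v'. \<lbrakk>(u,v) \<in> P; (u',v') \<in> P; (u,v) \<noteq> (u',v')\<rbrakk> \<Longrightarrow> v \<le> u' \<or> v' \<le> u;
       (\<Sum>(u,v)\<in>P. v - u) < \<delta>\<rbrakk> \<Longrightarrow> (\<Sum>(u,v)\<in>P. norm (\<gamma> v - \<gamma> u)) < \<epsilon>"
proof -
  obtain \<delta> where \<delta>: "\<delta> > 0" and ac: "\<And>(n::nat) (a::nat \<Rightarrow> real) (b::nat \<Rightarrow> real).
        (\<forall>i<n. 0 \<le> a i \<and> a i \<le> b i \<and> b i \<le> 1) \<Longrightarrow>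
        (\<forall>i j. i < j \<and> j < n \<longrightarrow> b i \<le> a j) \<Longrightarrow>
        (\<Sum>i<n. b i - a i) < \<delta> \<Longrightarrow> (\<Sum>i<n. norm (\<gamma> (b i) - \<gamma> (a i))) < \<epsilon>"
    using assms(1)[unfolded abs_cont_01_def, rule_format, OF assms(2)] by blast
  show ?thesis
  proof (rule that[OF \<delta>])
    fix P :: "(real \<times> real) set"
    assume fin: "finite P" and 1: "\<And>u v. (u,v) \<in> P \<Longrightarrow> 0 \<le> u \<and> u < v \<and> v \<le> 1"
      and 2: "\<And>u v u' v'. \<lbrakk>(u,v) \<in> P; (u',v') \<in> P; (u,v) \<noteq> (u',v')\<rbrakk> \<Longrightarrow> v \<le> u' \<or> v' \<le> u"
      and 3: "(\<Sum>(u,v)\<in>P. v - u) < \<delta>"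
    obtain ys where ys: "set ys = P" "distinct ys" using fin finite_distinct_list by blast
    \<comment> \<open>\<open>abs_cont_01\<close> speaks of intervals indexed from left to right.
      Sorting by left endpoints gives that order: since the intervals are nondegenerate and do not
      overlap, two of them cannot share a left endpoint, and a smaller one puts the whole interval
      to the left.\<close>
    define xs where "xs = sort_key fst ys"
    have xs: "set xs = P" "distinct xs" "sorted (map fst xs)" by (simp_all add: xs_def ys)
    have sum_eq: "(\<Sum>i<length xs. f (xs ! i)) = sum f P" for f :: "real \<times> real \<Rightarrow> real"
    proof -
      have "sum f P = sum_list (map f xs)" using xs by (metis sum.distinct_set_conv_list)
      also have "\<dots> = (\<Sum>i<length xs. f (xs ! i))" by (simp add: sum_list_sum_nth atLeast0LessThan)
      finally show ?thesis by simp
    qed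
    have mem: "xs ! i \<in> P" if "i < length xs" for i using xs that nth_mem by blast
    have "(\<Sum>i<length xs. norm (\<gamma> (snd (xs!i)) - \<gamma> (fst (xs!i)))) < \<epsilon>"
    proof (rule ac)
      show "\<forall>i<length xs. 0 \<le> fst (xs!i) \<and> fst (xs!i) \<le> snd (xs!i) \<and> snd (xs!i) \<le> 1"
      proof (intro allI impI)
        fix i assume "i < length xs"
        then have "(fst (xs!i), snd (xs!i)) \<in> P" using mem by simp
        from 1[OF this] show "0 \<le> fst (xs!i) \<and> fst (xs!i) \<le> snd (xs!i) \<and> snd (xs!i) \<le> 1" by linarith
      qed
      show "\<forall>i j. i < j \<and> j < length xs \<longrightarrow> snd (xs ! i) \<le> fst (xs ! j)"
      proof (intro allI impI)
        fix i j assume ij: "i < j \<and> j < length xs"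
        have "fst (xs!i) \<le> fst (xs!j)"
          using xs(3) ij by (auto simp: sorted_iff_nth_mono_less)
        moreover have "xs!i \<noteq> xs!j" using xs(2) ij by (simp add: nth_eq_iff_index_eq)
        moreover have "xs!i \<in> P" "xs!j \<in> P" using ij mem by auto
        ultimately show "snd (xs!i) \<le> fst (xs!j)"
          using 1[of "fst (xs!j)" "snd (xs!j)"] 2[of "fst (xs!i)" "snd (xs!i)" "fst (xs!j)" "snd (xs!j)"]
          by (smt (verit) prod.collapse)
      qed
      show "(\<Sum>i<length xs. snd (xs!i) - fst (xs!i)) < \<delta>"
        using 3 sum_eq[of "\<lambda>p. snd p - fst p"] by (simp add: case_prod_beta)
    qed
    then show "(\<Sum>(u,v)\<in>P. norm (\<gamma> v - \<gamma> u)) < \<epsilon>"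
      using sum_eq[of "\<lambda>p. norm (\<gamma> (snd p) - \<gamma> (fst p))"] by (simp add: case_prod_beta)
  qed
qed

text \<open>Off \<open>E\<close> the gauge comes from differentiability, as in the elementary
  fundamental theorem. At tags in \<open>E\<close> it keeps the intervals inside an open set of
  small measure, over which absolute continuity makes the total increment small. The hypothesis
  \<open>dom\<close> passes absolute continuity from \<open>\<gamma>\<close> to
  \<open>h\<close>.\<close>

lemma abs_cont_01_ftc:
  fixes h :: "real \<Rightarrow> real"
  assumes ac: "abs_cont_01 \<gamma>" and T: "0 \<le> T" "T \<le> 1"
    and dom: "\<And>s t. \<lbrakk>s \<in> {0..1}; t \<in> {0..1}\<rbrakk> \<Longrightarrow> \<bar>h t - h s\<bar> \<le> C * norm (\<gamma> t - \<gamma> s)"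
    and E: "negligible E"
    and der: "\<And>t. t \<in> {0..1} - E \<Longrightarrow> (h has_vector_derivative h' t) (at t within {0..1})"
  shows "((\<lambda>t. if t \<in> E then 0 else h' t) has_integral h T - h 0) {0..T}"
proof -
  let ?f = "\<lambda>t. if t \<in> E then 0 else h' t"
  have "\<exists>d. gauge d \<and> (\<forall>p. p tagged_division_of {0..T} \<and> d fine p \<longrightarrow>
      norm ((\<Sum>(x,k)\<in>p. measure lborel k *\<^sub>R ?f x) - (h T - h 0)) \<le> e)" if e: "e > 0" for e
  proof -
    define C' where "C' = \<bar>C\<bar> + 1"
    have C': "C' > 0" "C \<le> C'" by (auto simp: C'_def)
    obtain \<delta> where \<delta>: "\<delta> > 0" and fam:
      "\<And>P. \<lbrakk>finite P; \<And>u v. (u,v) \<in> P \<Longrightarrow> 0 \<le> u \<and> u < v \<and> v \<le> 1;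
       \<And>u v u' v'. \<lbrakk>(u,v) \<in> P; (u',v') \<in> P; (u,v) \<noteq> (u',v')\<rbrakk> \<Longrightarrow> v \<le> u' \<or> v' \<le> u;
       (\<Sum>(u,v)\<in>P. v - u) < \<delta>\<rbrakk> \<Longrightarrow> (\<Sum>(u,v)\<in>P. norm (\<gamma> v - \<gamma> u)) < e / (2 * C')"
    proof -
      have pos: "e / (2*C') > 0" using e C' by simp
      show thesis by (rule abs_cont_01_family[OF ac pos], rule that) blast+
    qed
    have EN: "E \<in> null_sets lebesgue" using E by (simp add: negligible_iff_null_sets)
    then have "E \<in> sets lebesgue" by auto
    from sets_lebesgue_outer_open[OF this \<delta>] obtain U where U: "open U" "E \<subseteq> U"
      "U - E \<in> lmeasurable" "emeasure lebesgue (U - E) < ennreal \<delta>" by blast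
    have Um: "U \<in> lmeasurable" "measure lebesgue U < \<delta>"
    proof -
      have "emeasure lebesgue U = emeasure lebesgue ((U - E) \<union> E)"
        using U(2) by (simp add: Un_absorb2)
      also have "\<dots> = emeasure lebesgue (U - E)"
        by (rule emeasure_Un_null_set) (use U(3) EN in auto)
      finally have *: "emeasure lebesgue U < ennreal \<delta>" using U(4) by simp
      have "U \<in> sets lebesgue" using U(1) by simp
      moreover have "emeasure lebesgue U < \<infinity>"
        unfolding infinity_ennreal_def by (rule order_less_trans[OF * ennreal_less_top])
      ultimately show Ul: "U \<in> lmeasurable" by (rule fmeasurableI)
      show "measure lebesgue U < \<delta>" using * \<delta> unfolding emeasure_eq_measure2[OF Ul]
        by (simp add: ennreal_less_iff)
    qed
    have "\<exists>r>0. (x \<in> E \<longrightarrow> ball x r \<subseteq> U) \<and> (x \<in> {0..1} - E \<longrightarrow>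
        (\<forall>y\<in>{0..1}. norm (y-x) < r \<longrightarrow> norm (h y - h x - (y-x) *\<^sub>R h' x) \<le> e/2 * norm (y-x)))" for x
    proof (cases "x \<in> E")
      case True
      then obtain r where "r > 0" "ball x r \<subseteq> U" using U openE by blast
      then show ?thesis using True by blast
    next
      case False
      show ?thesis
      proof (cases "x \<in> {0..1}")
        case True
        with False der have "(h has_vector_derivative h' x) (at x within {0..1})" by auto
        moreover have "e/2 > 0" using e by simp
        ultimately have "\<exists>r>0. \<forall>y\<in>{0..1}. norm (y-x) < r \<longrightarrow> norm (h y - h x - (y-x) *\<^sub>R h' x) \<le> e/2 * norm (y-x)"
          unfolding has_vector_derivative_def has_derivative_within_alt by blast
        then show ?thesis using False by blast
      qed (use False in \<open>auto intro: exI[of _ 1]\<close>)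
    qed
    then have "\<exists>r. \<forall>x. r x > 0 \<and> (x \<in> E \<longrightarrow> ball x (r x) \<subseteq> U) \<and> (x \<in> {0..1} - E \<longrightarrow>
        (\<forall>y\<in>{0..1}. norm (y-x) < r x \<longrightarrow> norm (h y - h x - (y-x) *\<^sub>R h' x) \<le> e/2 * norm (y-x)))"
      by (intro choice allI)
    then obtain r where r: "\<And>x. r x > 0" "\<And>x. x \<in> E \<Longrightarrow> ball x (r x) \<subseteq> U"
      "\<And>x y. \<lbrakk>x \<in> {0..1} - E; y \<in> {0..1}; norm (y-x) < r x\<rbrakk> \<Longrightarrow> norm (h y - h x - (y-x) *\<^sub>R h' x) \<le> e/2 * norm (y-x)"
      by blast
    show ?thesis
    proof (intro exI conjI allI impI)
      show "gauge (\<lambda>x. ball x (r x))" using r(1) gauge_ball_dependent by blast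
      fix p assume p: "p tagged_division_of {0..T} \<and> (\<lambda>x. ball x (r x)) fine p"
      then have ptag: "p tagged_division_of {0..T}" and pfine: "(\<lambda>x. ball x (r x)) fine p" by auto
      have fin: "finite p" by (rule tagged_division_of_finite[OF ptag])
      have int: "\<exists>u v. K = {u..v} \<and> 0 \<le> u \<and> u \<le> x \<and> x \<le> v \<and> v \<le> T \<and> K \<subseteq> ball x (r x)" if xK: "(x,K) \<in> p" for x K
      proof -
        obtain u v where uv: "K = {u..v}" using tagged_division_ofD(4)[OF ptag xK] by auto
        have "x \<in> K" "K \<subseteq> {0..T}" "K \<subseteq> ball x (r x)"
          using tagged_division_ofD(2,3)[OF ptag xK] fineD[OF pfine xK] by auto
        then show ?thesis using uv by (intro exI[of _ u] exI[of _ v]) auto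
      qed
      have b: "h T - h 0 = (\<Sum>(x,K)\<in>p. h(Sup K) - h(Inf K))" "T - 0 = (\<Sum>(x,K)\<in>p. Sup K - Inf K)"
        using additive_tagged_division_1[OF T(1) ptag, of h] additive_tagged_division_1[OF T(1) ptag, of "\<lambda>x. x"] by auto
      define p1 where "p1 = {(x,K)\<in>p. x \<in> E}"
      define p2 where "p2 = {(x,K)\<in>p. x \<notin> E}"
      have pp: "p = p1 \<union> p2" "p1 \<inter> p2 = {}" by (auto simp: p1_def p2_def)
      then have pf: "finite p1" "finite p2" using fin by auto
      let ?g = "\<lambda>(x,K). measure lborel K *\<^sub>R ?f x - (h(Sup K) - h(Inf K))"
      have "norm (sum ?g p2) \<le> (\<Sum>(x,K)\<in>p2. e/2 * (Sup K - Inf K))"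
      proof (rule sum_norm_le, safe)
        fix x K assume "(x,K) \<in> p2"
        then have xK: "(x,K) \<in> p" "x \<notin> E" by (auto simp: p2_def)
        then obtain u v where K: "K = {u..v}" "0 \<le> u" "u \<le> x" "x \<le> v" "v \<le> T" "K \<subseteq> ball x (r x)" using int by blast
        have "u \<in> K" "v \<in> K" using K(1,3,4) by auto
        then have "u \<in> ball x (r x)" "v \<in> ball x (r x)" using K(6) by blast+
        then have "norm (u - x) < r x" "norm (v - x) < r x" by (auto simp: dist_real_def)
        moreover have "x \<in> {0..1} - E" "u \<in> {0..1}" "v \<in> {0..1}" using K T xK by auto
        ultimately have "norm (h u - h x - (u-x) *\<^sub>R h' x) \<le> e/2 * norm (u-x)" "norm (h v - h x - (v-x) *\<^sub>R h' x) \<le> e/2 * norm (v-x)"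
          using r(3)[of x u] r(3)[of x v] by blast+
        moreover have "norm (u-x) = x - u" "norm (v - x) = v - x" using K by auto
        moreover have "measure lborel K *\<^sub>R ?f x - (h(Sup K) - h(Inf K)) = (h u - h x - (u-x) *\<^sub>R h' x) - (h v - h x - (v-x) *\<^sub>R h' x)"
          using K xK by (simp add: algebra_simps)
        ultimately have "norm (measure lborel K *\<^sub>R ?f x - (h(Sup K) - h(Inf K))) \<le> e/2 * (x-u) + e/2*(v-x)"
          using norm_triangle_ineq4[of "h u - h x - (u-x) *\<^sub>R h' x" "h v - h x - (v-x) *\<^sub>R h' x"] by (smt (verit))
        also have "\<dots> = e/2 * (Sup K - Inf K)" using K by (simp add: field_simps)
        finally show "norm (measure lborel K *\<^sub>R ?f x - (h(Sup K) - h(Inf K))) \<le> e/2 * (Sup K - Inf K)" .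
      qed
      also have "\<dots> \<le> (\<Sum>(x,K)\<in>p. e/2 * (Sup K - Inf K))"
      proof (rule sum_mono2)
        show "finite p" "p2 \<subseteq> p" using fin pp by auto
        fix b assume "b \<in> p - p2"
        then show "0 \<le> (case b of (x, K) \<Rightarrow> e / 2 * (Sup K - Inf K))"
          using int e by (cases b) fastforce
      qed
      also have "\<dots> = e/2 * T" using b(2) by (simp add: sum_distrib_left case_prod_beta)
      finally have n2: "norm (sum ?g p2) \<le> e/2" using T e by (smt (verit) mult_left_le half_gt_zero)
      \<comment> \<open>Degenerate intervals are discarded: their increments vanish, and only a
        nondegenerate interval determines its tag, because a second tagged copy would have the same
        nonempty interior.\<close>
      define P where "P = {(u,v). u < v \<and> (\<exists>x. (x,{u..v}) \<in> p1)}"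
      have Pimg: "P \<subseteq> (\<lambda>(x,K). (Inf K, Sup K)) ` p1"
        by (force simp: P_def image_iff)
      have finP: "finite P" using finite_subset[OF Pimg] pf by auto
      have dis: "{u<..<v} \<inter> {u'<..<v'} = {}" if "(x,{u..v}) \<in> p" "(x',{u'..v'}) \<in> p" "(x,{u..v}) \<noteq> (x',{u'..v'})" for x x' u v u' v'
      proof -
        show ?thesis using tagged_division_ofD(5)[OF ptag that] by simp
      qed
      have Pdis: "v \<le> u' \<or> v' \<le> u" if uv: "(u,v) \<in> P" "(u',v') \<in> P" "(u,v) \<noteq> (u',v')" for u v u' v'
      proof -
        obtain x x' where x: "(x,{u..v}) \<in> p" "(x',{u'..v'}) \<in> p" "u < v" "u' < v'" using uv(1,2) unfolding P_def p1_def by blast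
        have "{u..v} \<noteq> {u'..v'}" using uv x by (auto simp: Icc_eq_Icc)
        then have d: "{u<..<v} \<inter> {u'<..<v'} = {}" using dis x by blast
        show ?thesis
        proof (rule ccontr)
          assume n: "\<not> ?thesis"
          define w where "w = (max u u' + min v v')/2"
          have "w \<in> {u<..<v} \<inter> {u'<..<v'}" using n x by (auto simp: w_def max_def min_def)
          then show False using d by auto
        qed
      qed
      have Pb: "0 \<le> u \<and> u < v \<and> v \<le> 1 \<and> {u..v} \<subseteq> U" if uv: "(u,v) \<in> P" for u v
      proof -
        obtain x where x: "(x,{u..v}) \<in> p" "u < v" "x \<in> E" using uv unfolding P_def p1_def by blast
        from int[OF x(1)] show ?thesis using x r(2)[of x] T by (auto simp: Icc_eq_Icc)
      qed
      have "(\<Sum>(u,v)\<in>P. v - u) = (\<Sum>i\<in>P. measure lebesgue {fst i<..<snd i})"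
        by (rule sum.cong) (use Pb in \<open>auto simp: less_imp_le\<close>)
      also have "\<dots> = measure lebesgue (\<Union>i\<in>P. {fst i<..<snd i})"
      proof (rule measure_finite_Union[symmetric])
        show "finite P" by fact
        show "(\<lambda>i. {fst i<..<snd i}) ` P \<subseteq> sets lebesgue" by auto
        show "disjoint_family_on (\<lambda>i. {fst i<..<snd i}) P"
          unfolding disjoint_family_on_def using Pdis by fastforce
        show "\<And>i. i \<in> P \<Longrightarrow> emeasure lebesgue {fst i<..<snd i} \<noteq> \<infinity>"
          using Pb by (auto simp: less_imp_le)
      qed
      also have "\<dots> \<le> measure lebesgue U"
      proof (rule measure_mono_fmeasurable)
        show "(\<Union>i\<in>P. {fst i<..<snd i}) \<subseteq> U"
        proof (clarsimp)
          fix x u v assume "(u,v) \<in> P" "u < x" "x < v"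
          with Pb[of u v] show "x \<in> U" by (auto simp: subset_iff)
        qed
      qed (use Um finP in auto)
      finally have "(\<Sum>(u,v)\<in>P. v - u) < \<delta>" using Um by linarith
      then have s: "(\<Sum>(u,v)\<in>P. norm (\<gamma> v - \<gamma> u)) < e / (2 * C')"
        using fam[OF finP _ Pdis] Pb by blast
      have "norm (sum ?g p1) \<le> (\<Sum>(x,K)\<in>p1. C' * norm (\<gamma> (Sup K) - \<gamma> (Inf K)))"
      proof (rule sum_norm_le, safe)
        fix x K assume "(x,K) \<in> p1"
        then have xK: "(x,K) \<in> p" "x \<in> E" by (auto simp: p1_def)
        then obtain u v where K: "K = {u..v}" "0 \<le> u" "u \<le> x" "x \<le> v" "v \<le> T" using int by blast
        have "\<bar>h v - h u\<bar> \<le> C * norm (\<gamma> v - \<gamma> u)" using dom K T by auto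
        also have "\<dots> \<le> C' * norm (\<gamma> v - \<gamma> u)" using C' by (intro mult_right_mono) auto
        finally show "norm (measure lborel K *\<^sub>R ?f x - (h(Sup K) - h(Inf K))) \<le> C' * norm (\<gamma> (Sup K) - \<gamma> (Inf K))"
          using K xK by auto
      qed
      also have "\<dots> = (\<Sum>(x,K)\<in>{(x,K)\<in>p1. Inf K < Sup K}. C' * norm (\<gamma> (Sup K) - \<gamma> (Inf K)))"
      proof (rule sum.mono_neutral_right)
        show "\<forall>i\<in>p1 - {(x, K). (x, K) \<in> p1 \<and> Inf K < Sup K}. (case i of (x, K) \<Rightarrow> C' * norm (\<gamma> (Sup K) - \<gamma> (Inf K))) = 0"
        proof
          fix i assume i: "i \<in> p1 - {(x, K). (x, K) \<in> p1 \<and> Inf K < Sup K}"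
          obtain x K where xK: "i = (x,K)" by (cases i)
          then have K: "(x,K) \<in> p" "\<not> Inf K < Sup K" using i by (auto simp: p1_def)
          obtain u v where "K = {u..v}" "u \<le> v" using int[OF K(1)] by auto
          then show "(case i of (x, K) \<Rightarrow> C' * norm (\<gamma> (Sup K) - \<gamma> (Inf K))) = 0" using xK K(2) by auto
        qed
      qed (use pf in auto)
      also have "\<dots> = (\<Sum>i\<in>P. C' * norm (\<gamma> (snd i) - \<gamma> (fst i)))"
      proof -
        have bij: "bij_betw (\<lambda>(x, K). (Inf K, Sup K)) {(x, K). (x, K) \<in> p1 \<and> Inf K < Sup K} P"
          unfolding bij_betw_def
        proof
          show "inj_on (\<lambda>(x, K). (Inf K, Sup K)) {(x, K). (x, K) \<in> p1 \<and> Inf K < Sup K}"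
          proof (rule inj_onI, clarify)
            fix x K x' K' assume *: "(x,K) \<in> p1" "(x',K') \<in> p1" "Inf K < Sup K" "Inf K = Inf K'" "Sup K = Sup K'"
            then obtain u v u' v' where "K = {u..v}" "u \<le> v" "K' = {u'..v'}" "u' \<le> v'"
              using int[of x K] int[of x' K'] unfolding p1_def by auto
            then have K: "K = {u..v}" "K' = {u..v}" "u < v" using * by auto
            show "x = x' \<and> K = K'"
            proof (rule ccontr)
              assume n: "\<not> (x = x' \<and> K = K')"
              have "{u<..<v} \<inter> {u<..<v} = {}" using dis[of x u v x' u v] * K n by (auto simp: p1_def)
              then show False using K dense by fastforce
            qed
          qed
          show "(\<lambda>(x, K). (Inf K, Sup K)) ` {(x, K). (x, K) \<in> p1 \<and> Inf K < Sup K} = P"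
          proof safe
            fix x K assume *: "(x,K) \<in> p1" "Inf K < Sup K"
            then obtain u v where "K = {u..v}" "u \<le> v" using int[of x K] unfolding p1_def by auto
            then show "(Inf K, Sup K) \<in> P" using * by (auto simp: P_def)
          next
            fix u v assume "(u,v) \<in> P"
            then obtain x where "(x,{u..v}) \<in> p1" "u < v" by (auto simp: P_def)
            then show "(u,v) \<in> (\<lambda>(x, K). (Inf K, Sup K)) ` {(x, K). (x, K) \<in> p1 \<and> Inf K < Sup K}"
              by (intro image_eqI[of _ _ "(x,{u..v})"]) auto
          qed
        qed
        show ?thesis using sum.reindex_bij_betw[OF bij, of "\<lambda>i. C' * norm (\<gamma> (snd i) - \<gamma> (fst i))"]
          by (simp add: case_prod_beta)
      qed
      also have "\<dots> = C' * (\<Sum>(u,v)\<in>P. norm (\<gamma> v - \<gamma> u))"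
        by (simp add: sum_distrib_left case_prod_beta)
      also have "\<dots> \<le> C' * (e / (2*C'))" using s C' by (intro mult_left_mono) auto
      also have "\<dots> = e/2" using C' by simp
      finally have n1: "norm (sum ?g p1) \<le> e/2" .
      have "(\<Sum>(x,k)\<in>p. measure lborel k *\<^sub>R ?f x) - (h T - h 0) = sum ?g p"
        unfolding b(1) by (simp add: sum_subtractf[symmetric] case_prod_beta)
      also have "\<dots> = sum ?g p1 + sum ?g p2" unfolding pp(1) by (rule sum.union_disjoint) (use pp pf in auto)
      finally show "norm ((\<Sum>(x,k)\<in>p. measure lborel k *\<^sub>R ?f x) - (h T - h 0)) \<le> e"
        using order_trans[OF norm_triangle_ineq add_mono[OF n1 n2]] by simp
    qed
  qed
  then have "\<exists>d. gauge d \<and> (\<forall>p. p tagged_division_of {0..T} \<and> d fine p \<longrightarrow>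
      norm ((\<Sum>(x,k)\<in>p. measure lborel k *\<^sub>R ?f x) - (h T - h 0)) < e)" if e: "e > 0" for e
    using e by (meson field_lbound_gt_zero order_le_less_trans)
  then show ?thesis unfolding has_integral_real by blast
qed

section \<open>Calibrations\<close>

lemma lipschitz_on_mult_cball:
  fixes f g :: "'a::real_normed_vector \<Rightarrow> real"
  assumes "\<exists>C. C-lipschitz_on (cball 0 B) f" "\<exists>C. C-lipschitz_on (cball 0 B) g" "B \<ge> 0"
  shows "\<exists>C. C-lipschitz_on (cball 0 B) (\<lambda>x. f x * g x)"
proof -
  obtain C D where C: "C-lipschitz_on (cball 0 B) f" and D: "D-lipschitz_on (cball 0 B) g"
    using assms by blast
  have C0: "C \<ge> 0" and D0: "D \<ge> 0" using C D lipschitz_on_nonneg by blast+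
  have bound: "\<bar>h x\<bar> \<le> \<bar>h 0\<bar> + L * B" if L: "L-lipschitz_on (cball 0 B) h" and x: "x \<in> cball 0 B" for h :: "'a \<Rightarrow> real" and L x
  proof -
    have "\<bar>h x - h 0\<bar> \<le> L * norm (x - 0)"
      using lipschitz_on_normD[OF L x, of 0] assms(3) by simp
    also have "\<dots> \<le> L * B" using x lipschitz_on_nonneg[OF L] by (intro mult_left_mono) auto
    finally show ?thesis by linarith
  qed
  define F where "F = \<bar>f 0\<bar> + C * B"
  define G where "G = \<bar>g 0\<bar> + D * B"
  have F0: "F \<ge> 0" and G0: "G \<ge> 0" using C0 D0 assms(3) by (auto simp: F_def G_def)
  have "(F * D + G * C)-lipschitz_on (cball 0 B) (\<lambda>x. f x * g x)"
  proof (rule lipschitz_onI)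
    fix x y :: 'a assume xy: "x \<in> cball 0 B" "y \<in> cball 0 B"
    have "f x * g x - f y * g y = f x * (g x - g y) + g y * (f x - f y)" by (simp add: algebra_simps)
    then have "\<bar>f x * g x - f y * g y\<bar> \<le> \<bar>f x\<bar> * \<bar>g x - g y\<bar> + \<bar>g y\<bar> * \<bar>f x - f y\<bar>"
      by (metis abs_mult abs_triangle_ineq)
    also have "\<dots> \<le> F * (D * norm (x - y)) + G * (C * norm (x - y))"
      using bound[OF C xy(1)] bound[OF D xy(2)] lipschitz_on_normD[OF C xy] lipschitz_on_normD[OF D xy] F0 G0
      by (intro add_mono mult_mono) (auto simp: F_def G_def)
    finally show "dist (f x * g x) (f y * g y) \<le> (F * D + G * C) * dist x y"
      by (simp add: dist_norm algebra_simps)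
  qed (use F0 G0 C0 D0 in auto)
  then show ?thesis by blast
qed

lemma lipschitz_on_add_cball:
  fixes f g :: "'a::real_normed_vector \<Rightarrow> real"
  assumes "\<exists>C. C-lipschitz_on (cball 0 B) f" "\<exists>C. C-lipschitz_on (cball 0 B) g"
  shows "\<exists>C. C-lipschitz_on (cball 0 B) (\<lambda>x. f x + g x)"
  using assms lipschitz_on_add by blast

lemma lipschitz_on_linear_cball:
  fixes f :: "'a::real_normed_vector \<Rightarrow> real"
  assumes "bounded_linear f"
  shows "\<exists>C. C-lipschitz_on (cball 0 B) f"
proof -
  interpret bounded_linear f by fact
  show ?thesis using lipschitz_boundE[of "cball 0 B"] by metis
qed

text \<open>A potential for the form \<open>(A - w (b + k x)^2) dx + (b + k x) dy\<close> along horizontal curves, on which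
  \<open>d(z + x y / 2) = x dy\<close>.\<close>
definition calib :: "real \<Rightarrow> real \<Rightarrow> real \<Rightarrow> real \<Rightarrow> R3 \<Rightarrow> real" where
  "calib A w b k p = A * fst p - w * (b\<^sup>2 * fst p + b * k * (fst p)\<^sup>2 + k\<^sup>2 * (fst p)^3 / 3)
     + b * fst (snd p) + k * (snd (snd p) + fst p * fst (snd p) / 2)"

text \<open>The potential is a cubic polynomial, hence Lipschitz only on bounded sets. This suffices
  because an admissible curve is bounded, and it supplies the hypothesis \<open>dom\<close> of
  \<open>abs_cont_01_ftc\<close>.\<close>

lemma calib_lipschitz: 
  assumes "B \<ge> 0"
  shows "\<exists>C. C-lipschitz_on (cball 0 B) (calib A w b k)"
proof -
  have [simp]: "\<exists>C. C-lipschitz_on (cball 0 B) (fst :: R3 \<Rightarrow> real)"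
    by (intro lipschitz_on_linear_cball bounded_linear_fst)
  have [simp]: "\<exists>C. C-lipschitz_on (cball 0 B) (\<lambda>p::R3. fst (snd p))" "\<exists>C. C-lipschitz_on (cball 0 B) (\<lambda>p::R3. snd (snd p))"
    by (intro lipschitz_on_linear_cball bounded_linear_fst_comp bounded_linear_snd_comp bounded_linear_snd bounded_linear_fst)+
  have [simp]: "\<exists>C. C-lipschitz_on (cball 0 B) (\<lambda>p::R3. c)" for c :: real
    using lipschitz_on_constant by blast
  have eq: "calib A w b k = (\<lambda>p. (A - w * b\<^sup>2) * fst p + ((- w * b * k) * (fst p * fst p) + ((- w * k\<^sup>2 / 3) * (fst p * (fst p * fst p))
     + (b * fst (snd p) + (k * snd (snd p) + (k/2) * (fst p * fst (snd p)))))))"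
    by (auto simp: calib_def power2_eq_square power3_eq_cube algebra_simps)
  show ?thesis unfolding eq
    by (intro lipschitz_on_add_cball lipschitz_on_mult_cball assms) simp_all
qed

lemma calib_deriv:
  assumes "(\<gamma> has_vector_derivative (u1 *\<^sub>R X1 (\<gamma> t) + u2 *\<^sub>R X2 (\<gamma> t))) (at t within S)"
  shows "((\<lambda>t. calib A w b k (\<gamma> t)) has_vector_derivative
     (A - w * (b + k * fst (\<gamma> t))\<^sup>2) * u1 + (b + k * fst (\<gamma> t)) * u2) (at t within S)"
proof -
  have eq: "u1 *\<^sub>R X1 (\<gamma> t) + u2 *\<^sub>R X2 (\<gamma> t) = (u1, u2, (fst (\<gamma> t) * u2 - fst (snd (\<gamma> t)) * u1) / 2)"
    by (cases "\<gamma> t") (simp add: X1_def X2_def algebra_simps diff_divide_distrib)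
  have d: "(\<gamma> has_derivative (\<lambda>h. h *\<^sub>R (u1, u2, (fst (\<gamma> t) * u2 - fst (snd (\<gamma> t)) * u1) / 2))) (at t within S)"
    using assms unfolding eq has_vector_derivative_def .
  have x: "((\<lambda>t. fst (\<gamma> t)) has_field_derivative u1) (at t within S)"
    using has_derivative_fst[OF d] by (simp add: has_field_derivative_def mult_commute_abs)
  have y: "((\<lambda>t. fst (snd (\<gamma> t))) has_field_derivative u2) (at t within S)"
    using has_derivative_fst[OF has_derivative_snd[OF d]] by (simp add: has_field_derivative_def mult_commute_abs)
  have z: "((\<lambda>t. snd (snd (\<gamma> t))) has_field_derivative (fst (\<gamma> t) * u2 - fst (snd (\<gamma> t)) * u1) / 2) (at t within S)"
    unfolding has_field_derivative_def
    by (rule has_derivative_eq_rhs[OF has_derivative_snd[OF has_derivative_snd[OF d]]]) (auto simp: fun_eq_iff)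
  show ?thesis unfolding calib_def has_real_derivative_iff_has_vector_derivative[symmetric]
    by (rule derivative_eq_intros x y z refl | simp)+ (simp add: power2_eq_square field_simps)
qed

lemma abs_cont_01_bounded:
  assumes "abs_cont_01 \<gamma>"
  obtains B where "B \<ge> 0" "\<And>t. t \<in> {0..1} \<Longrightarrow> norm (\<gamma> t) \<le> B"
proof -
  have "continuous_on {0..1} \<gamma>"
    unfolding continuous_on_iff
  proof (intro ballI allI impI)
    fix x e :: real assume x: "x \<in> {0..1}" and e: "e > 0"
    then obtain d where d: "d > 0" and *: "\<And>(n::nat) a b.
        \<lbrakk>\<forall>i<n. 0 \<le> a i \<and> a i \<le> b i \<and> b i \<le> 1; \<forall>i j. i < j \<and> j < n \<longrightarrow> b i \<le> a j;
        (\<Sum>i<n. b i - a i) < d\<rbrakk> \<Longrightarrow> (\<Sum>i<n. norm (\<gamma> (b i) - \<gamma> (a i))) < e"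
      using assms[unfolded abs_cont_01_def, rule_format, OF e] by blast
    have "dist (\<gamma> y) (\<gamma> x) < e" if y: "y \<in> {0..1}" "dist y x < d" for y
    proof -
      have "(\<Sum>i<Suc 0. norm (\<gamma> (max x y) - \<gamma> (min x y))) < e"
        by (rule *[of "Suc 0" "\<lambda>_. min x y" "\<lambda>_. max x y"]) (use x y in \<open>auto simp: dist_real_def\<close>)
      then show ?thesis by (auto simp: dist_norm max_def min_def norm_minus_commute split: if_splits)
    qed
    then show "\<exists>d>0. \<forall>x'\<in>{0..1}. dist x' x < d \<longrightarrow> dist (\<gamma> x') (\<gamma> x) < e" using d by blast
  qed
  then have "bounded (\<gamma> ` {0..1})" by (intro compact_imp_bounded compact_continuous_image) auto
  then obtain B where B: "\<forall>x\<in>\<gamma> ` {0..1}. norm x \<le> B" unfolding bounded_iff by blast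
  show ?thesis
  proof (rule that[of "max B 0"])
    show "norm (\<gamma> t) \<le> max B 0" if "t \<in> {0..1}" for t
      using B that by (simp add: le_max_iff_disj)
  qed simp
qed

section \<open>Norms on the plane and lengths of admissible curves\<close>

lemma is_normD:
  assumes "is_norm n"
  shows "n v \<ge> 0" "n v = 0 \<longleftrightarrow> v = 0" "n (c *\<^sub>R v) = \<bar>c\<bar> * n v" "n (v + w) \<le> n v + n w"
  using assms unfolding is_norm_def by blast+

lemma is_norm_bound:
  assumes "is_norm n"
  obtains C where "C > 0" "\<And>v. n v \<le> C * norm v"
proof -
  define C where "C = n (1,0) + n (0,1) + 1"
  have 0: "n v \<ge> 0" for v by (rule is_normD[OF assms])
  have "n v \<le> C * norm v" for v
  proof -
    have "n v = n (fst v *\<^sub>R (1,0) + snd v *\<^sub>R (0,1))" by (simp)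
    also have "\<dots> \<le> \<bar>fst v\<bar> * n (1,0) + \<bar>snd v\<bar> * n (0,1)"
      using is_normD(4)[OF assms, of "fst v *\<^sub>R (1,0)" "snd v *\<^sub>R (0,1)"] by (simp only: is_normD(3)[OF assms])
    also have "\<dots> \<le> norm v * n (1,0) + norm v * n (0,1)"
      using norm_fst_le[of "fst v" "snd v"] norm_snd_le[of "snd v" "fst v"] 0
      by (intro add_mono mult_right_mono) auto
    also have "\<dots> \<le> C * norm v" by (simp add: C_def algebra_simps)
    finally show ?thesis .
  qed
  moreover have "C > 0" using 0[of "(1,0)"] 0[of "(0,1)"] by (simp add: C_def)
  ultimately show ?thesis using that by blast
qed

lemma is_norm_diff:
  assumes "is_norm n" shows "\<bar>n v - n w\<bar> \<le> n (v - w)"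
proof -
  have t: "n (x + y) \<le> n x + n y" for x y by (rule is_normD(4)[OF assms])
  have "n (w - v) = n (v - w)" using is_normD(3)[OF assms, of "-1" "v - w"] by simp
  then show ?thesis using t[of "v - w" w] t[of "w - v" v] by simp
qed

lemma is_norm_continuous:
  assumes "is_norm n" shows "continuous_on S n"
proof -
  obtain C where C: "C > 0" "\<And>v. n v \<le> C * norm v" using is_norm_bound[OF assms] by blast
  have "C-lipschitz_on S n"
  proof (rule lipschitz_onI)
    fix v w show "dist (n v) (n w) \<le> C * dist v w"
      using is_norm_diff[OF assms, of v w] C(2)[of "v - w"] by (simp only: dist_norm real_norm_def)
  qed (use C in simp)
  then show ?thesis by (rule lipschitz_on_continuous_on)
qed

text \<open>\<open>sf_length\<close> is a Bochner integral and would be 0 for a non-integrable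
  integrand, so lower bounds on lengths need this. On a bounded interval square integrability is
  enough.\<close>

lemma admissible_integrable:
  assumes "is_norm n" "admissible \<gamma> u"
  shows "integrable (lebesgue_on {0..1}) (\<lambda>t. n (u t))"
proof -
  obtain C where C: "C > 0" "\<And>v. n v \<le> C * norm v" using is_norm_bound[OF assms(1)] by blast
  have um: "u \<in> borel_measurable (lebesgue_on {0..1})" and
    ui: "integrable (lebesgue_on {0..1}) (\<lambda>t. (norm (u t))\<^sup>2)" using assms(2) by (auto simp: admissible_def)
  have nb: "n \<in> borel_measurable borel" 
    by (rule borel_measurable_continuous_onI[OF is_norm_continuous[OF assms(1)]])
  have 1: "integrable (lebesgue_on {0..1}) (\<lambda>t. C * (1 + (norm (u t))\<^sup>2))"
    by (intro integrable_mult_right Bochner_Integration.integrable_add ui continuous_imp_integrable_real continuous_intros)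
  show ?thesis
  proof (rule Bochner_Integration.integrable_bound[OF 1])
    show "(\<lambda>t. n (u t)) \<in> borel_measurable (lebesgue_on {0..1})"
      using measurable_compose[OF um nb] .
    have "norm (n v) \<le> norm (C * (1 + (norm v)\<^sup>2))" for v
    proof -
      have "n v \<ge> 0" by (rule is_normD[OF assms(1)])
      moreover have "norm v \<le> 1 + (norm v)\<^sup>2"
        using zero_le_power2[of "norm v - 1/2"] by (simp add: power2_eq_square algebra_simps)
      then have "C * norm v \<le> C * (1 + (norm v)\<^sup>2)" using C by (intro mult_left_mono) auto
      then have "n v \<le> C * (1 + (norm v)\<^sup>2)" using C(2)[of v] by linarith
      ultimately show ?thesis by simp
    qed
    then show "AE x in lebesgue_on {0..1}. norm (n (u x)) \<le> norm (C * (1 + (norm (u x))\<^sup>2))" by simp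
  qed
qed

lemma sf_length_eq:
  assumes "is_norm n" "admissible \<gamma> u"
  shows "((\<lambda>t. n (u t)) has_integral sf_length n u) {0..1}"
  unfolding sf_length_def by (intro has_integral_integral_lebesgue_on admissible_integrable[OF assms]) auto

lemma integral_le_sf_length:
  assumes "is_norm n" "admissible \<gamma> u" "0 \<le> T" "T \<le> 1"
  shows "(\<lambda>t. n (u t)) integrable_on {0..T}" "integral {0..T} (\<lambda>t. n (u t)) \<le> sf_length n u"
proof -
  have i: "(\<lambda>t. n (u t)) integrable_on {0..1}" using sf_length_eq[OF assms(1,2)] by blast
  then show j: "(\<lambda>t. n (u t)) integrable_on {0..T}" using assms(3,4) integrable_on_subinterval by fastforce
  have "integral {0..T} (\<lambda>t. n (u t)) \<le> integral {0..1} (\<lambda>t. n (u t))"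
    by (rule integral_subset_le[OF _ j i]) (use assms is_normD(1)[OF assms(1)] in auto)
  also have "\<dots> = sf_length n u" using sf_length_eq[OF assms(1,2)] by blast
  finally show "integral {0..T} (\<lambda>t. n (u t)) \<le> sf_length n u" .
qed

text \<open>At almost every time the form is at most \<open>n (u t)\<close> on the velocity;
  integrate. The covector is required to have dual norm at most one only where the curve passes,
  because the quadratic expansion of the norm gives this only in a strip. Times \<open>T < 1\<close>
  serve to show that the curve stays in that strip.\<close>

lemma calib_le_length:
  assumes n: "is_norm n" and adm: "admissible \<gamma> u" and T: "0 \<le> T" "T \<le> 1"
    and dual: "\<And>t v1 v2. t \<in> {0..T} \<Longrightarrow>
       (A - w * (b + k * fst (\<gamma> t))\<^sup>2) * v1 + (b + k * fst (\<gamma> t)) * v2 \<le> n (v1, v2)"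
  shows "calib A w b k (\<gamma> T) - calib A w b k (\<gamma> 0) \<le> sf_length n u"
proof -
  have ac: "abs_cont_01 \<gamma>" using adm by (simp add: admissible_def)
  obtain B where B: "B \<ge> 0" "\<And>t. t \<in> {0..1} \<Longrightarrow> norm (\<gamma> t) \<le> B" using abs_cont_01_bounded[OF ac] by blast
  obtain C where C: "C-lipschitz_on (cball 0 B) (calib A w b k)" using calib_lipschitz[OF B(1)] by blast
  define bad where "bad = {t\<in>{0..1}. \<not> (\<gamma> has_vector_derivative (fst (u t) *\<^sub>R X1 (\<gamma> t) + snd (u t) *\<^sub>R X2 (\<gamma> t))) (at t within {0..1})}"
  have "AE t in lebesgue_on {0..1}. (\<gamma> has_vector_derivative (fst (u t) *\<^sub>R X1 (\<gamma> t) + snd (u t) *\<^sub>R X2 (\<gamma> t))) (at t within {0..1})"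
    using adm by (simp add: admissible_def)
  then have "AE t in lebesgue. t \<in> {0..1} \<longrightarrow> (\<gamma> has_vector_derivative (fst (u t) *\<^sub>R X1 (\<gamma> t) + snd (u t) *\<^sub>R X2 (\<gamma> t))) (at t within {0..1})"
    by (subst (asm) AE_restrict_space_iff) auto
  then obtain N where N: "N \<in> null_sets lebesgue" "bad \<subseteq> N"
    unfolding bad_def by (auto simp: eventually_ae_filter)
  then have neg: "negligible N" by (simp add: negligible_iff_null_sets)
  let ?h' = "\<lambda>t. (A - w * (b + k * fst (\<gamma> t))\<^sup>2) * fst (u t) + (b + k * fst (\<gamma> t)) * snd (u t)"
  have I: "((\<lambda>t. if t \<in> N then 0 else ?h' t) has_integral calib A w b k (\<gamma> T) - calib A w b k (\<gamma> 0)) {0..T}"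
  proof (rule abs_cont_01_ftc[OF ac T _ neg])
    fix s t :: real assume st: "s \<in> {0..1}" "t \<in> {0..1}"
    then show "\<bar>calib A w b k (\<gamma> t) - calib A w b k (\<gamma> s)\<bar> \<le> C * norm (\<gamma> t - \<gamma> s)"
      using lipschitz_on_normD[OF C, of "\<gamma> t" "\<gamma> s"] B by auto
  next
    fix t :: real assume "t \<in> {0..1} - N"
    then have "(\<gamma> has_vector_derivative (fst (u t) *\<^sub>R X1 (\<gamma> t) + snd (u t) *\<^sub>R X2 (\<gamma> t))) (at t within {0..1})"
      using N by (auto simp: bad_def)
    then show "((\<lambda>t. calib A w b k (\<gamma> t)) has_vector_derivative ?h' t) (at t within {0..1})"
      by (rule calib_deriv)
  qed
  have "calib A w b k (\<gamma> T) - calib A w b k (\<gamma> 0) \<le> integral {0..T} (\<lambda>t. n (u t))"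
  proof (rule has_integral_le[OF I])
    show "((\<lambda>t. n (u t)) has_integral integral {0..T} (\<lambda>t. n (u t))) {0..T}"
      using integral_le_sf_length(1)[OF n adm T] by (rule integrable_integral)
    fix t assume t: "t \<in> {0..T}"
    have "0 \<le> n (u t)" by (rule is_normD[OF n])
    then show "(if t \<in> N then 0 else ?h' t) \<le> n (u t)"
      using dual[OF t, of "fst (u t)" "snd (u t)"] by simp
  qed
  then show ?thesis using integral_le_sf_length(2)[OF n adm T] by linarith
qed

section \<open>Bounds for the sub-Finsler distance\<close>

lemma admissible_C1:
  assumes u: "continuous_on {0..1} u"
    and der: "\<And>t. t \<in> {0..1} \<Longrightarrow> (\<gamma> has_vector_derivative (fst (u t) *\<^sub>R X1 (\<gamma> t) + snd (u t) *\<^sub>R X2 (\<gamma> t))) (at t within {0..1})"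
  shows "admissible \<gamma> u"
proof -
  let ?D = "\<lambda>t. fst (u t) *\<^sub>R X1 (\<gamma> t) + snd (u t) *\<^sub>R X2 (\<gamma> t)"
  have c: "continuous_on {0..1} \<gamma>"
    using der has_vector_derivative_continuous continuous_on_eq_continuous_within by blast
  have "continuous_on {0..1} ?D"
    unfolding X1_def X2_def case_prod_beta
    by (intro continuous_intros u c) simp_all
  then have "bounded (?D ` {0..1})" by (intro compact_imp_bounded compact_continuous_image) auto
  then obtain M where M: "M > 0" "\<And>t. t \<in> {0..1} \<Longrightarrow> norm (?D t) \<le> M"
    unfolding bounded_pos by blast
  have lip: "norm (\<gamma> t - \<gamma> s) \<le> M * norm (t - s)" if "s \<in> {0..1}" "t \<in> {0..1}" for s t
  proof (rule differentiable_bound[of "{0..1}" \<gamma> "\<lambda>t h. h *\<^sub>R ?D t"])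
    show "\<And>x. x \<in> {0..1} \<Longrightarrow> (\<gamma> has_derivative (\<lambda>h. h *\<^sub>R ?D x)) (at x within {0..1})"
      using der unfolding has_vector_derivative_def .
    show "onorm (\<lambda>h. h *\<^sub>R ?D x) \<le> M" if "x \<in> {0..1}" for x
    proof (rule onorm_le)
      fix h :: real
      show "norm (h *\<^sub>R ?D x) \<le> M * norm h"
        unfolding norm_scaleR using mult_left_mono[OF M(2)[OF that], of "\<bar>h\<bar>"] by (simp only: mult.commute real_norm_def abs_ge_zero)
    qed
  qed (use that in auto)
  have "abs_cont_01 \<gamma>"
    unfolding abs_cont_01_def
  proof (intro allI impI)
    fix e :: real assume e: "e > 0"
    show "\<exists>\<delta>>0. \<forall>(n::nat) a b. (\<forall>i<n. 0 \<le> a i \<and> a i \<le> b i \<and> b i \<le> 1) \<and>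
        (\<forall>i j. i < j \<and> j < n \<longrightarrow> b i \<le> a j) \<and> (\<Sum>i<n. b i - a i) < \<delta>
        \<longrightarrow> (\<Sum>i<n. norm (\<gamma> (b i) - \<gamma> (a i))) < e"
    proof (rule exI[of _ "e / M"], intro conjI allI impI)
      fix n :: nat and a b :: "nat \<Rightarrow> real"
      assume *: "(\<forall>i<n. 0 \<le> a i \<and> a i \<le> b i \<and> b i \<le> 1) \<and>
        (\<forall>i j. i < j \<and> j < n \<longrightarrow> b i \<le> a j) \<and> (\<Sum>i<n. b i - a i) < e / M"
      have "(\<Sum>i<n. norm (\<gamma> (b i) - \<gamma> (a i))) \<le> (\<Sum>i<n. M * (b i - a i))"
      proof (rule sum_mono)
        fix i assume "i \<in> {..<n}"
        then have "0 \<le> a i" "a i \<le> b i" "b i \<le> 1" using * by auto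
        then show "norm (\<gamma> (b i) - \<gamma> (a i)) \<le> M * (b i - a i)"
          using lip[of "a i" "b i"] by auto
      qed
      also have "\<dots> = M * (\<Sum>i<n. b i - a i)" by (simp add: sum_distrib_left)
      also have "\<dots> < e" using * M(1) by (simp add: field_simps)
      finally show "(\<Sum>i<n. norm (\<gamma> (b i) - \<gamma> (a i))) < e" .
    qed (use e M in auto)
  qed
  moreover have "u \<in> borel_measurable (lebesgue_on {0..1})"
    by (rule continuous_imp_measurable_on_sets_lebesgue[OF u]) auto
  moreover have "integrable (lebesgue_on {0..1}) (\<lambda>t. (norm (u t))\<^sup>2)"
    by (intro continuous_imp_integrable_real continuous_intros u)
  moreover have "AE t in lebesgue_on {0..1}. (\<gamma> has_vector_derivative ?D t) (at t within {0..1})"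
    using der by (auto intro!: AE_I2)
  ultimately show ?thesis unfolding admissible_def by blast
qed

text \<open>The curve is the left translate by \<open>(a, b, c)\<close> of the horizontal curve
  \<open>(X, Y, Z)\<close> , whose last coordinate is the area swept in the plane.\<close>

lemma admissible_lift:
  assumes X: "\<And>t. (X has_real_derivative X' t) (at t)" and Y: "\<And>t. (Y has_real_derivative Y' t) (at t)"
    and Z: "\<And>t. (Z has_real_derivative (X t * Y' t - Y t * X' t) / 2) (at t)"
    and c: "continuous_on {0..1} X'" "continuous_on {0..1} Y'"
  shows "admissible (\<lambda>t. (a + X t, b + Y t, c + (a * Y t - b * X t) / 2 + Z t)) (\<lambda>t. (X' t, Y' t))"
proof (rule admissible_C1)
  show "continuous_on {0..1} (\<lambda>t. (X' t, Y' t))" by (intro continuous_intros c)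
  fix t :: real
  have eq: "fst (X' t, Y' t) *\<^sub>R X1 (a + X t, b + Y t, c + (a * Y t - b * X t) / 2 + Z t) +
         snd (X' t, Y' t) *\<^sub>R X2 (a + X t, b + Y t, c + (a * Y t - b * X t) / 2 + Z t)
      = (X' t, Y' t, (a * Y' t - b * X' t) / 2 + (X t * Y' t - Y t * X' t) / 2)"
    by (simp add: X1_def X2_def field_simps)
  have 1: "((\<lambda>t. a + X t) has_vector_derivative X' t) (at t within {0..1})"
    using has_field_derivative_at_within[OF X] unfolding has_real_derivative_iff_has_vector_derivative[symmetric]
    by (auto intro!: derivative_eq_intros)
  have 2: "((\<lambda>t. b + Y t) has_vector_derivative Y' t) (at t within {0..1})"
    using has_field_derivative_at_within[OF Y] unfolding has_real_derivative_iff_has_vector_derivative[symmetric]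
    by (auto intro!: derivative_eq_intros)
  have 3: "((\<lambda>t. c + (a * Y t - b * X t) / 2 + Z t) has_vector_derivative (a * Y' t - b * X' t) / 2 + (X t * Y' t - Y t * X' t) / 2) (at t within {0..1})"
    unfolding has_real_derivative_iff_has_vector_derivative[symmetric]
    by (rule derivative_eq_intros has_field_derivative_at_within[OF X] has_field_derivative_at_within[OF Y] has_field_derivative_at_within[OF Z] refl | simp)+
  show "((\<lambda>t. (a + X t, b + Y t, c + (a * Y t - b * X t) / 2 + Z t)) has_vector_derivative
      fst (X' t, Y' t) *\<^sub>R X1 (a + X t, b + Y t, c + (a * Y t - b * X t) / 2 + Z t) +
         snd (X' t, Y' t) *\<^sub>R X2 (a + X t, b + Y t, c + (a * Y t - b * X t) / 2 + Z t)) (at t within {0..1})"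
    unfolding eq by (intro has_vector_derivative_Pair 1 2 3)
qed

text \<open>These are the geodesics of the quadratic model: x is affine in time and the second
  control is affine too. The \<open>w\<close> term of the plane curve vanishes at both ends, so it
  only changes the final height, by \<open>x * w / 12\<close>.\<close>

lemma admissible_parabola:
  fixes x y w :: real
  shows "admissible (\<lambda>t. (a + x * t, b + (y * t + w * (t\<^sup>2 - t) / 2), c + (a * (y * t + w * (t\<^sup>2 - t) / 2) - b * (x * t)) / 2 + x * w * t^3 / 12))
     (\<lambda>t. (x, y + w * (t - 1/2)))"
proof (rule admissible_lift[where X = "\<lambda>t. x * t" and Y = "\<lambda>t. y * t + w * (t\<^sup>2 - t) / 2" and Z = "\<lambda>t. x * w * t^3 / 12"])
  fix t :: real
  show "((\<lambda>t. x * t) has_real_derivative x) (at t)"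
    by (auto intro!: derivative_eq_intros)
  show "((\<lambda>t. y * t + w * (t\<^sup>2 - t) / 2) has_real_derivative y + w * (t - 1/2)) (at t)"
    by (auto intro!: derivative_eq_intros simp: field_simps)
  show "((\<lambda>t. x * w * t^3 / 12) has_real_derivative
      (x * t * (y + w * (t - 1/2)) - (y * t + w * (t\<^sup>2 - t) / 2) * x) / 2) (at t)"
    by (rule derivative_eq_intros refl | simp)+ (simp add: field_simps power2_eq_square)
qed (intro continuous_intros)+

text \<open>The parabola cannot adjust the height when the x-displacement is 0. Here x returns to
  its starting value, and the cubic term contributes \<open>w / 60\<close> to the final
  height.\<close>

lemma admissible_loop:
  fixes y w :: real
  shows "admissible (\<lambda>t. (a + (t\<^sup>2 - t), b + (y * t + w * (t^3 - t)), c + (a * (y * t + w * (t^3 - t)) - b * (t\<^sup>2 - t)) / 2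
        + (w * (t^5/5 - t^4/2 + t^3/3) - y * t^3 / 3) / 2))
     (\<lambda>t. (2 * t - 1, y + w * (3 * t\<^sup>2 - 1)))"
proof (rule admissible_lift[where X = "\<lambda>t. t\<^sup>2 - t" and Y = "\<lambda>t. y * t + w * (t^3 - t)"
      and Z = "\<lambda>t. (w * (t^5/5 - t^4/2 + t^3/3) - y * t^3 / 3) / 2"])
  fix t :: real
  show "((\<lambda>t. t\<^sup>2 - t) has_real_derivative 2 * t - 1) (at t)"
    by (auto intro!: derivative_eq_intros)
  show "((\<lambda>t. y * t + w * (t^3 - t)) has_real_derivative y + w * (3 * t\<^sup>2 - 1)) (at t)"
    by (auto intro!: derivative_eq_intros simp: field_simps)
  show "((\<lambda>t. (w * (t^5/5 - t^4/2 + t^3/3) - y * t^3 / 3) / 2) has_real_derivative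
      ((t\<^sup>2 - t) * (y + w * (3 * t\<^sup>2 - 1)) - (y * t + w * (t^3 - t)) * (2 * t - 1)) / 2) (at t)"
    by (rule derivative_eq_intros refl | simp)+ (simp add: field_simps power2_eq_square power3_eq_cube power4_eq_xxxx)
qed (intro continuous_intros)+

text \<open>Ensures that the set in \<open>sf_dist\<close> is nonempty; the real \<open>Inf\<close>
  of the empty set would carry no information. In both cases \<open>w\<close> is solved from the
  required final height.\<close>

lemma admissible_connect:
  obtains \<gamma> u where "admissible \<gamma> u" "\<gamma> 0 = p" "\<gamma> 1 = q"
proof -
  obtain a b c a' b' c' where p: "p = (a,b,c)" and q: "q = (a',b',c')" by (cases p; cases q) auto
  show ?thesis
  proof (cases "a' = a")
    case False
    define w where "w = 12 * (c' - c - (a * (b' - b) - b * (a' - a)) / 2) / (a' - a)"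
    have w: "(a' - a) * w / 12 = c' - c - (a * (b' - b) - b * (a' - a)) / 2" using False by (simp add: w_def)
    have "c + (a * ((b' - b) * 1 + w * (1\<^sup>2 - 1) / 2) - b * ((a' - a) * 1)) / 2 + (a' - a) * w * 1^3 / 12
       = c + (a * (b' - b) - b * (a' - a)) / 2 + (a' - a) * w / 12" by simp
    also have "\<dots> = c'" unfolding w by simp
    finally have e: "c + (a * ((b' - b) * 1 + w * (1\<^sup>2 - 1) / 2) - b * ((a' - a) * 1)) / 2 + (a' - a) * w * 1^3 / 12 = c'" .
    show ?thesis
      by (rule that[OF admissible_parabola[of a "a' - a" b "b' - b" w c]]) (use e in \<open>simp_all add: p q\<close>)
  next
    case True
    define w where "w = 60 * (c' - c - a * (b' - b) / 2 + (b' - b) / 6)"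
    have e: "c + (a * ((b' - b) * 1 + w * (1^3 - 1)) - b * (1\<^sup>2 - 1)) / 2
        + (w * (1^5/5 - 1^4/2 + 1^3/3) - (b' - b) * 1^3 / 3) / 2 = c'"
      by (simp add: w_def field_simps)
    show ?thesis
      by (rule that[OF admissible_loop[of a b "b' - b" w c]]) (use e in \<open>simp_all add: p q True\<close>)
  qed
qed

section \<open>Estimates of the distance from above and from below\<close>

lemma sf_length_nonneg: "is_norm n \<Longrightarrow> sf_length n u \<ge> 0"
  unfolding sf_length_def by (intro Bochner_Integration.integral_nonneg) (rule is_normD)

lemma sf_dist_le:
  assumes "is_norm n" "admissible \<gamma> u"
  shows "sf_dist n (\<gamma> 0) (\<gamma> 1) \<le> sf_length n u"
  unfolding sf_dist_def
proof (rule cInf_lower)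
  show "sf_length n u \<in> {sf_length n u' | \<gamma>' u'. admissible \<gamma>' u' \<and> \<gamma>' 0 = \<gamma> 0 \<and> \<gamma>' 1 = \<gamma> 1}"
    using assms(2) by blast
  show "bdd_below {sf_length n u' | \<gamma>' u'. admissible \<gamma>' u' \<and> \<gamma>' 0 = \<gamma> 0 \<and> \<gamma>' 1 = \<gamma> 1}"
    using sf_length_nonneg[OF assms(1)] by (intro bdd_belowI[of _ 0]) blast
qed

lemma sf_dist_nonempty: "{sf_length n u | \<gamma> u. admissible \<gamma> u \<and> \<gamma> 0 = p \<and> \<gamma> 1 = q} \<noteq> {}"
proof -
  obtain \<gamma> u where "admissible \<gamma> u" "\<gamma> 0 = p" "\<gamma> 1 = q" by (rule admissible_connect)
  then show ?thesis by blast
qed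

lemma sf_dist_nonneg: "is_norm n \<Longrightarrow> sf_dist n p q \<ge> 0"
  unfolding sf_dist_def by (rule cInf_greatest[OF sf_dist_nonempty]) (use sf_length_nonneg in blast)

lemma sf_dist_less:
  assumes "sf_dist n p q < r"
  obtains \<gamma> u where "admissible \<gamma> u" "\<gamma> 0 = p" "\<gamma> 1 = q" "sf_length n u < r"
proof -
  obtain l where "l \<in> {sf_length n u | \<gamma> u. admissible \<gamma> u \<and> \<gamma> 0 = p \<and> \<gamma> 1 = q}" "l < r"
    using cInf_lessD[OF sf_dist_nonempty assms[unfolded sf_dist_def]] by blast
  then show ?thesis using that by blast
qed

lemma sf_dist_parabola:
  fixes x y z :: real
  assumes n: "is_norm n" and x: "x \<noteq> 0"
  shows "sf_dist n (a,b,c) (a + x, b + y, c + (a * y - b * x) / 2 + z)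
     \<le> integral {0..1} (\<lambda>t. n (x, y + (12 * z / x) * (t - 1/2)))"
proof -
  let ?u = "\<lambda>t. (x, y + (12 * z / x) * (t - 1/2))"
  note adm = admissible_parabola[of a x b y "12 * z / x" c]
  have "integral {0..1} (\<lambda>t. n (?u t)) = sf_length n ?u" using sf_length_eq[OF n adm] by blast
  then show ?thesis using sf_dist_le[OF n adm] x by simp
qed

text \<open>Integrate the expansion along the parabola with \<open>w = 12 * z / x\<close>. Centring
  at time 1/2 removes the cross term, and \<open>w^2 / 12\<close> produces the coefficient of
  \<open>z^2\<close>. The hypothesis \<open>small\<close> keeps all slopes inside the window, since
  \<open>w * (t - 1/2) / x\<close> is at most \<open>6 * \<bar>z\<bar> / x^2\<close> in
  modulus.\<close>

lemma sf_dist_parabola_quadratic: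
  fixes x y z :: real
  assumes n: "is_norm n" and x: "x > 0" and small: "\<bar>y\<bar> / x + 6 * \<bar>z\<bar> / x\<^sup>2 \<le> \<delta>"
    and quad: "\<And>u. \<bar>u\<bar> \<le> \<delta> \<Longrightarrow> n (1, u) \<le> L + K / 2 * u\<^sup>2 + e"
  shows "sf_dist n (a,b,c) (a + x, b + y, c + (a * y - b * x) / 2 + z)
     \<le> L * x + K / 2 * (y\<^sup>2 / x + 12 * z\<^sup>2 / x^3) + e * x"
proof -
  let ?w = "12 * z / x"
  have adm: "admissible (\<lambda>t. (a + x * t, b + (y * t + ?w * (t\<^sup>2 - t) / 2), c + (a * (y * t + ?w * (t\<^sup>2 - t) / 2) - b * (x * t)) / 2 + x * ?w * t^3 / 12)) (\<lambda>t. (x, y + ?w * (t - 1/2)))"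
    by (rule admissible_parabola)
  have I1: "((\<lambda>t. n (x, y + ?w * (t - 1/2))) has_integral sf_length n (\<lambda>t. (x, y + ?w * (t - 1/2)))) {0..1}"
    by (rule sf_length_eq[OF n adm])
  let ?F = "\<lambda>t. (L + e) * x * t + K / (2 * x) * (y\<^sup>2 * t + y * ?w * (t\<^sup>2 - t) + ?w\<^sup>2 * (t - 1/2)^3 / 3)"
  have I2: "((\<lambda>t. (L + e) * x + K / (2 * x) * (y + ?w * (t - 1/2))\<^sup>2) has_integral ?F 1 - ?F 0) {0..1}"
    by (rule fundamental_theorem_of_calculus)
       (use x in \<open>auto intro!: derivative_eq_intros simp: has_real_derivative_iff_has_vector_derivative[symmetric] power2_eq_square algebra_simps add_divide_distrib diff_divide_distrib\<close>)
  have "sf_length n (\<lambda>t. (x, y + ?w * (t - 1/2))) \<le> ?F 1 - ?F 0"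
  proof (rule has_integral_le[OF I1 I2])
    fix t :: real assume t: "t \<in> {0..1}"
    let ?v = "y + ?w * (t - 1/2)"
    have "\<bar>?v / x\<bar> \<le> \<delta>"
    proof -
      have "\<bar>?w * (t - 1/2)\<bar> \<le> \<bar>?w\<bar> * (1/2)"
        unfolding abs_mult by (intro mult_left_mono abs_leI) (use t in auto)
      also have "\<dots> = 6 * \<bar>z\<bar> / x" using x by (simp add: abs_mult)
      finally have "\<bar>?v\<bar> \<le> \<bar>y\<bar> + 6 * \<bar>z\<bar> / x" by linarith
      then have "\<bar>?v\<bar> / x \<le> (\<bar>y\<bar> + 6 * \<bar>z\<bar> / x) / x" using x by (simp add: divide_right_mono)
      also have "\<dots> = \<bar>y\<bar> / x + 6 * \<bar>z\<bar> / x\<^sup>2" by (simp add: add_divide_distrib power2_eq_square)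
      finally show ?thesis using small x by simp
    qed
    from quad[OF this] have q: "n (1, ?v / x) \<le> L + K / 2 * (?v / x)\<^sup>2 + e" .
    have "n (x, ?v) = n (x *\<^sub>R (1, ?v / x))" using x by simp
    also have "\<dots> = x * n (1, ?v / x)" using x by (simp only: is_normD(3)[OF n] abs_of_pos)
    also have "\<dots> \<le> x * (L + K / 2 * (?v / x)\<^sup>2 + e)" using q x by (intro mult_left_mono) auto
    also have "\<dots> = (L + e) * x + K / (2 * x) * ?v\<^sup>2"
    proof -
      have "x * (L + K / 2 * (v / x)\<^sup>2 + e) = (L + e) * x + K / (2 * x) * v\<^sup>2" for v
        using x by (simp add: field_simps power2_eq_square)
      then show ?thesis .
    qed
    finally show "n (x, ?v) \<le> (L + e) * x + K / (2 * x) * ?v\<^sup>2" .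
  qed
  also have "?F 1 - ?F 0 = L * x + K / 2 * (y\<^sup>2 / x + 12 * z\<^sup>2 / x^3) + e * x"
    using x by (simp add: field_simps power2_eq_square power3_eq_cube)
  finally show ?thesis using sf_dist_le[OF n adm] x by simp
qed

text \<open>For \<open>v1 < 0\<close> apply the case \<open>v1 > 0\<close> to \<open>-v\<close> and \<open>-p\<close>.\<close>
lemma dual_quadratic:
  assumes n: "is_norm n" and K: "K > 0" and d: "\<delta> > 0" and e: "0 \<le> e" "16 * e \<le> K * \<delta>\<^sup>2"
    and quad: "\<And>u. \<bar>u\<bar> \<le> \<delta> \<Longrightarrow> \<bar>n (1, u) - (L + K / 2 * u\<^sup>2)\<bar> \<le> e"
    and p: "\<bar>p\<bar> \<le> K * \<delta> / 2" and pos: "L - e - 1 / (2 * K) * p\<^sup>2 \<ge> 0"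
  shows "(L - e - 1 / (2 * K) * p\<^sup>2) * v1 + p * v2 \<le> n (v1, v2)"
proof -
  have gen: "L - e - 1 / (2 * K) * p\<^sup>2 \<le> n (1, u) - p * u" if p: "\<bar>p\<bar> \<le> K * \<delta> / 2" for p u
  proof -
    have sq: "L + K / 2 * u\<^sup>2 - p * u = L - 1 / (2 * K) * p\<^sup>2 + K / 2 * (u - p / K)\<^sup>2" for u
      using K by (simp add: field_simps power2_eq_square)
    have in1: "L - e - 1 / (2 * K) * p\<^sup>2 \<le> n (1, u) - p * u" if "\<bar>u\<bar> \<le> \<delta>" for u
    proof -
      have "0 \<le> K / 2 * (u - p / K)\<^sup>2" using K by simp
      then show ?thesis using quad[OF that] sq[of u] by linarith
    qed
    show ?thesis
    proof (cases "\<bar>u\<bar> \<le> \<delta>")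
      case True then show ?thesis by (rule in1)
    next
      case False
      \<comment> \<open>Beyond the window only convexity of the norm is available. After subtracting
        \<open>p * u\<close>, the value at the vertex \<open>w\<close> is at most \<open>H\<close>,
        while at the boundary point \<open>s\<close> between \<open>w\<close> and \<open>u\<close>
        it is at least \<open>H\<close>: \<open>s\<close> is at distance at least
        \<open>\<delta>/2\<close> from \<open>w\<close>, and
        \<open>16 * e \<le> K * \<delta>^2\<close> makes the quadratic gain at least
        \<open>2 * e\<close>. Convexity then gives at least \<open>H\<close> at
        \<open>u\<close>.\<close>
      define w where "w = p / K"
      have w: "\<bar>w\<bar> \<le> \<delta> / 2" using p K by (simp add: w_def abs_divide field_simps)
      define s where "s = (if u > 0 then \<delta> else - \<delta>)"
      have s: "\<bar>s\<bar> = \<delta>" using d by (simp add: s_def)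
      define t where "t = (s - w) / (u - w)"
      have t: "0 < t" "t < 1" "s = (1 - t) * w + t * u"
      proof -
        have "u - w \<noteq> 0" using False w d by auto
        then have "t * (u - w) = s - w" by (simp add: t_def)
        then show "s = (1 - t) * w + t * u" by (simp add: algebra_simps)
        show "0 < t" "t < 1" using False w d unfolding t_def s_def
          by (auto simp: divide_simps split: if_splits)
      qed
      have "n (1, s) = n ((1 - t) *\<^sub>R (1, w) + t *\<^sub>R (1, u))" using t(3) by simp
      also have "\<dots> \<le> n ((1 - t) *\<^sub>R (1, w)) + n (t *\<^sub>R (1, u))" by (rule is_normD[OF n])
      also have "\<dots> = (1 - t) * n (1, w) + t * n (1, u)"
        using t by (simp only: is_normD(3)[OF n] abs_of_pos diff_gt_0_iff_gt)
      finally have c: "n (1, s) \<le> (1 - t) * n (1, w) + t * n (1, u)" .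
      have gw: "n (1, w) - p * w \<le> L - 1 / (2 * K) * p\<^sup>2 + e"
      proof -
        have "K / 2 * (w - p / K)\<^sup>2 = 0" by (simp add: w_def)
        moreover have "\<bar>n (1, w) - (L + K / 2 * w\<^sup>2)\<bar> \<le> e" using quad[of w] w d by simp
        ultimately show ?thesis using sq[of w] by linarith
      qed
      have "\<bar>s - w\<bar> \<ge> \<delta> / 2" using s w by linarith
      then have "(s - w)\<^sup>2 \<ge> (\<delta> / 2)\<^sup>2" using d by (metis abs_le_square_iff abs_of_pos half_gt_zero)
      then have "K / 2 * (s - w)\<^sup>2 \<ge> K / 2 * (\<delta> / 2)\<^sup>2" using K by (intro mult_left_mono) auto
      then have "K / 2 * (s - w)\<^sup>2 \<ge> 2 * e" using e by (simp add: power_divide)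
      then have gs: "n (1, s) - p * s \<ge> L - 1 / (2 * K) * p\<^sup>2 + e"
        using quad[of s] s sq[of s] unfolding w_def by linarith
      have ps: "p * s = (1 - t) * (p * w) + t * (p * u)" unfolding t(3) by (simp add: algebra_simps)
      define H where "H = L - 1 / (2 * K) * p\<^sup>2 + e"
      have "H \<le> (1 - t) * (n (1, w) - p * w) + t * (n (1, u) - p * u)"
        using c gs ps unfolding H_def[symmetric] by (simp add: algebra_simps)
      also have "\<dots> \<le> (1 - t) * H + t * (n (1, u) - p * u)"
        using gw t unfolding H_def[symmetric] by (intro add_right_mono mult_left_mono) auto
      finally have "t * H \<le> t * (n (1, u) - p * u)" by (simp add: algebra_simps)
      then have "H \<le> n (1, u) - p * u" using t by simp
      then show ?thesis using e unfolding H_def by linarith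
    qed
  qed
  have pos1: "(L - e - 1 / (2 * K) * p\<^sup>2) * v1 + p * v2 \<le> n (v1, v2)" if p: "\<bar>p\<bar> \<le> K * \<delta> / 2" and v: "v1 > 0" for p v1 v2
  proof -
    have "n (v1, v2) = n (v1 *\<^sub>R (1, v2 / v1))" using v by simp
    also have "\<dots> = v1 * n (1, v2 / v1)" using v by (simp only: is_normD(3)[OF n] abs_of_pos)
    also have "\<dots> \<ge> v1 * (L - e - 1 / (2 * K) * p\<^sup>2 + p * (v2 / v1))"
      using gen[OF p, of "v2 / v1"] v by (intro mult_left_mono) auto
    finally show ?thesis using v by (simp add: algebra_simps)
  qed
  have pos0: "(L - e - 1 / (2 * K) * p\<^sup>2) * v1 + p * v2 \<le> n (v1, v2)" if p: "\<bar>p\<bar> \<le> K * \<delta> / 2" and v: "v1 \<ge> 0" for p v1 v2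
  proof (cases "v1 = 0")
    case True
    have "p * v2 \<le> n (0, v2) + r" if r: "r > 0" for r
    proof -
      \<comment> \<open>The case \<open>v1 = 0\<close> is the limit of \<open>v1 = s > 0\<close>,
        with \<open>s\<close> chosen so that the perturbation costs at most
        \<open>r\<close>.\<close>
      define h where "h = L - e - 1 / (2 * K) * p\<^sup>2"
      define s where "s = r / (\<bar>n (1,0) - h\<bar> + 1)"
      have s: "s > 0" using r by (simp add: s_def)
      have "h * s + p * v2 \<le> n (s, v2)" using pos1[OF p s] by (simp add: h_def)
      also have "\<dots> = n (s *\<^sub>R (1,0) + (0, v2))" by simp
      also have "\<dots> \<le> n (s *\<^sub>R (1,0)) + n (0, v2)" by (rule is_normD[OF n])
      also have "\<dots> = s * n (1,0) + n (0, v2)" using s by (simp only: is_normD(3)[OF n] abs_of_pos)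
      finally have "p * v2 \<le> n (0, v2) + s * (n (1,0) - h)" by (simp add: algebra_simps)
      also have "s * (n (1,0) - h) \<le> s * (\<bar>n (1,0) - h\<bar> + 1)" using s by (intro mult_left_mono) auto
      also have "\<dots> = r" by (simp add: s_def)
      finally show ?thesis by simp
    qed
    then show ?thesis using True by (simp add: field_le_epsilon)
  next
    case False
    then show ?thesis using pos1[OF p] v by simp
  qed
  show ?thesis
  proof (cases "v1 \<ge> 0")
    case True then show ?thesis using pos0[OF p] by simp
  next
    case False
    have "(L - e - 1 / (2 * K) * (-p)\<^sup>2) * (-v1) + (-p) * (-v2) \<le> n (-v1, -v2)"
      by (rule pos0) (use p False in auto)
    moreover have "n (-v1, -v2) = n (v1, v2)" using is_normD(3)[OF n, of "-1" "(v1,v2)"] by simp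
    moreover have "(L - e - 1 / (2 * K) * p\<^sup>2) * v1 \<le> 0" using pos False by (simp add: mult_nonneg_nonpos)
    ultimately show ?thesis by simp
  qed
qed

text \<open>Covectors of momentum \<open>s\<close> are controlled only for
  \<open>\<bar>s\<bar> \<le> pm\<close>, so competing curves must first be confined. Momentum 0 does
  this: the forms \<open>A dx\<close> and \<open>- A dx\<close> bound the x-displacement of every
  curve shorter than \<open>r\<close>. In the resulting strip the full calibration applies.\<close>

lemma sf_dist_ge_calib:
  assumes n: "is_norm n" and A: "A > 0"
    and dual: "\<And>s v1 v2. \<bar>s\<bar> \<le> pm \<Longrightarrow> (A - w * s\<^sup>2) * v1 + s * v2 \<le> n (v1, v2)"
    and pm: "pm \<ge> 0"
    and rng: "\<And>x. A * \<bar>x - fst p\<bar> \<le> r \<Longrightarrow> \<bar>b + k * x\<bar> \<le> pm"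
    and r: "sf_dist n p q < r"
  shows "calib A w b k q - calib A w b k p \<le> sf_dist n p q"
proof (rule ccontr)
  assume "\<not> ?thesis"
  then have "sf_dist n p q < min r (calib A w b k q - calib A w b k p)" using r by simp
  then obtain \<gamma> u where g: "admissible \<gamma> u" "\<gamma> 0 = p" "\<gamma> 1 = q" "sf_length n u < min r (calib A w b k q - calib A w b k p)"
    by (rule sf_dist_less)
  have d0: "A * v1 \<le> n (v1, v2)" for v1 v2 using dual[of 0 v1 v2] pm by simp
  have d1: "- A * v1 \<le> n (v1, v2)" for v1 v2
    using d0[of "-v1" "-v2"] is_normD(3)[OF n, of "-1" "(v1,v2)"] by simp
  have x: "A * \<bar>fst (\<gamma> t) - fst p\<bar> \<le> r" if t: "0 \<le> t" "t \<le> 1" for t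
  proof -
    have "calib A 0 0 0 (\<gamma> t) - calib A 0 0 0 (\<gamma> 0) \<le> sf_length n u"
      by (rule calib_le_length[OF n g(1) t]) (use d0 in simp)
    moreover have "calib (-A) 0 0 0 (\<gamma> t) - calib (-A) 0 0 0 (\<gamma> 0) \<le> sf_length n u"
      by (rule calib_le_length[OF n g(1) t]) (use d1 in simp)
    ultimately have "A * (fst (\<gamma> t) - fst p) \<le> r" "- (A * (fst (\<gamma> t) - fst p)) \<le> r"
      using g by (simp_all add: calib_def algebra_simps)
    then have "\<bar>A * (fst (\<gamma> t) - fst p)\<bar> \<le> r" by linarith
    then show ?thesis using A by (simp add: abs_mult)
  qed
  have "calib A w b k (\<gamma> 1) - calib A w b k (\<gamma> 0) \<le> sf_length n u"
    by (rule calib_le_length[OF n g(1)]) (use dual rng x in auto)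
  then show False using g by simp
qed

section \<open>Linear automorphisms\<close>

definition lin2 :: "R2 \<Rightarrow> R2 \<Rightarrow> R2 \<Rightarrow> R2" where
  "lin2 f g v = fst v *\<^sub>R f + snd v *\<^sub>R g"

definition det2 :: "R2 \<Rightarrow> R2 \<Rightarrow> real" where
  "det2 f g = fst f * snd g - snd f * fst g"

text \<open>The group automorphism induced by \<open>lin2 f g\<close>. The central coordinate is an
  area and scales by the determinant; replacing \<open>f\<close> and \<open>g\<close> by
  \<open>S\<close> times themselves therefore composes with the Heisenberg dilation by
  \<open>S\<close>.\<close>

definition heis_aut :: "R2 \<Rightarrow> R2 \<Rightarrow> R3 \<Rightarrow> R3" where
  "heis_aut f g p = (fst p * fst f + fst (snd p) * fst g, fst p * snd f + fst (snd p) * snd g, det2 f g * snd (snd p))"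

lemma bounded_linear_lin2: "bounded_linear (lin2 f g)"
  unfolding lin2_def by (intro bounded_linear_intros)

lemma bounded_linear_heis_aut: "bounded_linear (heis_aut f g)"
  unfolding heis_aut_def by (intro bounded_linear_intros bounded_linear_mult_const bounded_linear_const_mult)

lemma admissible_heis_aut:
  assumes "admissible \<gamma> u"
  shows "admissible (\<lambda>t. heis_aut f g (\<gamma> t)) (\<lambda>t. lin2 f g (u t))"
  unfolding admissible_def
proof (intro conjI)
  interpret T: bounded_linear "heis_aut f g" by (rule bounded_linear_heis_aut)
  interpret M: bounded_linear "lin2 f g" by (rule bounded_linear_lin2)
  have ac: "abs_cont_01 \<gamma>" and um: "u \<in> borel_measurable (lebesgue_on {0..1})"
    and ui: "integrable (lebesgue_on {0..1}) (\<lambda>t. (norm (u t))\<^sup>2)"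
    and ae: "AE t in lebesgue_on {0..1}. (\<gamma> has_vector_derivative (fst (u t) *\<^sub>R X1 (\<gamma> t) + snd (u t) *\<^sub>R X2 (\<gamma> t))) (at t within {0..1})"
    using assms by (auto simp: admissible_def)
  obtain C where C: "C > 0" "\<And>p. norm (heis_aut f g p) \<le> norm p * C" using T.pos_bounded by blast
  show "abs_cont_01 (\<lambda>t. heis_aut f g (\<gamma> t))"
    unfolding abs_cont_01_def
  proof (intro allI impI)
    fix e :: real assume e: "e > 0"
    then have "e / C > 0" using C by simp
    from ac[unfolded abs_cont_01_def, rule_format, OF this] obtain d where d: "d > 0" and *: "\<And>(n::nat) a b.
        (\<forall>i<n. 0 \<le> a i \<and> a i \<le> b i \<and> b i \<le> 1) \<and> (\<forall>i j. i < j \<and> j < n \<longrightarrow> b i \<le> a j) \<and>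
        (\<Sum>i<n. b i - a i) < d \<Longrightarrow> (\<Sum>i<n. norm (\<gamma> (b i) - \<gamma> (a i))) < e / C" by blast
    show "\<exists>\<delta>>0. \<forall>(n::nat) a b. (\<forall>i<n. 0 \<le> a i \<and> a i \<le> b i \<and> b i \<le> 1) \<and>
        (\<forall>i j. i < j \<and> j < n \<longrightarrow> b i \<le> a j) \<and> (\<Sum>i<n. b i - a i) < \<delta>
        \<longrightarrow> (\<Sum>i<n. norm (heis_aut f g (\<gamma> (b i)) - heis_aut f g (\<gamma> (a i)))) < e"
    proof (rule exI[of _ d], intro conjI allI impI d)
      fix n :: nat and a b :: "nat \<Rightarrow> real"
      assume h: "(\<forall>i<n. 0 \<le> a i \<and> a i \<le> b i \<and> b i \<le> 1) \<and>
        (\<forall>i j. i < j \<and> j < n \<longrightarrow> b i \<le> a j) \<and> (\<Sum>i<n. b i - a i) < d"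
      have "(\<Sum>i<n. norm (heis_aut f g (\<gamma> (b i)) - heis_aut f g (\<gamma> (a i)))) \<le> (\<Sum>i<n. norm (\<gamma> (b i) - \<gamma> (a i)) * C)"
        by (rule sum_mono) (metis C(2) T.diff)
      also have "\<dots> = (\<Sum>i<n. norm (\<gamma> (b i) - \<gamma> (a i))) * C" by (simp add: sum_distrib_right)
      also have "\<dots> < e" using *[OF h] C by (simp add: field_simps)
      finally show "(\<Sum>i<n. norm (heis_aut f g (\<gamma> (b i)) - heis_aut f g (\<gamma> (a i)))) < e" .
    qed
  qed
  show m: "(\<lambda>t. lin2 f g (u t)) \<in> borel_measurable (lebesgue_on {0..1})"
    by (rule measurable_compose[OF um]) (intro borel_measurable_continuous_onI linear_continuous_on bounded_linear_lin2)
  obtain D where D: "D > 0" "\<And>p. norm (lin2 f g p) \<le> norm p * D" using M.pos_bounded by blast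
  show "integrable (lebesgue_on {0..1}) (\<lambda>t. (norm (lin2 f g (u t)))\<^sup>2)"
  proof (rule Bochner_Integration.integrable_bound[OF integrable_mult_left[OF ui, of "D\<^sup>2"]])
    show "(\<lambda>t. (norm (lin2 f g (u t)))\<^sup>2) \<in> borel_measurable (lebesgue_on {0..1})" using m by measurable
    have "(norm (lin2 f g v))\<^sup>2 \<le> (norm v)\<^sup>2 * D\<^sup>2" for v
      using power_mono[OF D(2)[of v], of 2] by (simp add: power_mult_distrib)
    then show "AE t in lebesgue_on {0..1}. norm ((norm (lin2 f g (u t)))\<^sup>2) \<le> norm ((norm (u t))\<^sup>2 * D\<^sup>2)"
      by simp
  qed
  show "AE t in lebesgue_on {0..1}. ((\<lambda>t. heis_aut f g (\<gamma> t)) has_vector_derivative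
      (fst (lin2 f g (u t)) *\<^sub>R X1 (heis_aut f g (\<gamma> t)) + snd (lin2 f g (u t)) *\<^sub>R X2 (heis_aut f g (\<gamma> t)))) (at t within {0..1})"
    using ae
  proof (rule AE_mp, intro AE_I2 impI)
    fix t assume "(\<gamma> has_vector_derivative (fst (u t) *\<^sub>R X1 (\<gamma> t) + snd (u t) *\<^sub>R X2 (\<gamma> t))) (at t within {0..1})"
    from T.has_vector_derivative[OF this]
    have "((\<lambda>t. heis_aut f g (\<gamma> t)) has_vector_derivative heis_aut f g (fst (u t) *\<^sub>R X1 (\<gamma> t) + snd (u t) *\<^sub>R X2 (\<gamma> t))) (at t within {0..1})" .
    moreover have "heis_aut f g (a *\<^sub>R X1 p + b *\<^sub>R X2 p)
      = fst (lin2 f g (a,b)) *\<^sub>R X1 (heis_aut f g p) + snd (lin2 f g (a,b)) *\<^sub>R X2 (heis_aut f g p)" for a b p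
      by (cases p; cases f; cases g) (simp add: heis_aut_def lin2_def det2_def X1_def X2_def field_simps)
    ultimately show "((\<lambda>t. heis_aut f g (\<gamma> t)) has_vector_derivative
      (fst (lin2 f g (u t)) *\<^sub>R X1 (heis_aut f g (\<gamma> t)) + snd (lin2 f g (u t)) *\<^sub>R X2 (heis_aut f g (\<gamma> t)))) (at t within {0..1})"
      by simp
  qed
qed

lemma lin2_inverse:
  assumes "det2 f g \<noteq> 0"
  obtains f' g' where "det2 f' g' \<noteq> 0" "\<And>v. lin2 f g (lin2 f' g' v) = v" "\<And>v. lin2 f' g' (lin2 f g v) = v"
    "\<And>p. heis_aut f g (heis_aut f' g' p) = p" "\<And>p. heis_aut f' g' (heis_aut f g p) = p"
proof -
  obtain a b c d where fg: "f = (a,b)" "g = (c,d)" by (cases f; cases g) auto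
  define D where "D = a * d - b * c"
  have D: "D \<noteq> 0" "det2 f g = D" using assms by (auto simp: det2_def fg D_def)
  define f' g' where "f' = (d / D, - b / D)" and "g' = (- c / D, a / D)"
  have D': "det2 f' g' = 1 / D" using D(1) by (simp add: det2_def f'_def g'_def field_simps) (simp add: D_def algebra_simps power2_eq_square)
  have 2: "(x * a + y * c) * (d / D) + (x * b + y * d) * (- c / D) = x"
       "(x * a + y * c) * (- b / D) + (x * b + y * d) * (a / D) = y" for x y :: real
      using D(1) by (simp_all add: field_simps) (simp_all add: D_def algebra_simps)
  have one: "(x * (d / D) + y * (- c / D)) * a + (x * (- b / D) + y * (a / D)) * c = x"
      "(x * (d / D) + y * (- c / D)) * b + (x * (- b / D) + y * (a / D)) * d = y" for x y :: real
      using D(1) by (simp_all add: field_simps) (simp_all add: D_def algebra_simps)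
  show ?thesis
  proof (rule that[of f' g'])
    show "det2 f' g' \<noteq> 0" using D D' by simp
    fix v :: R2
    show "lin2 f g (lin2 f' g' v) = v"
      using one[of "fst v" "snd v"] by (cases v) (simp add: lin2_def fg f'_def g'_def)
    show "lin2 f' g' (lin2 f g v) = v"
      using 2[of "fst v" "snd v"] by (cases v) (simp add: lin2_def fg f'_def g'_def)
  next
    fix p :: R3
    show "heis_aut f g (heis_aut f' g' p) = p"
      using one[of "fst p" "fst (snd p)"] D D' by (cases p) (simp add: heis_aut_def fg f'_def g'_def)
    show "heis_aut f' g' (heis_aut f g p) = p"
      using 2[of "fst p" "fst (snd p)"] D D' by (cases p) (simp add: heis_aut_def fg f'_def g'_def)
  qed
qed

lemma is_norm_lin2:
  assumes n: "is_norm n" and D: "det2 f g \<noteq> 0"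
  shows "is_norm (\<lambda>v. n (lin2 f g v))"
proof -
  interpret M: bounded_linear "lin2 f g" by (rule bounded_linear_lin2)
  obtain f' g' where "\<And>v. lin2 f' g' (lin2 f g v) = v" using lin2_inverse[OF D] by metis
  then have inj: "lin2 f g v = 0 \<longleftrightarrow> v = 0" for v by (metis M.zero)
  show ?thesis unfolding is_norm_def
  proof (intro conjI allI)
    fix v w :: R2 and c :: real
    show "0 \<le> n (lin2 f g v)" by (rule is_normD[OF n])
    show "n (lin2 f g v) = 0 \<longleftrightarrow> v = 0" by (simp only: is_normD(2)[OF n] inj)
    show "n (lin2 f g (c *\<^sub>R v)) = \<bar>c\<bar> * n (lin2 f g v)" by (simp only: M.scaleR is_normD(3)[OF n])
    show "n (lin2 f g (v + w)) \<le> n (lin2 f g v) + n (lin2 f g w)" by (simp only: M.add is_normD(4)[OF n])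
  qed
qed

text \<open>The automorphism and its inverse carry admissible curves to admissible curves and
  transform controls by the plane map. This reduces a general frame to the standard coordinates with
  a changed norm.\<close>

lemma sf_dist_heis_aut:
  assumes D: "det2 f g \<noteq> 0"
  shows "sf_dist n (heis_aut f g p) (heis_aut f g q) = sf_dist (\<lambda>v. n (lin2 f g v)) p q"
proof -
  obtain f' g' where i: "\<And>v. lin2 f g (lin2 f' g' v) = v" 
    "\<And>p. heis_aut f g (heis_aut f' g' p) = p" "\<And>p. heis_aut f' g' (heis_aut f g p) = p"
    using lin2_inverse[OF D] by metis
  have "{sf_length n u | \<gamma> u. admissible \<gamma> u \<and> \<gamma> 0 = heis_aut f g p \<and> \<gamma> 1 = heis_aut f g q}
     = {sf_length (\<lambda>v. n (lin2 f g v)) u | \<gamma> u. admissible \<gamma> u \<and> \<gamma> 0 = p \<and> \<gamma> 1 = q}" (is "?A = ?B")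
  proof
    show "?A \<subseteq> ?B"
    proof
      fix l assume "l \<in> ?A"
      then obtain \<gamma> u where g: "admissible \<gamma> u" "\<gamma> 0 = heis_aut f g p" "\<gamma> 1 = heis_aut f g q" and l: "l = sf_length n u" by blast
      have "l = sf_length (\<lambda>v. n (lin2 f g v)) (\<lambda>t. lin2 f' g' (u t))" by (simp add: l sf_length_def i)
      moreover have "heis_aut f' g' (\<gamma> 0) = p" "heis_aut f' g' (\<gamma> 1) = q" by (simp_all add: g i)
      ultimately show "l \<in> ?B" using admissible_heis_aut[OF g(1), of f' g'] by blast
    qed
    show "?B \<subseteq> ?A"
    proof
      fix l assume "l \<in> ?B"
      then obtain \<gamma> u where g: "admissible \<gamma> u" "\<gamma> 0 = p" "\<gamma> 1 = q" and l: "l = sf_length (\<lambda>v. n (lin2 f g v)) u" by blast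
      have "l = sf_length n (\<lambda>t. lin2 f g (u t))" by (simp add: l sf_length_def)
      then show "l \<in> ?A" using admissible_heis_aut[OF g(1), of f g] g by blast
    qed
  qed
  then show ?thesis by (simp add: sf_dist_def)
qed

section \<open>Localisation of midpoints\<close>

text \<open>The integral of \<open>(b + k t)^2\<close> over \<open>t\<close> from 0 to \<open>x\<close>.\<close>
definition affine_energy :: "real \<Rightarrow> real \<Rightarrow> real \<Rightarrow> real" where
  "affine_energy b k x = b\<^sup>2 * x + b * k * x\<^sup>2 + k\<^sup>2 * x^3 / 3"

lemma abs_mult_le: "\<bar>a\<bar> \<le> A \<Longrightarrow> \<bar>b\<bar> \<le> B \<Longrightarrow> \<bar>a * b\<bar> \<le> A * (B::real)"
  by (simp add: abs_mult mult_mono')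

lemma abs_half_le:
  fixes a b c :: real
  assumes "\<bar>a\<bar> \<le> c" "\<bar>b\<bar> \<le> c"
  shows "\<bar>(a - b) / 2\<bar> \<le> c" "\<bar>(a + b) / 2\<bar> \<le> c"
proof -
  have "a \<le> c" "- a \<le> c" "b \<le> c" "- b \<le> c" using assms by (auto simp: abs_le_iff)
  then show "\<bar>(a - b) / 2\<bar> \<le> c" "\<bar>(a + b) / 2\<bar> \<le> c" by (simp_all add: abs_le_iff field_simps)
qed

text \<open>For momenta of size \<open>R\<close>, moving an end of integration by order
  \<open>R\<close> changes the energy only by order \<open>R^3\<close>. Hence the integration limits
  may be replaced by -1, 0 and 1.\<close>

lemma affine_energy_diff:
  assumes b: "\<bar>b\<bar> \<le> 3 * R" and k: "\<bar>k\<bar> \<le> 3 * R" and x: "\<bar>x\<bar> \<le> 2" "\<bar>y\<bar> \<le> 2" and xy: "\<bar>x - y\<bar> \<le> 2 * R"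
  shows "\<bar>affine_energy b k x - affine_energy b k y\<bar> \<le> 200 * R^3"
proof -
  have R: "R \<ge> 0" using b by linarith
  have "affine_energy b k x - affine_energy b k y = (b * b + b * k * (x + y) + k * k * ((x * x + x * y + y * y) / 3)) * (x - y)"
    by (simp add: affine_energy_def field_simps power2_eq_square power3_eq_cube)
  moreover have "\<bar>b * b + b * k * (x + y) + k * k * ((x * x + x * y + y * y) / 3)\<bar> \<le> 100 * R\<^sup>2"
  proof -
    have 1: "\<bar>b * b\<bar> \<le> 3 * R * (3 * R)" by (rule abs_mult_le[OF b b])
    have "\<bar>x + y\<bar> \<le> 4" using x by linarith
    then have 2: "\<bar>b * k * (x + y)\<bar> \<le> 3 * R * (3 * R) * 4" by (intro abs_mult_le b k)
    have "\<bar>x * x\<bar> \<le> 2 * 2" "\<bar>x * y\<bar> \<le> 2 * 2" "\<bar>y * y\<bar> \<le> 2 * 2" by (intro abs_mult_le x)+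
    then have "\<bar>x * x + x * y + y * y\<bar> \<le> 12" by linarith
    then have "\<bar>(x * x + x * y + y * y) / 3\<bar> \<le> 4" by simp
    then have 3: "\<bar>k * k * ((x * x + x * y + y * y) / 3)\<bar> \<le> 3 * R * (3 * R) * 4" by (intro abs_mult_le k)
    have "\<bar>b * b + b * k * (x + y) + k * k * ((x * x + x * y + y * y) / 3)\<bar> \<le> 9 * (R * R) + 36 * (R * R) + 36 * (R * R)"
      using 1 2 3 by linarith
    also have "\<dots> \<le> 100 * R\<^sup>2" by (simp add: power2_eq_square)
    finally show ?thesis .
  qed
  ultimately have "\<bar>affine_energy b k x - affine_energy b k y\<bar> \<le> 100 * R\<^sup>2 * (2 * R)"
    using abs_mult_le[OF _ xy] by presburger
  then show ?thesis by (simp add: power2_eq_square power3_eq_cube)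
qed

text \<open>Freezes the denominators at \<open>X = 2\<close>, where the coefficient of
  \<open>\<zeta>^2\<close> is 12/8 = 3/2. All corrections are cubic in \<open>R\<close>.\<close>

lemma energy_upper:
  fixes R X Y \<zeta> \<zeta>' :: real
  assumes R: "0 < R" "R \<le> 1/100" and X: "\<bar>X - 2\<bar> \<le> 2 * R" and Y: "\<bar>Y\<bar> \<le> 2 * R"
    and z: "\<bar>\<zeta>\<bar> \<le> 6/5 * R" "\<bar>\<zeta>' - \<zeta>\<bar> \<le> R\<^sup>2"
  shows "Y\<^sup>2 / X + 12 * \<zeta>'\<^sup>2 / X^3 \<le> Y\<^sup>2 / 2 + 3/2 * \<zeta>\<^sup>2 + 100 * R^3"
proof -
  have X2: "X \<ge> 2 - 2 * R" "X \<ge> 1" using X R by linarith+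
  have i: "1 / X \<le> 1/2 + R"
  proof -
    have "1 \<le> (1/2 + R) * (2 - 2 * R)" using R mult_right_mono[of R "1/100" R] by (simp add: algebra_simps)
    also have "\<dots> \<le> (1/2 + R) * X" using X2 R by (intro mult_left_mono) auto
    finally show ?thesis using X2 by (simp add: field_simps)
  qed
  have "1 / X^3 = (1/X)^3" by (simp add: power_one_over)
  also have "\<dots> \<le> (1/2 + R)^3" using i X2 by (intro power_mono) auto
  also have "\<dots> = 1/8 + R * (3/4 + 3/2 * R + R * R)" by (simp add: power3_eq_cube algebra_simps)
  also have "\<dots> \<le> 1/8 + R * 1"
  proof -
    have "R * R \<le> 1/100 * R" using R by (intro mult_right_mono) auto
    then have "3/4 + 3/2 * R + R * R \<le> 1" using R by linarith
    then show ?thesis using R by (intro add_left_mono mult_left_mono) auto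
  qed
  finally have i3: "1 / X^3 \<le> 1/8 + R" by simp
  have sqY: "Y\<^sup>2 \<le> 4 * R\<^sup>2" using abs_mult_le[OF Y Y] by (simp add: power2_eq_square)
  have RR: "R\<^sup>2 \<le> R * (1/100)" using R by (simp add: power2_eq_square)
  have sqz: "\<zeta>'\<^sup>2 \<le> \<zeta>\<^sup>2 + 3 * R^3"
  proof -
    have "\<bar>\<zeta>' + \<zeta>\<bar> \<le> 3 * R" using z RR by linarith
    from abs_mult_le[OF z(2) this] have "(\<zeta>' - \<zeta>) * (\<zeta>' + \<zeta>) \<le> R\<^sup>2 * (3 * R)" by linarith
    then show ?thesis by (simp add: power2_eq_square power3_eq_cube algebra_simps)
  qed
  have "\<bar>\<zeta>'\<bar> \<le> 2 * R" using z RR R by linarith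
  then have sqz': "\<zeta>'\<^sup>2 \<le> 4 * R\<^sup>2" using abs_mult_le[of \<zeta>' "2*R" \<zeta>' "2*R"] by (simp add: power2_eq_square)
  have "Y\<^sup>2 / X = Y\<^sup>2 * (1 / X)" by simp
  also have "\<dots> \<le> Y\<^sup>2 * (1/2 + R)" using i by (intro mult_left_mono) auto
  also have "\<dots> = Y\<^sup>2 / 2 + Y\<^sup>2 * R" by (simp add: algebra_simps)
  also have "Y\<^sup>2 * R \<le> 4 * R\<^sup>2 * R" using sqY R by (intro mult_right_mono) auto
  finally have 1: "Y\<^sup>2 / X \<le> Y\<^sup>2 / 2 + 4 * R^3" by (simp add: power2_eq_square power3_eq_cube)
  have "12 * \<zeta>'\<^sup>2 / X^3 = 12 * (\<zeta>'\<^sup>2 * (1 / X^3))" by simp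
  also have "\<dots> \<le> 12 * (\<zeta>'\<^sup>2 * (1/8 + R))" using i3 by (intro mult_left_mono) auto
  also have "\<dots> = 3/2 * \<zeta>'\<^sup>2 + 12 * (\<zeta>'\<^sup>2 * R)" by (simp add: algebra_simps)
  also have "\<zeta>'\<^sup>2 * R \<le> 4 * R\<^sup>2 * R" using sqz' R by (intro mult_right_mono) auto
  finally have "12 * \<zeta>'\<^sup>2 / X^3 \<le> 3/2 * \<zeta>'\<^sup>2 + 48 * R^3" by (simp add: power2_eq_square power3_eq_cube)
  moreover have "R^3 > 0" using R by simp
  ultimately have 2: "12 * \<zeta>'\<^sup>2 / X^3 \<le> 3/2 * \<zeta>\<^sup>2 + 53 * R^3" using sqz by linarith
  have "R^3 > 0" using R by simp
  then show ?thesis using 1 2 by linarith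
qed

text \<open>On the half-width \<open>40 * R\<close>, \<open>dual_quadratic\<close> admits momenta up
  to \<open>20 * K * R\<close>. The test momenta are \<open>K * (b + k x)\<close> with
  \<open>b\<close>, \<open>k\<close> at most \<open>3 * R\<close> and \<open>x\<close> at most
  51/10, and 3 + 3 * 51/10 < 20. Small \<open>R\<close> absorbs cubic terms into \<open>R^2\<close>,
  the bound on \<open>e\<close> makes the expansion error negligible against the energy, and
  \<open>K * R \<le> L / 1000\<close> will control \<open>xm\<close>.\<close>

locale endpoint_setup =
  fixes n :: "R2 \<Rightarrow> real" and L K R e :: real and xp yp zp xq yq zq :: real
  assumes n: "is_norm n" and L: "L > 0" and K: "K > 0"
    and R: "0 < R" "R \<le> 1/10000000" and e: "0 \<le> e" "e \<le> K * R\<^sup>2 / 1000000" and KRL: "K * R \<le> L / 1000"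
    and quad: "\<And>u. \<bar>u\<bar> \<le> 40 * R \<Longrightarrow> \<bar>n (1, u) - (L + K / 2 * u\<^sup>2)\<bar> \<le> e"
    and p: "\<bar>xp + 1\<bar> \<le> R" "\<bar>yp\<bar> \<le> R" "\<bar>zp\<bar> \<le> R / 10"
    and q: "\<bar>xq - 1\<bar> \<le> R" "\<bar>yq\<bar> \<le> R" "\<bar>zq\<bar> \<le> R / 10"
begin

abbreviation "dpq \<equiv> sf_dist n (xp, yp, zp) (xq, yq, zq)"

text \<open>The central coordinate of the group displacement from \<open>p\<close> to
  \<open>q\<close>, with \<open>xp\<close> and \<open>xq\<close> replaced by -1 and 1; the true
  value differs by at most \<open>R^2\<close>.\<close>

definition \<zeta> where "\<zeta> = zq - zp + (yp + yq) / 2"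

lemma small_R: "R\<^sup>2 \<le> R / 10000000" "R^3 \<le> R\<^sup>2 / 10000000" "R^3 > 0" "R\<^sup>2 > 0"
  using R mult_left_mono[of R "1/10000000" R] mult_left_mono[of R "1/10000000" "R*R"]
  by (auto simp: power2_eq_square power3_eq_cube)

lemma KR2: "K * R\<^sup>2 \<le> L / 10000000000"
proof -
  have "K * R\<^sup>2 = (K * R) * R" by (simp add: power2_eq_square)
  also have "\<dots> \<le> (L / 1000) * (1 / 10000000)" using KRL R L by (intro mult_mono) auto
  finally show ?thesis by simp
qed

lemma e_le: "e \<le> L / 10000000000"
proof -
  have "K * R\<^sup>2 \<ge> 0" using K by simp
  then show ?thesis using e KR2 by linarith
qed

lemma pq_linear:
  "- R \<le> xp + 1" "xp + 1 \<le> R" "- R \<le> xq - 1" "xq - 1 \<le> R" "- R \<le> yp" "yp \<le> R" "- R \<le> yq" "yq \<le> R"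
  "- (R / 10) \<le> zp" "zp \<le> R / 10" "- (R / 10) \<le> zq" "zq \<le> R / 10" "R \<le> 1/100"
  using p q R by (simp_all only: abs_le_iff) linarith+

lemma zeta_bound: "\<bar>\<zeta>\<bar> \<le> 6/5 * R" unfolding \<zeta>_def by (intro abs_leI) (use pq_linear in \<open>simp_all add: field_simps\<close>)

lemma dpq_upper: "dpq \<le> L * (xq - xp) + K / 2 * ((yq - yp)\<^sup>2 / 2 + 3/2 * \<zeta>\<^sup>2 + 100 * R^3) + e * (xq - xp)"
proof -
  define X where "X = xq - xp"
  define Y where "Y = yq - yp"
  define z where "z = zq - zp - (xp * Y - yp * X) / 2"
  have X: "\<bar>X - 2\<bar> \<le> 2 * R" unfolding X_def by (intro abs_leI) (use pq_linear in linarith)+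
  have X1: "X > 0" "X \<ge> 1" unfolding X_def using pq_linear by linarith+
  have Y: "\<bar>Y\<bar> \<le> 2 * R" unfolding Y_def by (intro abs_leI) (use pq_linear in linarith)+
  have z: "\<bar>z - \<zeta>\<bar> \<le> R\<^sup>2"
  proof -
    have "z - \<zeta> = ((xq - 1) * yp - (xp + 1) * yq) / 2" by (simp add: z_def \<zeta>_def X_def Y_def field_simps)
    moreover have "\<bar>(xq - 1) * yp\<bar> \<le> R * R" "\<bar>(xp + 1) * yq\<bar> \<le> R * R" using p q by (intro abs_mult_le; simp)+
    ultimately show ?thesis using abs_half_le(1) by (simp only: power2_eq_square)
  qed
  have zb: "\<bar>z\<bar> \<le> 2 * R" using z zeta_bound small_R R by linarith
  have "sf_dist n (xp, yp, zp) (xp + X, yp + Y, zp + (xp * Y - yp * X) / 2 + z)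
     \<le> L * X + K / 2 * (Y\<^sup>2 / X + 12 * z\<^sup>2 / X^3) + e * X"
  proof (rule sf_dist_parabola_quadratic[OF n X1(1)])
    have "\<bar>Y\<bar> / X \<le> \<bar>Y\<bar>" using X1 divide_left_mono[of 1 X "\<bar>Y\<bar>"] by simp
    moreover have "X\<^sup>2 \<ge> 1" using X1 by simp
    then have "6 * \<bar>z\<bar> / X\<^sup>2 \<le> 6 * \<bar>z\<bar>" using divide_left_mono[of 1 "X\<^sup>2" "6 * \<bar>z\<bar>"] X1 by simp
    ultimately show "\<bar>Y\<bar> / X + 6 * \<bar>z\<bar> / X\<^sup>2 \<le> 40 * R" using Y zb by linarith
    show "n (1, u) \<le> L + K / 2 * u\<^sup>2 + e" if "\<bar>u\<bar> \<le> 40 * R" for u using quad[OF that] by linarith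
  qed
  also have "(xp + X, yp + Y, zp + (xp * Y - yp * X) / 2 + z) = (xq, yq, zq)" by (simp add: X_def Y_def z_def)
  finally have "dpq \<le> L * X + K / 2 * (Y\<^sup>2 / X + 12 * z\<^sup>2 / X^3) + e * X" .
  also have "\<dots> \<le> L * X + K / 2 * (Y\<^sup>2 / 2 + 3/2 * \<zeta>\<^sup>2 + 100 * R^3) + e * X"
  proof -
    have "K / 2 * (Y\<^sup>2 / X + 12 * z\<^sup>2 / X^3) \<le> K / 2 * (Y\<^sup>2 / 2 + 3/2 * \<zeta>\<^sup>2 + 100 * R^3)"
      using K by (intro mult_left_mono[OF energy_upper[OF R(1) pq_linear(13) X Y zeta_bound z]]) simp
    then show ?thesis by linarith
  qed
  finally show ?thesis by (simp add: X_def Y_def)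
qed

text \<open>Crude forms: the first has the leading coefficient \<open>L - e\<close> of the
  calibrations and is meant for \<open>xm\<close>, the second gives the length range
  \<open>3 * L\<close> used to confine curves.\<close>

lemma dpq_bound: "dpq \<le> (L - e) * (xq - xp) + 11 * K * R\<^sup>2" "dpq < 3 * L"
proof -
  have Y: "\<bar>yq - yp\<bar> \<le> 2 * R" by (intro abs_leI) (use pq_linear in linarith)+
  have "(yq - yp)\<^sup>2 \<le> 4 * R\<^sup>2" using abs_mult_le[OF Y Y] by (simp add: power2_eq_square)
  moreover have "\<zeta>\<^sup>2 \<le> 2 * R\<^sup>2" 
  proof -
    have "\<zeta> * \<zeta> \<le> 6/5 * R * (6/5 * R)" using abs_mult_le[OF zeta_bound zeta_bound] by simp
    moreover have "0 \<le> R * R" by simp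
    ultimately show ?thesis unfolding power2_eq_square by linarith
  qed
  ultimately have "(yq - yp)\<^sup>2 / 2 + 3/2 * \<zeta>\<^sup>2 + 100 * R^3 \<le> 10 * R\<^sup>2" using small_R by linarith
  then have 1: "K / 2 * ((yq - yp)\<^sup>2 / 2 + 3/2 * \<zeta>\<^sup>2 + 100 * R^3) \<le> K / 2 * (10 * R\<^sup>2)"
    using K by (intro mult_left_mono) auto
  have X: "xq - xp \<le> 21/10" "xq - xp \<ge> 0" using pq_linear by linarith+
  have KR: "K * R\<^sup>2 > 0" using K R by simp
  have "e * (xq - xp) \<le> K * R\<^sup>2 / 1000000 * (21/10)" by (rule mult_mono) (use e X KR in auto)
  then have 2: "e * (xq - xp) \<le> K * R\<^sup>2 / 2" using KR by linarith
  have "(L - e) * (xq - xp) = L * (xq - xp) - e * (xq - xp)" by (simp add: algebra_simps)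
  then show a: "dpq \<le> (L - e) * (xq - xp) + 11 * K * R\<^sup>2"
    using dpq_upper 1 2 KR by linarith
  have "L * (xq - xp) \<le> L * (21/10)" using L X by (intro mult_left_mono) auto
  then show "dpq < 3 * L" using dpq_upper 1 2 KR2 KR L by linarith
qed

lemma dual: "\<bar>s\<bar> \<le> 20 * K * R \<Longrightarrow> (L - e - 1 / (2 * K) * s\<^sup>2) * v1 + s * v2 \<le> n (v1, v2)"
proof (rule dual_quadratic[OF n K, of "40 * R"])
  assume s: "\<bar>s\<bar> \<le> 20 * K * R"
  then show "\<bar>s\<bar> \<le> K * (40 * R) / 2" by simp
  have "s\<^sup>2 \<le> 400 * K\<^sup>2 * R\<^sup>2" using abs_mult_le[OF s s] by (simp add: power2_eq_square algebra_simps)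
  then have "1 / (2 * K) * s\<^sup>2 \<le> 1 / (2 * K) * (400 * K\<^sup>2 * R\<^sup>2)" using K by (intro mult_left_mono) auto
  also have "\<dots> = 200 * (K * R\<^sup>2)" using K by (simp add: power2_eq_square)
  finally show "0 \<le> L - e - 1 / (2 * K) * s\<^sup>2" using KR2 e_le L by linarith
  show "16 * e \<le> K * (40 * R)\<^sup>2" using e K R by (simp add: power_mult_distrib)
qed (use R e quad in auto)

lemma A_pos: "L - e > 0" "3 * L \<le> 31/10 * (L - e)" using e_le L by (simp_all add: field_simps)

end

locale midpoint_setup = endpoint_setup +
  fixes xm ym zm :: real
  assumes mid: "sf_dist n (xp, yp, zp) (xm, ym, zm) = sf_dist n (xp, yp, zp) (xq, yq, zq) / 2"
      "sf_dist n (xm, ym, zm) (xq, yq, zq) = sf_dist n (xp, yp, zp) (xq, yq, zq) / 2"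
begin

text \<open>The two halves of a pair are calibrated separately, so their momenta may differ. The
  factors \<open>K\<close> and \<open>1 / (2 * K)\<close> are those of the Legendre transform of
  \<open>K / 2 * u^2\<close>. The second half needs a bound on \<open>xm\<close> because the strip
  confining its curves is centred there.\<close>

lemma calib_diff_le_half_dist:
  assumes "\<bar>b\<bar> \<le> 3 * R" "\<bar>k\<bar> \<le> 3 * R"
  shows "calib (L - e) (1 / (2 * K)) (K * b) (K * k) (xm, ym, zm) - calib (L - e) (1 / (2 * K)) (K * b) (K * k) (xp, yp, zp) \<le> dpq / 2"
    "\<bar>xm\<bar> \<le> 2 \<Longrightarrow> calib (L - e) (1 / (2 * K)) (K * b) (K * k) (xq, yq, zq) - calib (L - e) (1 / (2 * K)) (K * b) (K * k) (xm, ym, zm) \<le> dpq / 2"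
proof -
  \<comment> \<open>As \<open>3 * L \<le> 31/10 * (L - e)\<close>, a curve of length below
    \<open>3 * L\<close> moves at most 31/10 in x, so it stays within 51/10 of the origin.\<close>
  have rng: "\<bar>K * b + K * k * x\<bar> \<le> 20 * K * R" if x: "(L - e) * \<bar>x - x0\<bar> \<le> 3 * L" and x0: "\<bar>x0\<bar> \<le> 2" for x x0
  proof -
    have "(L - e) * \<bar>x - x0\<bar> \<le> (L - e) * (31/10)" using x A_pos by linarith
    then have "\<bar>x - x0\<bar> \<le> 31/10" using mult_le_cancel_left_pos[OF A_pos(1)] by blast
    then have "\<bar>x\<bar> \<le> 51/10" using x0 by linarith
    then have "\<bar>k * x\<bar> \<le> 3 * R * (51/10)" using assms by (intro abs_mult_le)
    then have "\<bar>b + k * x\<bar> \<le> 20 * R" using assms R by linarith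
    then have "K * \<bar>b + k * x\<bar> \<le> K * (20 * R)" using K by (intro mult_left_mono) auto
    moreover have "\<bar>K * b + K * k * x\<bar> = K * \<bar>b + k * x\<bar>" using K by (simp add: abs_mult distrib_left[symmetric] mult.assoc)
    ultimately show ?thesis by simp
  qed
  have "dpq \<ge> 0" by (rule sf_dist_nonneg[OF n])
  then have d: "dpq / 2 < 3 * L" using dpq_bound(2) L by linarith
  have xp: "\<bar>xp\<bar> \<le> 2" by (intro abs_leI) (use pq_linear in linarith)+
  have pm: "20 * K * R \<ge> 0" using K R by simp
  show "calib (L - e) (1 / (2 * K)) (K * b) (K * k) (xm, ym, zm) - calib (L - e) (1 / (2 * K)) (K * b) (K * k) (xp, yp, zp) \<le> dpq / 2"
    using sf_dist_ge_calib[OF n A_pos(1) dual pm, of "(xp,yp,zp)" "3*L" "K*b" "K*k" "(xm,ym,zm)"] rng[of _ xp] xp mid d by simp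
  show "calib (L - e) (1 / (2 * K)) (K * b) (K * k) (xq, yq, zq) - calib (L - e) (1 / (2 * K)) (K * b) (K * k) (xm, ym, zm) \<le> dpq / 2" if "\<bar>xm\<bar> \<le> 2"
    using sf_dist_ge_calib[OF n A_pos(1) dual pm, of "(xm,ym,zm)" "3*L" "K*b" "K*k" "(xq,yq,zq)"] rng[of _ xm] that mid d by simp
qed

text \<open>With momentum 0 each half of the distance is at least \<open>L - e\<close> times its
  x-displacement. The excess in \<open>dpq_bound\<close> is of order \<open>K * R^2\<close>, which
  is small against \<open>L * R\<close>.\<close>

lemma xm_bound: "\<bar>xm - (xp + xq) / 2\<bar> \<le> R / 20" "\<bar>xm\<bar> \<le> 11/10 * R"
proof -
  have A1: "(L - e) * (xm - xp) \<le> dpq / 2" 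
    using calib_diff_le_half_dist(1)[of 0 0] R by (simp add: calib_def algebra_simps)
  have s: "(L - e) * r \<le> (L - e) * (R / 20) \<Longrightarrow> r \<le> R / 20" for r using A_pos by simp
  have "11 * K * R\<^sup>2 \<le> 11 * (L / 1000 * R)" using KRL R by (simp add: power2_eq_square)
  also have "\<dots> \<le> (L - e) * (R / 20) * 2"
  proof -
    have "L * R \<le> (31/30 * (L - e)) * R" using A_pos R by (intro mult_right_mono) auto
    moreover have "(L - e) * R \<ge> 0" using A_pos R by simp
    ultimately show ?thesis by (simp add: algebra_simps)
  qed
  finally have "dpq \<le> (L - e) * (xq - xp) + (L - e) * (R / 20) * 2" using dpq_bound(1) by linarith
  also have "\<dots> = 2 * ((L - e) * ((xq - xp) / 2 + R / 20))" by (simp add: field_simps)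
  finally have D: "dpq / 2 \<le> (L - e) * ((xq - xp) / 2 + R / 20)" by simp
  have "(L - e) * (xm - xp) \<le> (L - e) * ((xq - xp) / 2 + R / 20)" using A1 D by linarith
  then have 1: "xm - xp \<le> (xq - xp) / 2 + R / 20" using mult_le_cancel_left_pos[OF A_pos(1)] by blast
  \<comment> \<open>The second part of \<open>calib_diff_le_half_dist\<close> presupposes a bound on
    \<open>xm\<close>. With momentum range 0 the strip condition of \<open>sf_dist_ge_calib\<close>
    is trivial, so no such bound enters.\<close>
  have "(L - e) * (xq - xm) \<le> dpq / 2" 
  proof -
    have d0: "(L - e) * v1 \<le> n (v1, v2)" for v1 v2 using dual[of 0 v1 v2] K R by simp
    have "dpq / 2 < 3 * L" using dpq_bound(2) sf_dist_nonneg[OF n, of "(xp,yp,zp)" "(xq,yq,zq)"] L by linarith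
    then show ?thesis
      using sf_dist_ge_calib[OF n A_pos(1), of 0 0 "(xm,ym,zm)" "3*L" 0 0 "(xq,yq,zq)"] d0 mid
      by (simp add: calib_def algebra_simps)
  qed
  then have "(L - e) * (xq - xm) \<le> (L - e) * ((xq - xp) / 2 + R / 20)" using D by linarith
  then have 2: "xq - xm \<le> (xq - xp) / 2 + R / 20" using mult_le_cancel_left_pos[OF A_pos(1)] by blast
  show 3: "\<bar>xm - (xp + xq) / 2\<bar> \<le> R / 20" by (intro abs_leI) (use 1 2 in \<open>simp_all add: field_simps\<close>)
  then have "xm - (xp + xq) / 2 \<le> R / 20" "- (xm - (xp + xq) / 2) \<le> R / 20" by (simp_all only: abs_le_iff)
  then show "\<bar>xm\<bar> \<le> 11/10 * R" by (intro abs_leI) (use pq_linear in \<open>simp_all add: field_simps\<close>)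
qed

text \<open>Add the calibrations of the two halves and compare with \<open>dpq_upper\<close>: the
  terms in \<open>L\<close> cancel and \<open>K\<close> divides out. The subtracted terms are half
  the integrals of \<open>(b1 + k1 x)^2\<close> over [-1, 0] and of \<open>(b2 + k2 x)^2\<close>
  over [0, 1]. Inserting momenta close to that of the model geodesic turns near-optimality into
  bounds on \<open>ym\<close> and \<open>zm\<close>.\<close>

lemma calib_test_inequality:
  assumes b: "\<bar>b1\<bar> \<le> 3 * R" "\<bar>k1\<bar> \<le> 3 * R" "\<bar>b2\<bar> \<le> 3 * R" "\<bar>k2\<bar> \<le> 3 * R"
  shows "b1 * (ym - yp) + b2 * (yq - ym) + k1 * (zm + xm * ym / 2 - zp - xp * yp / 2) + k2 * (zq + xq * yq / 2 - zm - xm * ym / 2)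
     - (b1\<^sup>2 - b1 * k1 + k1\<^sup>2 / 3 + b2\<^sup>2 + b2 * k2 + k2\<^sup>2 / 3) / 2 \<le> (yq - yp)\<^sup>2 / 4 + 3/4 * \<zeta>\<^sup>2 + R\<^sup>2 / 10000"
proof -
  have "- (11/10 * R) \<le> xm" "xm \<le> 11/10 * R" using xm_bound(2) by linarith+
  note lin = this pq_linear
  have x: "\<bar>xm\<bar> \<le> 2" "\<bar>xm - 0\<bar> \<le> 2 * R" "\<bar>xp\<bar> \<le> 2" "\<bar>xq\<bar> \<le> 2" "\<bar>xp - (-1)\<bar> \<le> 2 * R" "\<bar>xq - 1\<bar> \<le> 2 * R"
    by (intro abs_leI; use lin in linarith)+
  let ?c = "\<lambda>b k. calib (L - e) (1 / (2 * K)) (K * b) (K * k)"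
  define T where "T b k x y z = b * y + k * (z + x * y / 2) - affine_energy b k x / 2" for b k x y z
  have eq: "?c b k (x, y, z) = (L - e) * x + K * T b k x y z" for b k x y z
    using K by (simp add: T_def calib_def affine_energy_def field_simps power2_eq_square)
  define P where "P = b1 * (ym - yp) + b2 * (yq - ym) + k1 * (zm + xm * ym / 2 - zp - xp * yp / 2) + k2 * (zq + xq * yq / 2 - zm - xm * ym / 2)"
  define E where "E = affine_energy b1 k1 xm - affine_energy b1 k1 xp + affine_energy b2 k2 xq - affine_energy b2 k2 xm"
  have "?c b1 k1 (xm, ym, zm) - ?c b1 k1 (xp, yp, zp) + (?c b2 k2 (xq, yq, zq) - ?c b2 k2 (xm, ym, zm)) \<le> dpq"
    using calib_diff_le_half_dist(1)[OF b(1,2)] calib_diff_le_half_dist(2)[OF b(3,4) x(1)] by linarith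
  moreover have "?c b1 k1 (xm, ym, zm) - ?c b1 k1 (xp, yp, zp) + (?c b2 k2 (xq, yq, zq) - ?c b2 k2 (xm, ym, zm))
     = (L - e) * (xq - xp) + K * (T b1 k1 xm ym zm - T b1 k1 xp yp zp + T b2 k2 xq yq zq - T b2 k2 xm ym zm)"
    unfolding eq by (simp add: algebra_simps)
  moreover have "T b1 k1 xm ym zm - T b1 k1 xp yp zp + T b2 k2 xq yq zq - T b2 k2 xm ym zm = P - E / 2"
    by (simp add: T_def P_def E_def algebra_simps add_divide_distrib diff_divide_distrib)
  ultimately have "(L - e) * (xq - xp) + K * (P - E / 2) \<le> dpq" by simp
  moreover have "(L - e) * (xq - xp) = L * (xq - xp) - e * (xq - xp)" by (simp add: algebra_simps)
  moreover have "K / 2 * ((yq - yp)\<^sup>2 / 2 + 3/2 * \<zeta>\<^sup>2 + 100 * R^3) = K * ((yq - yp)\<^sup>2 / 4 + 3/4 * \<zeta>\<^sup>2 + 50 * R^3)"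
    by (simp add: algebra_simps)
  moreover have "e * (xq - xp) \<le> K * (R\<^sup>2 / 200000)"
  proof -
    have X: "xq - xp \<le> 21/10" "xq - xp \<ge> 0" using pq_linear by linarith+
    have KR: "K * R\<^sup>2 \<ge> 0" using K by simp
    have "e * (xq - xp) \<le> K * R\<^sup>2 / 1000000 * (21/10)" by (rule mult_mono) (use e X KR in auto)
    then show ?thesis using KR by simp
  qed
  ultimately have "K * (P - E / 2) \<le> K * ((yq - yp)\<^sup>2 / 4 + 3/4 * \<zeta>\<^sup>2 + 50 * R^3) + 2 * (K * (R\<^sup>2 / 200000))"
    using dpq_upper by linarith
  also have "\<dots> = K * ((yq - yp)\<^sup>2 / 4 + 3/4 * \<zeta>\<^sup>2 + 50 * R^3 + R\<^sup>2 / 100000)" by (simp add: algebra_simps)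
  finally have main: "P - E / 2 \<le> (yq - yp)\<^sup>2 / 4 + 3/4 * \<zeta>\<^sup>2 + 50 * R^3 + R\<^sup>2 / 100000"
    using mult_le_cancel_left_pos[OF K] by blast
  have "affine_energy b1 k1 xm - affine_energy b1 k1 0 \<le> 200 * R^3" "- (affine_energy b1 k1 xp - affine_energy b1 k1 (-1)) \<le> 200 * R^3"
    "affine_energy b2 k2 xq - affine_energy b2 k2 1 \<le> 200 * R^3" "- (affine_energy b2 k2 xm - affine_energy b2 k2 0) \<le> 200 * R^3"
    using affine_energy_diff[OF b(1,2) x(1) _ x(2)] affine_energy_diff[OF b(1,2) x(3) _ x(5)]
      affine_energy_diff[OF b(3,4) x(4) _ x(6)] affine_energy_diff[OF b(3,4) x(1) _ x(2)] by (simp_all only: abs_le_iff) simp_all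
  moreover have "affine_energy b k 0 = 0" "affine_energy b k 1 = b\<^sup>2 + b * k + k\<^sup>2 / 3" "affine_energy b k (-1) = - (b\<^sup>2 - b * k + k\<^sup>2 / 3)" for b k
    by (simp_all add: affine_energy_def)
  ultimately have EB: "E \<le> (b1\<^sup>2 - b1 * k1 + k1\<^sup>2 / 3 + b2\<^sup>2 + b2 * k2 + k2\<^sup>2 / 3) + 800 * R^3" unfolding E_def by simp
  define B where "B = b1\<^sup>2 - b1 * k1 + k1\<^sup>2 / 3 + b2\<^sup>2 + b2 * k2 + k2\<^sup>2 / 3"
  have "P - B / 2 \<le> (yq - yp)\<^sup>2 / 4 + 3/4 * \<zeta>\<^sup>2 + R\<^sup>2 / 10000"
    using EB main small_R unfolding B_def[symmetric] by linarith
  then show ?thesis unfolding P_def B_def .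
qed

lemma prod_bounds: "\<bar>(xp + 1) * yp\<bar> \<le> R\<^sup>2" "\<bar>(xq - 1) * yq\<bar> \<le> R\<^sup>2"
  unfolding power2_eq_square by (intro abs_mult_le; use p q in simp)+

text \<open>The affine momentum of the model geodesic from \<open>p\<close> to \<open>q\<close> is \<open>(yq - yp)/2 + (3/2) \<zeta> x\<close>. It is perturbed by
  \<open>s (6 x \<plusminus> 4)\<close> on the two halves, the direction that detects \<open>ym\<close> alone.\<close>
lemma ym_bound: "\<bar>ym\<bar> \<le> 44/100 * R"
proof -
  define \<mu> where "\<mu> = ym - (yp + yq) / 2 + 3/4 * \<zeta>"
  have z: "\<bar>\<zeta>\<bar> \<le> 6/5 * R" by (rule zeta_bound)
  \<comment> \<open>\<open>\<mu>\<close> is the deviation of \<open>ym\<close> from its model value.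
    The perturbation gains \<open>8 * s * \<mu>\<close> and costs \<open>4 * s^2\<close>, so
    \<open>\<mu>\<close> is bounded by \<open>s / 2\<close> plus an error divided by
    \<open>8 * s\<close>. The choice \<open>R / 20\<close> keeps both within
    \<open>R / 30\<close>.\<close>
  have *: "8 * (s * \<mu>) \<le> R\<^sup>2 / 80" if s: "\<bar>s\<bar> = R / 20" for s
  proof -
    define d where "d = yq - yp"
    define k where "k = 3/2 * \<zeta> + 6 * s"
    define E where "E = ((xq - 1) * yq - (xp + 1) * yp) / 2"
    have d: "\<bar>d\<bar> \<le> 2 * R" unfolding d_def by (intro abs_leI) (use pq_linear in linarith)+
    have kb: "\<bar>k\<bar> \<le> 3 * R" using z s R unfolding k_def by linarith
    have Eb: "\<bar>E\<bar> \<le> R\<^sup>2" unfolding E_def by (intro abs_half_le prod_bounds)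
    have T: "(d/2 + 4 * s) * (ym - yp) + (d/2 - 4 * s) * (yq - ym) + k * (zm + xm * ym / 2 - zp - xp * yp / 2) + k * (zq + xq * yq / 2 - zm - xm * ym / 2)
     - ((d/2 + 4 * s)\<^sup>2 - (d/2 + 4 * s) * k + k\<^sup>2 / 3 + (d/2 - 4 * s)\<^sup>2 + (d/2 - 4 * s) * k + k\<^sup>2 / 3) / 2 \<le> (yq - yp)\<^sup>2 / 4 + 3/4 * \<zeta>\<^sup>2 + R\<^sup>2 / 10000"
      by (rule calib_test_inequality) (use d s kb R in linarith)+
    have ze: "zm + xm * ym / 2 - zp - xp * yp / 2 + (zq + xq * yq / 2 - zm - xm * ym / 2) = \<zeta> + E"
      by (simp add: E_def \<zeta>_def field_simps)
    have ymu: "ym = \<mu> + (yp + yq) / 2 - 3/4 * \<zeta>" by (simp add: \<mu>_def)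
    have "(d/2 + 4 * s) * (ym - yp) + (d/2 - 4 * s) * (yq - ym) = d * d / 2 + 8 * s * (\<mu> - 3/4 * \<zeta>)"
      unfolding ymu d_def by (simp add: field_simps)
    moreover have "k * (zm + xm * ym / 2 - zp - xp * yp / 2) + k * (zq + xq * yq / 2 - zm - xm * ym / 2) = k * \<zeta> + k * E"
      unfolding distrib_left[symmetric] ze ..
    moreover have "((d/2 + 4 * s)\<^sup>2 - (d/2 + 4 * s) * k + k\<^sup>2 / 3 + (d/2 - 4 * s)\<^sup>2 + (d/2 - 4 * s) * k + k\<^sup>2 / 3) / 2
        = d * d / 4 + 3/4 * \<zeta>\<^sup>2 + 4 * s\<^sup>2"
      unfolding k_def by (simp add: field_simps power2_eq_square)
    moreover have "k * \<zeta> = 3/2 * \<zeta>\<^sup>2 + 6 * s * \<zeta>" by (simp add: k_def field_simps power2_eq_square)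
    moreover have "(yq - yp)\<^sup>2 / 4 = d * d / 4" by (simp add: d_def power2_eq_square)
    moreover have "8 * s * (\<mu> - 3/4 * \<zeta>) + 6 * s * \<zeta> = 8 * (s * \<mu>)" by (simp add: algebra_simps)
    ultimately have "8 * (s * \<mu>) \<le> 4 * s\<^sup>2 - k * E + R\<^sup>2 / 10000"
      using T by linarith
    moreover have "\<bar>k * E\<bar> \<le> 3 * R * R\<^sup>2" by (rule abs_mult_le[OF kb Eb])
    moreover have "3 * R * R\<^sup>2 \<le> R\<^sup>2 / 10000"
    proof -
      have "3 * R * R\<^sup>2 = 3 * R^3" by (simp add: power2_eq_square power3_eq_cube)
      then show ?thesis using small_R(2,4) by linarith
    qed
    moreover have "s\<^sup>2 = R\<^sup>2 / 400"
    proof -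
      have "s\<^sup>2 = \<bar>s\<bar>\<^sup>2" by simp
      then show ?thesis unfolding s by (simp add: power_divide)
    qed
    ultimately show ?thesis using small_R by linarith
  qed
  have "\<bar>\<mu>\<bar> \<le> R / 30"
  proof -
    have "8 * (R / 20 * \<mu>) \<le> R\<^sup>2 / 80" "8 * (- R / 20 * \<mu>) \<le> R\<^sup>2 / 80" using *[of "R/20"] *[of "-R/20"] R by auto
    then have "R * (8 * \<mu> / 20) \<le> R * (R / 80)" "R * (- 8 * \<mu> / 20) \<le> R * (R / 80)" by (simp_all add: power2_eq_square)
    then have "8 * \<mu> / 20 \<le> R / 80" "- 8 * \<mu> / 20 \<le> R / 80" using R mult_le_cancel_left_pos by blast+
    then show ?thesis by (simp add: abs_le_iff)
  qed
  \<comment> \<open>Inserting \<open>\<zeta>\<close> reduces the weight of \<open>yp + yq\<close>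
    from 1/2 to 1/2 - 3/8 = 1/8. The total is at most R/30 + R/4 + (3/4)(R/5), below (44/100)
    R.\<close>
  moreover have "ym = \<mu> + (yp + yq) / 8 - 3/4 * (zq - zp)" by (simp add: \<mu>_def \<zeta>_def field_simps)
  ultimately show ?thesis using pq_linear by (simp add: abs_le_iff field_simps)
qed

text \<open>The same momentum perturbed by \<open>\<plusminus> s (x \<plusminus> 1/2)\<close> on the two halves detects \<open>zm\<close>.\<close>
lemma zm_bound: "\<bar>zm\<bar> \<le> 11/100 * R"
proof -
  define \<nu> where "\<nu> = 2 * zm - zp - zq"
  have z: "\<bar>\<zeta>\<bar> \<le> 6/5 * R" by (rule zeta_bound)
  \<comment> \<open>Here the gain is \<open>s * \<nu>\<close> and the cost \<open>s^2 / 12\<close>.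
    With size \<open>R / 10\<close> this bounds \<open>\<nu>\<close> by \<open>R / 50\<close>, hence
    \<open>zm\<close> by R/10 + R/100.\<close>
  have *: "s * \<nu> \<le> R\<^sup>2 / 500" if s: "\<bar>s\<bar> = R / 10" for s
  proof -
    define d where "d = yq - yp"
    define E where "E = ((xq - 1) * yq - (xp + 1) * yp) / 2"
    define F where "F = xm * ym - ((xq - 1) * yq + (xp + 1) * yp) / 2"
    have d: "\<bar>d\<bar> \<le> 2 * R" unfolding d_def by (intro abs_leI) (use pq_linear in linarith)+
    have Eb: "\<bar>E\<bar> \<le> R\<^sup>2" unfolding E_def by (intro abs_half_le prod_bounds)
    \<comment> \<open>Calibrations see \<open>z + x * y / 2\<close> rather than \<open>z\<close>;
      the bound on \<open>ym\<close> already obtained makes the difference at the midpoint second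
      order.\<close>
    have "\<bar>xm * ym\<bar> \<le> 11/10 * R * (44/100 * R)" by (rule abs_mult_le[OF xm_bound(2) ym_bound])
    then have "\<bar>xm * ym\<bar> \<le> R\<^sup>2" using R by (simp add: power2_eq_square)
    moreover have "\<bar>((xq - 1) * yq + (xp + 1) * yp) / 2\<bar> \<le> R\<^sup>2" by (intro abs_half_le prod_bounds)
    ultimately have Fb: "\<bar>F\<bar> \<le> 2 * R\<^sup>2" unfolding F_def
      using abs_triangle_ineq4[of "xm * ym" "((xq - 1) * yq + (xp + 1) * yp) / 2"] by linarith
    have T: "(d/2 + s/2) * (ym - yp) + (d/2 + s/2) * (yq - ym) + (3/2 * \<zeta> + s) * (zm + xm * ym / 2 - zp - xp * yp / 2) + (3/2 * \<zeta> - s) * (zq + xq * yq / 2 - zm - xm * ym / 2)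
     - ((d/2 + s/2)\<^sup>2 - (d/2 + s/2) * (3/2 * \<zeta> + s) + (3/2 * \<zeta> + s)\<^sup>2 / 3 + (d/2 + s/2)\<^sup>2 + (d/2 + s/2) * (3/2 * \<zeta> - s) + (3/2 * \<zeta> - s)\<^sup>2 / 3) / 2 \<le> (yq - yp)\<^sup>2 / 4 + 3/4 * \<zeta>\<^sup>2 + R\<^sup>2 / 10000"
      by (rule calib_test_inequality) (use d s z R in linarith)+
    have "(d/2 + s/2) * (ym - yp) + (d/2 + s/2) * (yq - ym) = (d/2 + s/2) * d"
      by (simp add: d_def field_simps)
    moreover have "(3/2 * \<zeta> + s) * (zm + xm * ym / 2 - zp - xp * yp / 2) + (3/2 * \<zeta> - s) * (zq + xq * yq / 2 - zm - xm * ym / 2)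
        = 3/2 * \<zeta> * (\<zeta> + E) + s * (\<nu> + F - d / 2)"
    proof -
      have 1: "zm + xm * ym / 2 - zp - xp * yp / 2 + (zq + xq * yq / 2 - zm - xm * ym / 2) = \<zeta> + E"
        by (simp add: E_def \<zeta>_def field_simps)
      have 2: "zm + xm * ym / 2 - zp - xp * yp / 2 - (zq + xq * yq / 2 - zm - xm * ym / 2) = \<nu> + F - d / 2"
        by (simp add: F_def \<nu>_def d_def field_simps)
      have "(a + s) * u + (a - s) * v = a * (u + v) + s * (u - v)" for a u v by (simp add: algebra_simps)
      then show ?thesis by (simp only: 1 2)
    qed
    moreover have "((d/2 + s/2)\<^sup>2 - (d/2 + s/2) * (3/2 * \<zeta> + s) + (3/2 * \<zeta> + s)\<^sup>2 / 3 + (d/2 + s/2)\<^sup>2 + (d/2 + s/2) * (3/2 * \<zeta> - s) + (3/2 * \<zeta> - s)\<^sup>2 / 3) / 2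
       = d * d / 4 + 3/4 * (\<zeta> * \<zeta>) + s * s / 12"
      by (simp add: field_simps power2_eq_square)
    moreover have "(yq - yp)\<^sup>2 / 4 = d * d / 4" by (simp add: d_def power2_eq_square)
    moreover have "(d/2 + s/2) * d = d * d / 2 + s * d / 2" "3/2 * \<zeta> * (\<zeta> + E) = 3/2 * (\<zeta> * \<zeta>) + 3/2 * (\<zeta> * E)"
      "s * (\<nu> + F - d / 2) = s * \<nu> + s * F - s * d / 2" by (simp_all add: field_simps)
    moreover have "\<zeta>\<^sup>2 = \<zeta> * \<zeta>" by (simp add: power2_eq_square)
    ultimately have "s * \<nu> \<le> s * s / 12 - 3/2 * (\<zeta> * E) - s * F + R\<^sup>2 / 10000"
      using T by linarith
    moreover have "\<bar>\<zeta> * E\<bar> \<le> 6/5 * R * R\<^sup>2" by (rule abs_mult_le[OF z Eb])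
    moreover have "\<bar>s * F\<bar> \<le> R / 10 * (2 * R\<^sup>2)" by (rule abs_mult_le[OF _ Fb]) (use s in simp)
    moreover have "3 * R * R\<^sup>2 \<le> R\<^sup>2 / 10000"
    proof -
      have "3 * R * R\<^sup>2 = 3 * R^3" by (simp add: power2_eq_square power3_eq_cube)
      then show ?thesis using small_R(2,4) by linarith
    qed
    moreover have "s * s = R\<^sup>2 / 100"
    proof -
      have "s * s = \<bar>s\<bar>\<^sup>2" by (simp add: power2_eq_square)
      then show ?thesis unfolding s by (simp add: power_divide)
    qed
    moreover have "R * R\<^sup>2 \<ge> 0" using R by simp
    ultimately show ?thesis using small_R by linarith
  qed
  have "\<bar>\<nu>\<bar> \<le> R / 50"
  proof -
    have "R / 10 * \<nu> \<le> R\<^sup>2 / 500" "- R / 10 * \<nu> \<le> R\<^sup>2 / 500" using *[of "R/10"] *[of "-R/10"] R by auto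
    then have "R * (\<nu> / 10) \<le> R * (R / 500)" "R * (- \<nu> / 10) \<le> R * (R / 500)" by (simp_all add: power2_eq_square)
    then have "\<nu> / 10 \<le> R / 500" "- \<nu> / 10 \<le> R / 500" using R mult_le_cancel_left_pos by blast+
    then show ?thesis by (simp add: abs_le_iff)
  qed
  then have "\<nu> \<le> R / 50" "- \<nu> \<le> R / 50" by linarith+
  then show ?thesis unfolding \<nu>_def by (intro abs_leI) (use pq_linear in linarith)+
qed

end

section \<open>Directions of almost quadratic expansion\<close>

lemma wedge_le: "\<bar>fst v * snd w - snd v * fst w\<bar> \<le> norm v * norm (w :: R2)"
proof -
  have "\<bar>inner v (snd w, - fst w)\<bar> \<le> norm v * norm (snd w, - fst w)" by (rule Cauchy_Schwarz_ineq2)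
  moreover have "norm (snd w, - fst w) = norm w" by (cases w) (simp add: norm_Pair add.commute)
  moreover have "inner v (snd w, - fst w) = fst v * snd w - snd v * fst w" by (cases v) (simp add: inner_Pair)
  ultimately show ?thesis by simp
qed

lemma is_norm_lower_bound:
  assumes n: "is_norm n"
  obtains c where "c > 0" "\<And>v. c * norm v \<le> n v"
proof -
  have "compact (sphere (0::R2) 1)" "(1, 0) \<in> sphere (0::R2) 1" by simp_all
  then have "\<exists>v0\<in>sphere 0 1. \<forall>v\<in>sphere 0 1. n v0 \<le> n v"
    by (intro continuous_attains_inf is_norm_continuous[OF n]) blast+
  then obtain v0 where v0: "v0 \<in> sphere 0 1" "\<And>v. v \<in> sphere 0 1 \<Longrightarrow> n v0 \<le> n v" by blast
  have "v0 \<noteq> 0" using v0(1) by auto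
  then have pos: "n v0 > 0" using is_normD(1,2)[OF n, of v0] by linarith
  have "n v0 * norm v \<le> n v" for v
  proof (cases "v = 0")
    case True then show ?thesis using is_normD(1)[OF n] by simp
  next
    case False
    then have nv: "norm v > 0" by simp
    have "n v0 \<le> n ((1 / norm v) *\<^sub>R v)" by (rule v0(2)) (use False in simp)
    also have "\<dots> = n v / norm v" by (simp only: is_normD(3)[OF n]) simp
    finally show ?thesis using nv by (simp only: pos_le_divide_eq)
  qed
  then show ?thesis using pos that by blast
qed

text \<open>The derivative at \<open>v\<close> is the norming functional of \<open>v\<close>:
  subadditivity bounds every difference quotient in direction \<open>w\<close> by
  \<open>n w\<close>, and homogeneity gives Euler's identity.\<close>

lemma C1_norm_support:
  assumes n: "is_norm n" and C1: "C1_norm n"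
  obtains D :: "R2 \<Rightarrow> R2 \<Rightarrow> real" where "\<And>v w. v \<noteq> 0 \<Longrightarrow> D v w \<le> n w" "\<And>v. v \<noteq> 0 \<Longrightarrow> D v v = n v"
    "\<And>v. v \<noteq> 0 \<Longrightarrow> linear (D v)" "\<And>v. v \<noteq> 0 \<Longrightarrow> (n has_derivative D v) (at v)"
proof -
  obtain D' :: "R2 \<Rightarrow> (R2 \<Rightarrow>\<^sub>L real)" where D': "\<And>x. x \<noteq> 0 \<Longrightarrow> (n has_derivative blinfun_apply (D' x)) (at x)"
    using C1 unfolding C1_norm_def by blast
  have dir: "((\<lambda>t. n (v + t *\<^sub>R w)) has_real_derivative blinfun_apply (D' v) w) (at 0)" if "v \<noteq> 0" for v w
  proof -
    have 1: "((\<lambda>t. v + t *\<^sub>R w) has_derivative (\<lambda>t. t *\<^sub>R w)) (at 0)" by (auto intro!: derivative_eq_intros)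
    have 2: "(n has_derivative blinfun_apply (D' v)) (at (v + 0 *\<^sub>R w))" using D'[OF that] by simp
    show ?thesis using has_derivative_compose[OF 1 2]
      by (simp add: has_field_derivative_def blinfun.scaleR_right mult_commute_abs)
  qed
  show ?thesis
  proof (rule that[of "\<lambda>v. blinfun_apply (D' v)"])
    fix v w :: R2 assume v: "v \<noteq> 0"
    show "linear (blinfun_apply (D' v))" by (simp add: blinfun.bounded_linear_right bounded_linear.linear)
    show "(n has_derivative blinfun_apply (D' v)) (at v)" by (rule D'[OF v])
    have "((\<lambda>t. (n (v + t *\<^sub>R w) - n v) / t) \<longlongrightarrow> blinfun_apply (D' v) w) (at 0)"
      using dir[OF v, of w] by (simp add: has_field_derivative_iff)
    then have "((\<lambda>t. (n (v + t *\<^sub>R w) - n v) / t) \<longlongrightarrow> blinfun_apply (D' v) w) (at_right 0)"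
      by (rule filterlim_mono[OF _ order_refl at_le]) simp
    then show "blinfun_apply (D' v) w \<le> n w"
    proof (rule tendsto_upperbound)
      show "\<forall>\<^sub>F t in at_right 0. (n (v + t *\<^sub>R w) - n v) / t \<le> n w"
        using eventually_at_right_less[of "0::real"]
      proof (rule eventually_mono)
        fix t :: real assume t: "0 < t"
        have "n (v + t *\<^sub>R w) \<le> n v + n (t *\<^sub>R w)" by (rule is_normD[OF n])
        also have "n (t *\<^sub>R w) = t * n w" using t by (simp only: is_normD(3)[OF n] abs_of_pos)
        finally show "(n (v + t *\<^sub>R w) - n v) / t \<le> n w" using t by (simp add: field_simps)
      qed
    qed simp
    have "((\<lambda>t. n (v + t *\<^sub>R v)) has_real_derivative n v) (at 0)"
    proof (rule has_field_derivative_transform_within[where d = 1])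
      show "((\<lambda>t. (1 + t) * n v) has_real_derivative n v) (at 0)" by (auto intro!: derivative_eq_intros)
      fix t :: real assume "dist t 0 < 1"
      then have t: "1 + t > 0" by (auto simp: dist_real_def)
      have "n (v + t *\<^sub>R v) = n ((1 + t) *\<^sub>R v)" by (simp add: scaleR_add_left)
      also have "\<dots> = (1 + t) * n v" using t by (simp only: is_normD(3)[OF n] abs_of_pos)
      finally show "(1 + t) * n v = n (v + t *\<^sub>R v)" by simp
    qed auto
    then show "blinfun_apply (D' v) v = n v" using dir[OF v, of v] DERIV_unique by blast
  qed
qed

text \<open>Strong convexity is tested on the unit vectors in directions \<open>(1,a)\<close> and \<open>(1,b)\<close>.\<close>
lemma strongly_convex_slope:
  assumes n: "is_norm n" and sc: "strongly_convex_norm n"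
    and D: "\<And>v w. v \<noteq> 0 \<Longrightarrow> D v w \<le> n w" "\<And>v. v \<noteq> 0 \<Longrightarrow> D v v = n v" "\<And>v. v \<noteq> 0 \<Longrightarrow> linear (D v)"
  obtains c where "c > 0" "\<And>a b. \<lbrakk>0 \<le> a; a < b; b \<le> 1\<rbrakk> \<Longrightarrow> c * (b - a) \<le> D (1,b) (0,1) - D (1,a) (0,1)"
proof -
  obtain \<alpha> where \<alpha>: "\<alpha> > 0" and sconv: "\<And>x y t. t \<in> {0..1} \<Longrightarrow> (1/2) * (n (t *\<^sub>R x + (1 - t) *\<^sub>R y))\<^sup>2
          \<le> t * ((1/2) * (n x)\<^sup>2) + (1 - t) * ((1/2) * (n y)\<^sup>2) - \<alpha> / 2 * t * (1 - t) * (n (x - y))\<^sup>2"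
    using sc unfolding strongly_convex_norm_def by blast
  obtain m where m: "m > 0" "\<And>v. m * norm v \<le> n v" using is_norm_lower_bound[OF n] by blast
  obtain M where M: "M > 0" "\<And>v. n v \<le> M * norm v" using is_norm_bound[OF n] by blast
  have l_low: "m \<le> n (1, u)" for u
  proof -
    have "m * 1 \<le> m * norm (1::real, u)" using norm_fst_le[of "1::real" u] m(1) by (intro mult_left_mono) auto
    then show ?thesis using m(2)[of "(1,u)"] by linarith
  qed
  have l_up: "n (1, u) \<le> 2 * M" if "0 \<le> u" "u \<le> 1" for u
  proof -
    have "norm (1::real, u) \<le> norm (1::real) + norm u" by (rule norm_Pair_le)
    also have "\<dots> \<le> 2" using that by simp
    finally have "M * norm (1::real, u) \<le> M * 2" using M(1) by (intro mult_left_mono) auto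
    then show ?thesis using M(2)[of "(1,u)"] by simp
  qed
  \<comment> \<open>Product of the lower bound \<open>m\<close> for \<open>lb\<close>, the factor
    \<open>\<alpha> / 4\<close> from strong convexity at the midpoint, and the squared ratio by
    which the slopes \<open>a\<close> and \<open>b\<close> separate the corresponding unit
    vectors.\<close>
  define c where "c = \<alpha> * m / 4 * (m\<^sup>2 / (4 * M\<^sup>2))\<^sup>2"
  have half: "D (1,a) (0,1) * (b - a) \<le> n (1,b) - n (1,a) - c * (b - a)\<^sup>2"
    if ab: "0 \<le> a" "a \<le> 1" "0 \<le> b" "b \<le> 1" for a b
  proof -
    define la lb where "la = n (1,a)" and "lb = n (1,b)"
    have la: "0 < la" "m \<le> la" "la \<le> 2 * M" and lb: "0 < lb" "m \<le> lb" "lb \<le> 2 * M"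
      using l_low[of a] l_low[of b] l_up ab m(1) by (auto simp: la_def lb_def)
    have nz: "(1, a) \<noteq> (0::R2)" by (simp add: zero_prod_def)
    interpret lin: linear "D (1,a)" by (rule D(3)[OF nz])
    define x y where "x = (1 / la) *\<^sub>R (1::real, a)" and "y = (1 / lb) *\<^sub>R (1::real, b)"
    have nx: "n x = 1" "n y = 1"
      unfolding x_def y_def is_normD(3)[OF n] la_def[symmetric] lb_def[symmetric] using la lb by simp_all
    define \<tau> where "\<tau> = \<alpha> / 4 * (n (x - y))\<^sup>2"
    define s where "s = n ((1/2) *\<^sub>R x + (1 - 1/2) *\<^sub>R y)"
    have s: "s\<^sup>2 \<le> 1 - \<tau>" using sconv[of "1/2" x y] nx by (simp add: s_def \<tau>_def)
    have s0: "s \<ge> 0" unfolding s_def by (rule is_normD[OF n])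
    have t0: "\<tau> \<ge> 0" using \<alpha> by (simp add: \<tau>_def)
    have "s \<le> 1 - \<tau> / 2"
    proof (rule power2_le_imp_le)
      have "(1 - \<tau>/2)\<^sup>2 = 1 - \<tau> + \<tau>\<^sup>2 / 4" by (simp add: power2_eq_square field_simps)
      then show "s\<^sup>2 \<le> (1 - \<tau>/2)\<^sup>2" using s zero_le_power2[of \<tau>] by linarith
      have "s\<^sup>2 \<ge> 0" by simp
      then show "0 \<le> 1 - \<tau> / 2" using s by linarith
    qed
    \<comment> \<open>The norming functional of \<open>x\<close> is 1 at \<open>x\<close> and at
      most \<open>1 - \<tau> / 2\<close> at the midpoint of \<open>x\<close> and \<open>y\<close>,
      hence at most \<open>1 - \<tau>\<close> at \<open>y\<close>. After multiplication by
      \<open>lb\<close> this is a gap between the norm at \<open>(1, b)\<close> and its tangent line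
      at \<open>a\<close>.\<close>
    moreover have "D (1,a) ((1/2) *\<^sub>R x + (1 - 1/2) *\<^sub>R y) \<le> s" unfolding s_def by (rule D(1)[OF nz])
    moreover have "D (1,a) ((1/2) *\<^sub>R x + (1 - 1/2) *\<^sub>R y) = (1/2) * D (1,a) x + (1/2) * D (1,a) y"
      by (simp only: lin.add lin.scale) simp
    moreover have "D (1,a) x = 1"
      unfolding x_def lin.scale D(2)[OF nz] la_def[symmetric] using la by simp
    ultimately have "D (1,a) y \<le> 1 - \<tau>" by simp
    moreover have "D (1,a) y = (la + (b - a) * D (1,a) (0,1)) / lb"
    proof -
      have "y = (1 / lb) *\<^sub>R ((1,a) + (b - a) *\<^sub>R (0,1))" by (simp add: y_def)
      then have "D (1,a) y = (1 / lb) * (D (1,a) (1,a) + (b - a) * D (1,a) (0,1))"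
        by (simp only: lin.add lin.scale real_scaleR_def)
      then show ?thesis by (simp add: D(2)[OF nz] la_def)
    qed
    ultimately have 1: "la + (b - a) * D (1,a) (0,1) \<le> lb - lb * \<tau>"
      using lb by (simp add: field_simps)
    have "m * norm x \<le> 1" using m(2)[of x] nx by simp
    then have normx: "norm x \<le> 1 / m" using m(1) by (simp add: field_simps)
    \<comment> \<open>The parallelogram spanned by \<open>x\<close> and \<open>y\<close> has area
      \<open>\<bar>b - a\<bar> / (la * lb)\<close>, which bounds the distance between these unit
      vectors from below.\<close>
    have "\<bar>fst x * snd (y - x) - snd x * fst (y - x)\<bar> \<le> norm x * norm (y - x)" by (rule wedge_le)
    also have "fst x * snd (y - x) - snd x * fst (y - x) = (b - a) / (la * lb)"
      using la lb by (simp add: x_def y_def field_simps)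
    also have "norm x * norm (y - x) \<le> 1 / m * (n (x - y) / m)"
    proof (rule mult_mono[OF normx])
      show "norm (y - x) \<le> n (x - y) / m" using m(2)[of "x - y"] m(1) by (simp add: field_simps norm_minus_commute)
    qed (use m in auto)
    finally have "\<bar>b - a\<bar> / (la * lb) \<le> n (x - y) / m\<^sup>2" using la lb by (simp add: power2_eq_square abs_mult)
    moreover have "\<bar>b - a\<bar> / (4 * M\<^sup>2) \<le> \<bar>b - a\<bar> / (la * lb)"
    proof (rule divide_left_mono)
      have "la * lb \<le> 2 * M * (2 * M)" using la lb M by (intro mult_mono) auto
      then show "la * lb \<le> 4 * M\<^sup>2" by (simp add: power2_eq_square)
    qed (use la lb M in auto)
    ultimately have "\<bar>b - a\<bar> / (4 * M\<^sup>2) \<le> n (x - y) / m\<^sup>2" by linarith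
    then have "m\<^sup>2 / (4 * M\<^sup>2) * \<bar>b - a\<bar> \<le> n (x - y)" using m M by (simp add: field_simps)
    then have "(m\<^sup>2 / (4 * M\<^sup>2) * \<bar>b - a\<bar>)\<^sup>2 \<le> (n (x - y))\<^sup>2" by (intro power_mono) auto
    then have "\<alpha> / 4 * ((m\<^sup>2 / (4 * M\<^sup>2))\<^sup>2 * (b - a)\<^sup>2) \<le> \<tau>"
      unfolding \<tau>_def power_mult_distrib power2_abs using \<alpha> by (intro mult_left_mono) auto
    then have "m * (\<alpha> / 4 * ((m\<^sup>2 / (4 * M\<^sup>2))\<^sup>2 * (b - a)\<^sup>2)) \<le> lb * \<tau>"
      using lb m t0 \<alpha> by (intro mult_mono) auto
    moreover have "m * (\<alpha> / 4 * ((m\<^sup>2 / (4 * M\<^sup>2))\<^sup>2 * (b - a)\<^sup>2)) = c * (b - a)\<^sup>2" by (simp add: c_def)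
    moreover have "D (1,a) (0,1) * (b - a) = (b - a) * D (1,a) (0,1)" by (rule mult.commute)
    ultimately show ?thesis using 1 unfolding la_def lb_def by linarith
  qed
  show ?thesis
  proof (rule that[of "2 * c"])
    show "2 * c > 0" using \<alpha> m M by (simp add: c_def)
    fix a b :: real assume ab: "0 \<le> a" "a < b" "b \<le> 1"
    \<comment> \<open>Adding the tangent inequalities at \<open>a\<close> and at \<open>b\<close>
      cancels the values of the norm and leaves twice the gap.\<close>
    have "D (1,a) (0,1) * (b - a) \<le> n (1,b) - n (1,a) - c * (b - a)\<^sup>2" by (rule half) (use ab in auto)
    moreover have "D (1,b) (0,1) * (a - b) \<le> n (1,a) - n (1,b) - c * (a - b)\<^sup>2" by (rule half) (use ab in auto)
    ultimately have "(b - a) * (2 * c * (b - a)) \<le> (b - a) * (D (1,b) (0,1) - D (1,a) (0,1))"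
      by (simp add: algebra_simps power2_eq_square)
    then show "2 * c * (b - a) \<le> D (1,b) (0,1) - D (1,a) (0,1)" using ab by simp
  qed
qed

text \<open>The window is an interval on which the difference quotient of \<open>g\<close> is almost minimal: there, every
  difference quotient is squeezed between the infimum and a slightly larger number.\<close>
lemma almost_affine_window:
  fixes g :: "real \<Rightarrow> real"
  assumes c: "c > 0" and slope: "\<And>a b. \<lbrakk>0 \<le> a; a < b; b \<le> 1\<rbrakk> \<Longrightarrow> c * (b - a) \<le> g b - g a" and \<eta>: "\<eta> > 0"
  obtains K where "K > 0" "\<And>d. d > 0 \<Longrightarrow> \<exists>u \<delta>. 0 < \<delta> \<and> \<delta> \<le> d \<and> 0 \<le> u - \<delta> \<and> u + \<delta> \<le> 1 \<and>
     (\<forall>v. \<bar>v - u\<bar> \<le> \<delta> \<longrightarrow> \<bar>g v - g u - K * (v - u)\<bar> \<le> 2 * \<eta> * K * \<delta>)"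
proof -
  define Q where "Q = {(g b - g a) / (b - a) | a b. 0 \<le> a \<and> a < b \<and> b \<le> 1}"
  have Qmem: "(g b - g a) / (b - a) \<in> Q" if "0 \<le> a" "a < b" "b \<le> 1" for a b
    unfolding Q_def using that by blast
  have Qne: "Q \<noteq> {}" using Qmem[of 0 1] by auto
  have Qlow: "c \<le> q" if "q \<in> Q" for q using that slope unfolding Q_def by (auto simp: field_simps)
  \<comment> \<open>An infimum over intervals of all lengths, so \<open>K\<close> is fixed before
    the scale \<open>d\<close>; the application chooses \<open>d\<close> in terms of
    \<open>K\<close>.\<close>
  define K where "K = Inf Q"
  have Kc: "K \<ge> c" unfolding K_def by (rule cInf_greatest[OF Qne Qlow])
  have Kpos: "K > 0" using Kc c by linarith
  have Kslope: "K * (b - a) \<le> g b - g a" if "0 \<le> a" "a \<le> b" "b \<le> 1" for a b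
  proof (cases "a = b")
    case False
    have "K \<le> (g b - g a) / (b - a)" unfolding K_def
      by (intro cInf_lower Qmem bdd_belowI[of _ c] Qlow) (use that False in auto)
    then show ?thesis using that False by (simp add: field_simps)
  qed simp
  have "Inf Q < (1 + \<eta>) * K" using Kpos \<eta> unfolding K_def[symmetric] by (simp add: algebra_simps)
  then obtain a0 b0 where ab0: "0 \<le> a0" "a0 < b0" "b0 \<le> 1" "(g b0 - g a0) / (b0 - a0) < (1 + \<eta>) * K"
    using cInf_lessD[OF Qne] unfolding Q_def by blast
  \<comment> \<open>One of the two halves of an interval has a difference quotient no larger than
    that of the whole, so near-minimality survives at arbitrarily small scales.\<close>
  have bisect: "\<exists>a b. 0 \<le> a \<and> b \<le> 1 \<and> b - a = (b0 - a0) / 2^k \<and> g b - g a \<le> (1 + \<eta>) * K * (b - a)" for k :: nat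
  proof (induction k)
    case 0 then show ?case using ab0 by (intro exI[of _ a0] exI[of _ b0]) (simp add: field_simps)
  next
    case (Suc k)
    then obtain a b where ab: "0 \<le> a" "b \<le> 1" "b - a = (b0 - a0) / 2^k" "g b - g a \<le> (1 + \<eta>) * K * (b - a)" by blast
    define m where "m = (a + b) / 2"
    have "(b0 - a0) / 2^k > 0" using ab0 by simp
    then have "a < b" using ab(3) by linarith
    then have m: "0 \<le> m" "m \<le> 1" "m - a = (b0 - a0) / 2^Suc k" "b - m = (b0 - a0) / 2^Suc k"
      using ab by (auto simp: m_def field_simps)
    have "(1 + \<eta>) * K * (b - a) = (1 + \<eta>) * K * (m - a) + (1 + \<eta>) * K * (b - m)" by (simp add: algebra_simps)
    then have "g m - g a \<le> (1 + \<eta>) * K * (m - a) \<or> g b - g m \<le> (1 + \<eta>) * K * (b - m)" using ab(4) by linarith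
    then show ?case using ab m by blast
  qed
  show ?thesis
  proof (rule that[OF Kpos])
    fix d :: real assume d: "d > 0"
    obtain k :: nat where k: "1 / d < 2 ^ k" using real_arch_pow[of 2 "1/d"] by auto
    obtain a b where ab: "0 \<le> a" "b \<le> 1" "b - a = (b0 - a0) / 2^k" "g b - g a \<le> (1 + \<eta>) * K * (b - a)"
      using bisect by blast
    have ba: "b - a > 0" using ab0 unfolding ab(3) by simp
    have "b - a \<le> 1 / 2^k" unfolding ab(3) using ab0 by (intro divide_right_mono) auto
    also have "\<dots> < d" using k d by (simp add: field_simps)
    finally have bd: "b - a < d" .
    define u \<delta> where "u = (a + b) / 2" and "\<delta> = (b - a) / 2"
    have u: "u - \<delta> = a" "u + \<delta> = b" by (simp_all add: u_def \<delta>_def field_simps)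
    have "\<bar>g v - g u - K * (v - u)\<bar> \<le> 2 * \<eta> * K * \<delta>" if v: "\<bar>v - u\<bar> \<le> \<delta>" for v
    proof -
      have "v - u \<le> \<delta>" "u - v \<le> \<delta>" using v by linarith+
      moreover have "\<delta> > 0" using ba by (simp add: \<delta>_def)
      ultimately have v': "a \<le> v" "v \<le> b" "a \<le> u" "u \<le> b" using u by linarith+
      \<comment> \<open>Every piece of \<open>[a, b]\<close> has increment at least \<open>K\<close>
        times its length, and the excesses of the pieces cut out by \<open>u\<close> and
        \<open>v\<close> add up to at most \<open>2 * \<eta> * K * \<delta>\<close>. The piece
        between \<open>u\<close> and \<open>v\<close> therefore obeys the same bound.\<close>
      have "K * (v - a) \<le> g v - g a" "K * (b - v) \<le> g b - g v" "K * (u - a) \<le> g u - g a" "K * (b - u) \<le> g b - g u"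
        by (rule Kslope; use v' ab in linarith)+
      moreover have "g b - g a \<le> K * (b - a) + 2 * \<eta> * K * \<delta>" 
      proof -
        have "(1 + \<eta>) * K * (b - a) = K * (b - a) + 2 * \<eta> * K * \<delta>" by (simp add: \<delta>_def field_simps)
        then show ?thesis using ab(4) by linarith
      qed
      ultimately show ?thesis by (simp add: abs_le_iff algebra_simps)
    qed
    moreover have "0 < \<delta>" "\<delta> \<le> d" using ba bd by (auto simp: \<delta>_def)
    ultimately show "\<exists>u \<delta>. 0 < \<delta> \<and> \<delta> \<le> d \<and> 0 \<le> u - \<delta> \<and> u + \<delta> \<le> 1 \<and>
       (\<forall>v. \<bar>v - u\<bar> \<le> \<delta> \<longrightarrow> \<bar>g v - g u - K * (v - u)\<bar> \<le> 2 * \<eta> * K * \<delta>)"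
      using u ab by (intro exI[of _ u] exI[of _ \<delta>]) auto
  qed
qed

text \<open>The second frame vector is tangent to the unit circle at the first one, so that the linear term of the
  expansion disappears.\<close>
lemma quadratic_window:
  assumes n: "is_norm n" and C1: "C1_norm n" and sc: "strongly_convex_norm n"
  obtains f g L K R e where "det2 f g = 1" "L > 0" "K > 0" "0 < R" "R \<le> 1/10000000" "0 \<le> e" "e \<le> K * R\<^sup>2 / 1000000"
    "K * R \<le> L / 1000" "\<And>u. \<bar>u\<bar> \<le> 40 * R \<Longrightarrow> \<bar>n (lin2 f g (1, u)) - (L + K / 2 * u\<^sup>2)\<bar> \<le> e"
proof -
  obtain D :: "R2 \<Rightarrow> R2 \<Rightarrow> real" where D: "\<And>v w. v \<noteq> 0 \<Longrightarrow> D v w \<le> n w" "\<And>v. v \<noteq> 0 \<Longrightarrow> D v v = n v"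
    "\<And>v. v \<noteq> 0 \<Longrightarrow> linear (D v)" "\<And>v. v \<noteq> 0 \<Longrightarrow> (n has_derivative D v) (at v)"
    using C1_norm_support[OF n C1] by blast
  obtain c where c: "c > 0" "\<And>a b. \<lbrakk>0 \<le> a; a < b; b \<le> 1\<rbrakk> \<Longrightarrow> c * (b - a) \<le> D (1,b) (0,1) - D (1,a) (0,1)"
    using strongly_convex_slope[OF n sc D(1,2,3)] by blast
  define g where "g u = D (1,u) (0,1)" for u
  \<comment> \<open>The final error is \<open>4 * \<eta> * K * \<delta>^2\<close> with
    \<open>\<delta> = 80 * R\<close>, that is \<open>25600 * \<eta> * K * R^2\<close>; this
    \<open>\<eta>\<close> puts it below \<open>K * R^2 / 10^6\<close>.\<close>
  define \<eta> :: real where "\<eta> = 1 / 10^11"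
  have \<eta>: "\<eta> > 0" by (simp add: \<eta>_def)
  have slope: "c * (b - a) \<le> g b - g a" if "0 \<le> a" "a < b" "b \<le> 1" for a b using c(2)[OF that] by (simp add: g_def)
  obtain K where K: "K > 0" and win: "\<And>d. d > 0 \<Longrightarrow> \<exists>u \<delta>. 0 < \<delta> \<and> \<delta> \<le> d \<and> 0 \<le> u - \<delta> \<and> u + \<delta> \<le> 1 \<and>
     (\<forall>v. \<bar>v - u\<bar> \<le> \<delta> \<longrightarrow> \<bar>g v - g u - K * (v - u)\<bar> \<le> 2 * \<eta> * K * \<delta>)"
    using almost_affine_window[OF c(1) slope \<eta>] by blast
  obtain m where m: "m > 0" "\<And>v. m * norm v \<le> n v" using is_norm_lower_bound[OF n] by blast
  define C where "C = n (0,1) / m"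
  have C0: "C \<ge> 0" using m is_normD(1)[OF n] by (simp add: C_def)
  have nz: "(1, u) \<noteq> (0::R2)" for u by (simp add: zero_prod_def)
  have l_low: "m \<le> n (1, u)" for u
  proof -
    have "m * 1 \<le> m * norm (1::real, u)" using norm_fst_le[of "1::real" u] m(1) by (intro mult_left_mono) auto
    then show ?thesis using m(2)[of "(1,u)"] by linarith
  qed
  have gbound: "\<bar>g u\<bar> \<le> n (0,1)" for u
  proof -
    interpret lin: linear "D (1,u)" by (rule D(3)[OF nz])
    have "D (1,u) (- (0,1)) \<le> n (- (0,1))" by (rule D(1)[OF nz])
    moreover have "n (- (0,1)) = n (0,1)" using is_normD(3)[OF n, of "-1" "(0,1)"] by simp
    ultimately show ?thesis using D(1)[OF nz, of u "(0,1)"] lin.neg[of "(0,1)"] by (simp add: g_def abs_le_iff)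
  qed
  have der: "((\<lambda>u. n (1,u)) has_real_derivative g u) (at u)" for u
  proof -
    interpret lin: linear "D (1,u)" by (rule D(3)[OF nz])
    have 1: "((\<lambda>u. (1::real, u)) has_derivative (\<lambda>h. (0, h))) (at u)" by (auto intro!: derivative_eq_intros)
    have "D (1,u) (0,h) = h * g u" for h using lin.scale[of h "(0,1)"] by (simp add: g_def)
    then show ?thesis using has_derivative_compose[OF 1 D(4)[OF nz]]
      by (simp add: has_field_derivative_def mult_commute_abs)
  qed
  \<comment> \<open>The three bounds give, in this order, \<open>R \<le> 1/10000000\<close>,
    \<open>K * R \<le> L / 1000\<close>, and a factor \<open>1 + w\<close> close to 1 in the change
    of frame below.\<close>
  define d where "d = min (1/1000000) (min (8 * m / (100 * K)) (\<eta> / (C + 1)))"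
  have "d > 0" using K m C0 \<eta> by (simp add: d_def)
  from win[OF this] obtain u0 \<delta> where \<delta>: "0 < \<delta>" "\<delta> \<le> d"
    and aff: "\<And>v. \<bar>v - u0\<bar> \<le> \<delta> \<Longrightarrow> \<bar>g v - g u0 - K * (v - u0)\<bar> \<le> 2 * \<eta> * K * \<delta>" by blast
  define L where "L = n (1, u0)"
  have L: "L \<ge> m" "L > 0" using l_low[of u0] m(1) by (auto simp: L_def)
  have exp: "\<bar>n (1,v) - (L + g u0 * (v - u0) + K / 2 * (v - u0)\<^sup>2)\<bar> \<le> 2 * \<eta> * K * \<delta>\<^sup>2" if v: "\<bar>v - u0\<bar> \<le> \<delta>" for v
  proof -
    define F where "F v = n (1,v) - g u0 * (v - u0) - K / 2 * (v - u0)\<^sup>2" for v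
    have "norm (F v - F u0) \<le> 2 * \<eta> * K * \<delta> * norm (v - u0)"
    proof (rule field_differentiable_bound[of "cball u0 \<delta>" F "\<lambda>v. g v - g u0 - K * (v - u0)"])
      fix z assume z: "z \<in> cball u0 \<delta>"
      show "(F has_field_derivative g z - g u0 - K * (z - u0)) (at z within cball u0 \<delta>)"
        unfolding F_def by (rule derivative_eq_intros has_field_derivative_at_within[OF der] refl | simp)+
      show "norm (g z - g u0 - K * (z - u0)) \<le> 2 * \<eta> * K * \<delta>"
        using aff[of z] z by (simp add: dist_real_def abs_minus_commute)
    qed (use v \<delta> in \<open>auto simp: dist_real_def abs_minus_commute\<close>)
    also have "\<dots> \<le> 2 * \<eta> * K * \<delta> * \<delta>" using v \<eta> K \<delta> by (intro mult_left_mono) auto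
    finally show ?thesis by (simp add: F_def L_def power2_eq_square algebra_simps)
  qed
  \<comment> \<open>The second frame vector is \<open>cc\<close> times the first plus
    \<open>(0, 1)\<close>. The derivative of the norm at the first vector is \<open>L\<close> on
    that vector and \<open>g u0\<close> on \<open>(0, 1)\<close>, so this \<open>cc\<close> makes it
    vanish on the second.\<close>
  define cc where "cc = - g u0 / L"
  have cc: "cc * L = - g u0" "\<bar>cc\<bar> \<le> C"
  proof -
    show "cc * L = - g u0" using L by (simp add: cc_def)
    have "\<bar>g u0\<bar> / L \<le> n (0,1) / m" using gbound[of u0] L m by (intro frac_le) auto
    then show "\<bar>cc\<bar> \<le> C" using L by (simp add: cc_def C_def abs_divide)
  qed
  \<comment> \<open>Thus \<open>40 * R\<close> is half the window: the parameter \<open>s\<close>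
    below may be twice as large as \<open>u\<close> and must not leave the window.\<close>
  define R where "R = \<delta> / 80"
  define e where "e = 4 * \<eta> * K * \<delta>\<^sup>2"
  define f1 f2 where "f1 = (1::real, u0)" and "f2 = (cc, 1 + cc * u0)"
  have det: "det2 f1 f2 = 1" by (simp add: det2_def f1_def f2_def algebra_simps)
  have Rb: "0 < R" "R \<le> 1/10000000" using \<delta> by (auto simp: R_def d_def)
  have eb: "0 \<le> e" using \<eta> K by (simp add: e_def)
  have "e = K * R\<^sup>2 * (25600 * \<eta>)" by (simp add: e_def R_def power_divide)
  also have "\<dots> \<le> K * R\<^sup>2 * (1 / 1000000)" using K by (intro mult_left_mono) (auto simp: \<eta>_def)
  finally have eb2: "e \<le> K * R\<^sup>2 / 1000000" by simp
  have "K * \<delta> \<le> K * (8 * m / (100 * K))" using \<delta> K by (intro mult_left_mono) (auto simp: d_def)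
  then have KR: "K * R \<le> L / 1000" using L K by (simp add: R_def)
  have quad: "\<bar>n (lin2 f1 f2 (1, u)) - (L + K / 2 * u\<^sup>2)\<bar> \<le> e" if u: "\<bar>u\<bar> \<le> 40 * R" for u
  proof -
    have u2: "\<bar>u\<bar> \<le> \<delta> / 2" using u by (simp add: R_def)
    have "\<delta> * (C + 1) \<le> \<eta>" using \<delta> C0 by (simp add: d_def field_simps)
    then have dC: "\<delta> * C \<le> \<eta>" using \<delta> by (simp add: algebra_simps)
    \<comment> \<open>Homogeneity reduces the new frame to the old line: the vector with coordinates
      \<open>(1, u)\<close> is \<open>1 + w\<close> times \<open>(1, u0 + s)\<close>. The factor
      \<open>1 + w\<close> cancels the linear term and alters the quadratic one only by a relative
      error of size \<open>\<eta>\<close>.\<close>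
    define w where "w = cc * u"
    have "\<bar>w\<bar> \<le> C * (\<delta> / 2)" unfolding w_def abs_mult using cc(2) u2 C0 by (intro mult_mono) auto
    then have w: "\<bar>w\<bar> \<le> \<eta> / 2" using dC by (simp add: algebra_simps)
    have w2: "1 + w \<ge> 1/2" "1 + w \<le> 3/2" using w by (auto simp: \<eta>_def abs_le_iff)
    define s where "s = u / (1 + w)"
    have su: "(1 + w) * s = u" using w2 by (simp add: s_def)
    have "\<bar>s\<bar> = \<bar>u\<bar> / (1 + w)" using w2 by (simp add: s_def abs_divide)
    also have "\<dots> \<le> \<bar>u\<bar> / (1/2)" using w2 by (intro divide_left_mono) auto
    finally have sb: "\<bar>s\<bar> \<le> \<delta>" using u2 by simp
    have "lin2 f1 f2 (1, u) = (1 + w) *\<^sub>R (1, u0 + s)"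
      using su by (simp add: lin2_def f1_def f2_def w_def algebra_simps)
    then have "n (lin2 f1 f2 (1, u)) = (1 + w) * n (1, u0 + s)"
      using w2 by (simp only: is_normD(3)[OF n])
    moreover have "\<bar>n (1, u0 + s) - (L + g u0 * s + K / 2 * s\<^sup>2)\<bar> \<le> 2 * \<eta> * K * \<delta>\<^sup>2" using exp[of "u0 + s"] sb by simp
    ultimately have 1: "\<bar>n (lin2 f1 f2 (1, u)) - (1 + w) * (L + g u0 * s + K / 2 * s\<^sup>2)\<bar> \<le> 3/2 * (2 * \<eta> * K * \<delta>\<^sup>2)"
      using w2 abs_mult[of "1 + w" "n (1, u0 + s) - (L + g u0 * s + K / 2 * s\<^sup>2)"] mult_mono[of "1 + w" "3/2" "\<bar>n (1, u0 + s) - (L + g u0 * s + K / 2 * s\<^sup>2)\<bar>" "2 * \<eta> * K * \<delta>\<^sup>2"]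
      by (simp add: right_diff_distrib)
    have "(1 + w) * (L + g u0 * s + K / 2 * s\<^sup>2) = L + w * L + g u0 * ((1 + w) * s) + K / 2 * s * ((1 + w) * s)"
      by (simp add: algebra_simps power2_eq_square)
    also have "w * L = - g u0 * u"
    proof -
      have "w * L = (cc * L) * u" by (simp add: w_def)
      then show ?thesis unfolding cc(1) .
    qed
    also have "L + (- g u0 * u) + g u0 * ((1 + w) * s) + K / 2 * s * ((1 + w) * s) = L + K / 2 * (s * u)" unfolding su by simp
    finally have 2: "(1 + w) * (L + g u0 * s + K / 2 * s\<^sup>2) = L + K / 2 * (s * u)" .
    have "u\<^sup>2 - s * u = w * (s * u)" unfolding power2_eq_square using su by (metis add_diff_cancel_left' distrib_right mult.assoc mult_1 )
    moreover have "\<bar>w * (s * u)\<bar> \<le> \<eta> / 2 * (\<delta> * (\<delta> / 2))"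
      unfolding abs_mult using w sb u2 \<delta> \<eta> by (intro mult_mono) auto
    ultimately have "K / 2 * \<bar>u\<^sup>2 - s * u\<bar> \<le> K / 2 * (\<eta> / 2 * (\<delta> * (\<delta> / 2)))" using K by (intro mult_left_mono) auto
    moreover have "\<bar>K / 2 * (s * u) - K / 2 * u\<^sup>2\<bar> = K / 2 * \<bar>u\<^sup>2 - s * u\<bar>"
    proof -
      have "K / 2 * (s * u) - K / 2 * u\<^sup>2 = - (K / 2 * (u\<^sup>2 - s * u))" by (simp add: right_diff_distrib)
      then show ?thesis using K by (simp add: abs_mult)
    qed
    moreover have "K / 2 * (\<eta> / 2 * (\<delta> * (\<delta> / 2))) = \<eta> * K * \<delta>\<^sup>2 / 8" by (simp add: power2_eq_square)
    ultimately have 3: "\<bar>K / 2 * (s * u) - K / 2 * u\<^sup>2\<bar> \<le> \<eta> * K * \<delta>\<^sup>2 / 8" by linarith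
    have "\<eta> * K * \<delta>\<^sup>2 \<ge> 0" using \<eta> K by simp
    then show ?thesis using 1 3 unfolding 2 e_def by linarith
  qed
  show ?thesis using that[OF det L(2) K Rb eb eb2 KR quad] .
qed

section \<open>Distortion coefficients and volumes\<close>

text \<open>With \<open>h = \<theta> * sqrt (\<bar>K\<bar> / N)\<close>, the half-angle formulas
  turn the quotients into \<open>1 / (2 * cos (h/2))\<close> and
  \<open>1 / (2 * cosh (h/2))\<close>. The first is at least 1/2, the second tends to 1/2 with
  \<open>\<theta>\<close>. Keeping \<open>h \<le> 1 < pi\<close> avoids the infinite value.\<close>

lemma sigma_KN_half_lower:
  fixes K N \<kappa> :: real
  assumes N: "N > 0" and \<kappa>: "0 < \<kappa>" "\<kappa> < 1"
  obtains \<theta>0 where "\<theta>0 > 0" "\<And>\<theta>. \<lbrakk>0 \<le> \<theta>; \<theta> \<le> \<theta>0\<rbrakk> \<Longrightarrow> \<exists>s. sigma_KN K N (1/2) \<theta> = ereal s \<and> \<kappa> / 2 \<le> s"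
proof -
  have c0: "isCont (\<lambda>h::real. cosh (h/2)) 0" by (intro continuous_intros) simp
  have k0: "1 / \<kappa> - 1 > 0" using \<kappa> by simp
  have "\<exists>h0>0. \<forall>h::real. dist h 0 < h0 \<longrightarrow> dist (cosh (h/2)) (cosh (0/2)) < 1 / \<kappa> - 1"
    using c0[unfolded continuous_at_eps_delta, THEN spec, THEN mp, OF k0] .
  then obtain h0 where h0_pos: "h0 > 0" and h0_dist: "\<forall>h::real. dist h 0 < h0 \<longrightarrow> dist (cosh (h/2)) (cosh (0/2)) < 1 / \<kappa> - 1"
    by blast
  have h0: "\<bar>cosh (h/2) - 1\<bar> < 1 / \<kappa> - 1" if "\<bar>h\<bar> < h0" for h :: real
    using h0_dist[rule_format, of h] that by (simp add: dist_real_def)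
  define q where "q = sqrt (\<bar>K\<bar> / N)"
  have q: "q \<ge> 0" "q\<^sup>2 = \<bar>K\<bar> / N" using N by (simp_all add: q_def)
  define \<theta>0 where "\<theta>0 = min 1 (h0/2) / (q + 1)"
  have t0: "\<theta>0 > 0" using h0_pos q by (simp add: \<theta>0_def)
  show ?thesis
  proof (rule that[OF t0])
    fix \<theta> :: real assume \<theta>: "0 \<le> \<theta>" "\<theta> \<le> \<theta>0"
    define h where "h = \<theta> * q"
    have hm: "h \<le> min 1 (h0/2)"
    proof -
      have "h \<le> \<theta>0 * (q + 1)" unfolding h_def using \<theta> q by (intro mult_mono) auto
      also have "\<dots> = min 1 (h0/2)" using q by (simp add: \<theta>0_def)
      finally show ?thesis .
    qed
    then have h: "0 \<le> h" "h \<le> 1" "h < h0" using \<theta> q h0_pos by (auto simp: h_def)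
    have "\<bar>K\<bar> * \<theta>\<^sup>2 = N * h\<^sup>2" using N by (simp add: h_def power_mult_distrib q(2))
    moreover have "h\<^sup>2 \<le> 1" using h by (simp add: power_le_one)
    moreover have "pi\<^sup>2 > 1" using pi_gt3 by (simp add: one_less_power)
    ultimately have "\<bar>K\<bar> * \<theta>\<^sup>2 < N * pi\<^sup>2" using N by simp
    moreover have "K * \<theta>\<^sup>2 \<le> \<bar>K\<bar> * \<theta>\<^sup>2" by (intro mult_right_mono) auto
    ultimately have c1: "\<not> N * pi\<^sup>2 \<le> K * \<theta>\<^sup>2" by linarith
    show "\<exists>s. sigma_KN K N (1/2) \<theta> = ereal s \<and> \<kappa> / 2 \<le> s"
    proof (cases "K * \<theta>\<^sup>2 = 0")
      case True
      then have "sigma_KN K N (1/2) \<theta> = ereal (1/2)" using c1 unfolding sigma_KN_def by simp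
      then show ?thesis using \<kappa> by (intro exI[of _ "1/2"]) simp
    next
      case False
      then have nz: "K \<noteq> 0" "\<theta> > 0" using \<theta> by auto
      then have hpos: "h > 0" using N by (simp add: h_def q_def)
      show ?thesis
      proof (cases "K > 0")
        case True
        then have hq: "\<theta> * sqrt (K / N) = h" by (simp add: h_def q_def)
        have e: "sigma_KN K N (1/2) \<theta> = ereal (sin (h/2) / sin h)"
          using c1 False True by (simp add: sigma_KN_def hq[symmetric])
        have s: "sin h = 2 * sin (h/2) * cos (h/2)" using sin_double[of "h/2"] by simp
        have sp: "sin (h/2) > 0" using hpos h pi_gt3 by (intro sin_gt_zero) auto
        have cp: "cos (h/2) > 0" using hpos h pi_gt3 by (intro cos_gt_zero) auto
        have "sin (h/2) / sin h = 1 / (2 * cos (h/2))" unfolding s using sp by simp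
        also have "\<dots> \<ge> 1 / 2" using cp by (simp add: divide_simps)
        finally show ?thesis using e \<kappa> by (intro exI[of _ "sin (h/2) / sin h"]) simp
      next
        case False2: False
        then have hq: "\<theta> * sqrt (- K / N) = h" using nz by (simp add: h_def q_def)
        have e: "sigma_KN K N (1/2) \<theta> = ereal (sinh (h/2) / sinh h)"
          using c1 False False2 by (simp add: sigma_KN_def hq[symmetric])
        have s: "sinh h = 2 * sinh (h/2) * cosh (h/2)" using sinh_double[of "h/2"] by simp
        have "\<bar>cosh (h/2) - 1\<bar> < 1 / \<kappa> - 1" using h0[of h] h by simp
        then have "cosh (h/2) < 1 / \<kappa>" by linarith
        then have ch: "\<kappa> * cosh (h/2) \<le> 1" using \<kappa> by (simp add: field_simps)
        have "sinh (h/2) / sinh h = 1 / (2 * cosh (h/2))" unfolding s using hpos by simp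
        also have "\<dots> \<ge> \<kappa> / 2" using ch cosh_real_pos[of "h/2"] by (simp add: field_simps)
        finally show ?thesis using e by blast
      qed
    qed
  qed
qed

text \<open>The two powers of 1/2 multiply to 1/2 for every \<open>N\<close>, and
  \<open>\<kappa>\<close> enters with exponent \<open>1 - 1 / N\<close>, which only increases a
  number below 1.\<close>

lemma tau_KN_half_lower:
  fixes K N \<kappa> :: real
  assumes N: "N > 1" and \<kappa>: "0 < \<kappa>" "\<kappa> < 1"
  obtains \<theta>0 where "\<theta>0 > 0" "\<And>\<theta>. \<lbrakk>0 \<le> \<theta>; \<theta> \<le> \<theta>0\<rbrakk> \<Longrightarrow> \<exists>s. tau_KN K N (1/2) \<theta> = ereal s \<and> \<kappa> / 2 \<le> s"
proof -
  obtain \<theta>0 where \<theta>0: "\<theta>0 > 0" "\<And>\<theta>. \<lbrakk>0 \<le> \<theta>; \<theta> \<le> \<theta>0\<rbrakk> \<Longrightarrow> \<exists>s. sigma_KN K (N - 1) (1/2) \<theta> = ereal s \<and> \<kappa> / 2 \<le> s"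
    using sigma_KN_half_lower[of "N - 1" \<kappa> K] N \<kappa> by auto
  show ?thesis
  proof (rule that[OF \<theta>0(1)])
    fix \<theta> assume "0 \<le> \<theta>" "\<theta> \<le> \<theta>0"
    then obtain s where s: "sigma_KN K (N - 1) (1/2) \<theta> = ereal s" "\<kappa> / 2 \<le> s" using \<theta>0(2) by blast
    let ?a = "1 - 1 / N"
    have a: "0 \<le> ?a" "?a \<le> 1" using N by auto
    have "\<kappa> = \<kappa> powr 1" using \<kappa> by simp
    also have "\<dots> \<le> \<kappa> powr ?a" using \<kappa> a by (intro powr_mono') auto
    finally have k: "\<kappa> \<le> \<kappa> powr ?a" .
    have "(1/2) powr (1/N) * (1/2) powr ?a = (1/2::real)" by (simp add: powr_add[symmetric])
    then have "\<kappa> powr ?a / 2 = (1/2) powr (1/N) * (1/2) powr ?a * \<kappa> powr ?a" by simp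
    also have "\<dots> = (1/2) powr (1/N) * (\<kappa> / 2) powr ?a"
      using \<kappa> powr_mult[of "1/2" \<kappa> ?a] by (simp add: mult.assoc)
    also have "\<dots> \<le> (1/2) powr (1/N) * s powr ?a"
      using s(2) \<kappa> a by (intro mult_left_mono powr_mono2) auto
    finally have "\<kappa> / 2 \<le> (1/2) powr (1/N) * s powr ?a" using k by linarith
    then show "\<exists>s. tau_KN K N (1/2) \<theta> = ereal s \<and> \<kappa> / 2 \<le> s"
      using s(1) by (auto simp: tau_KN_def)
  qed
qed

lemma meas_root_le:
  assumes "x \<le> ennreal r" "r \<ge> 0" "N > 0"
  shows "meas_root N x \<le> ereal (r powr (1 / N))"
proof -
  have "x < \<infinity>" using assms(1) by (simp add: order_le_less_trans)
  moreover have "enn2real x \<le> r" using assms by (simp add: enn2real_leI)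
  ultimately show ?thesis using assms by (auto simp: meas_root_def intro!: powr_mono2)
qed

lemma meas_root_ge:
  assumes "ennreal r \<le> x" "r \<ge> 0" "N > 0"
  shows "ereal (r powr (1 / N)) \<le> meas_root N x"
proof (cases "x = \<infinity>")
  case False
  then have "r \<le> enn2real x" using assms enn2real_mono[of "ennreal r" x] by (simp add: less_top)
  then show ?thesis using assms False by (auto simp: meas_root_def intro!: powr_mono2)
qed (simp add: meas_root_def)

text \<open>Both coefficients are at least \<open>\<kappa> / 2\<close> and both sets have measure at
  least \<open>a\<close>, so the inequality forces the root of the midpoint measure up to
  \<open>\<kappa> * a powr (1 / N)\<close>, above \<open>(3/4 * a) powr (1 / N)\<close>. As all
  distances lie in \<open>[0, \<theta>0]\<close>, so does \<open>Theta\<close>, whether it is an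
  infimum or a supremum.\<close>

lemma BM_half_fails:
  assumes BM: "BM d M K N" and N: "N > 1" and sets: "A \<in> sets borel" "B \<in> sets borel" "A \<noteq> {}" "B \<noteq> {}" "A \<subseteq> spt d M" "B \<subseteq> spt d M"
    and \<theta>: "\<And>p q. \<lbrakk>p \<in> A; q \<in> B\<rbrakk> \<Longrightarrow> 0 \<le> d p q \<and> d p q \<le> \<theta>0"
    and tau: "\<And>\<theta>. \<lbrakk>0 \<le> \<theta>; \<theta> \<le> \<theta>0\<rbrakk> \<Longrightarrow> \<exists>s. tau_KN K N (1/2) \<theta> = ereal s \<and> \<kappa> / 2 \<le> s"
    and \<kappa>: "(3/4) powr (1/N) < \<kappa>" and a: "a > 0" "ennreal a \<le> emeasure M A" "ennreal a \<le> emeasure M B"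
    and mid: "outer_meas M (Mt d (1/2) A B) \<le> ennreal (3/4 * a)"
  shows False
proof -
  obtain p0 q0 where pq: "p0 \<in> A" "q0 \<in> B" using sets by blast
  have "0 \<le> Theta d K A B \<and> Theta d K A B \<le> ereal \<theta>0"
  proof (cases "K \<ge> 0")
    case True
    have "0 \<le> (INF p \<in> A \<times> B. ereal (d (fst p) (snd p)))" using \<theta> by (intro INF_greatest) auto
    moreover have "(INF p \<in> A \<times> B. ereal (d (fst p) (snd p))) \<le> ereal \<theta>0"
      using \<theta>[OF pq] pq by (intro INF_lower2[of "(p0,q0)"]) auto
    ultimately show ?thesis using True by (simp add: Theta_def)
  next
    case False
    have "0 \<le> (SUP p \<in> A \<times> B. ereal (d (fst p) (snd p)))"
      using \<theta>[OF pq] pq by (intro SUP_upper2[of "(p0,q0)"]) auto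
    moreover have "(SUP p \<in> A \<times> B. ereal (d (fst p) (snd p))) \<le> ereal \<theta>0" using \<theta> by (intro SUP_least) auto
    ultimately show ?thesis using False by (simp add: Theta_def)
  qed
  then obtain \<theta> where t: "Theta d K A B = ereal \<theta>" "0 \<le> \<theta>" "\<theta> \<le> \<theta>0"
    by (cases "Theta d K A B") auto
  obtain s where s: "tau_KN K N (1/2) \<theta> = ereal s" "\<kappa> / 2 \<le> s" using tau[OF t(2,3)] by blast
  have k0: "\<kappa> > 0" using \<kappa> powr_ge_zero[of "3/4" "1/N"] by linarith
  define y where "y = a powr (1/N)"
  have y: "y > 0" using a by (simp add: y_def)
  have r: "ereal y \<le> meas_root N (emeasure M A)" "ereal y \<le> meas_root N (emeasure M B)"
    unfolding y_def using a N by (auto intro!: meas_root_ge)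
  have "ereal (s * y + s * y) = ereal s * ereal y + ereal s * ereal y" by simp
  also have "\<dots> \<le> ereal s * meas_root N (emeasure M A) + ereal s * meas_root N (emeasure M B)"
    using s(2) k0 r by (intro add_mono ereal_mult_left_mono) auto
  also have "\<dots> \<le> meas_root N (outer_meas M (Mt d (1/2) A B))"
    using BM[unfolded BM_def, rule_format, of A B "1/2"] sets t s(1) by simp
  also have "\<dots> \<le> ereal ((3/4 * a) powr (1/N))" using mid a N by (intro meas_root_le) auto
  also have "(3/4 * a) powr (1/N) = (3/4) powr (1/N) * y" using a powr_mult[of "3/4" a "1/N"] by (simp add: y_def)
  finally have "s * y + s * y \<le> (3/4) powr (1/N) * y" by (simp only: ereal_less_eq)
  also have "\<dots> < \<kappa> * y" using \<kappa> y by simp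
  finally have "s + s < \<kappa>" using y by (simp add: distrib_right[symmetric])
  then show False using s(2) by linarith
qed

section \<open>Boxes, volumes and the support of the measure\<close>

lemma mem_cbox_triple:
  "(x, y, z) \<in> cbox (a1, a2, a3) (b1, b2, b3) \<longleftrightarrow> a1 \<le> x \<and> x \<le> b1 \<and> a2 \<le> y \<and> y \<le> b2 \<and> a3 \<le> z \<and> z \<le> (b3::real)"
  for x y z a1 a2 a3 b1 b2 b3 :: real
  by (auto simp: cbox_Pair_eq)

text \<open>The half sides of \<open>boxM\<close> are the bounds of \<open>xm_bound\<close>,
  \<open>ym_bound\<close> and \<open>zm_bound\<close>.\<close>

abbreviation "boxA R \<equiv> cbox (-1 - R, - R, - (R/10)) (-1 + R, R, R/10::real)"
abbreviation "boxB R \<equiv> cbox (1 - R, - R, - (R/10)) (1 + R, R, R/10::real)"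
abbreviation "boxM R \<equiv> cbox (- (11/10 * R), - (44/100 * R), - (11/100 * R)) (11/10 * R, 44/100 * R, 11/100 * R::real)"

text \<open>\<open>boxM\<close> is \<open>11/10\<close> times a box of which two disjoint translates fit into \<open>boxA\<close>; this compares the volumes of
  the linear images without determinants.\<close>
lemma box_image_measure:
  fixes T :: "R3 \<Rightarrow> R3"
  assumes T: "bounded_linear T" and T': "bounded_linear T'" and inv: "\<And>p. T (T' p) = p" "\<And>p. T' (T p) = p" and R: "R > 0"
  shows "measure lborel (T ` boxB R) = measure lborel (T ` boxA R)" "measure lborel (T ` boxA R) > 0"
    "measure lborel (T ` boxM R) \<le> 1331/2000 * measure lborel (T ` boxA R)"
proof -
  interpret T: bounded_linear T by (rule T)
  have comp: "compact (T ` cbox a b)" for a b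
    by (intro compact_continuous_image compact_cbox linear_continuous_on T)
  have lm: "T ` cbox a b \<in> lmeasurable" for a b by (rule lmeasurable_compact[OF comp])
  have leb: "measure lborel (T ` cbox a b) = measure lebesgue (T ` cbox a b)" for a b
    by (rule measure_completion[symmetric]) (simp add: borel_compact comp)
  have tr: "measure lebesgue (T ` cbox (c + a) (c + b)) = measure lebesgue (T ` cbox a b)" for a b c
  proof -
    have "T ` cbox (c + a) (c + b) = (+) (T c) ` (T ` cbox a b)"
      unfolding cbox_translation image_image by (simp add: T.add)
    then show ?thesis by (simp add: measure_translation)
  qed
  have inj: "inj T" by (rule inj_on_inverseI[of _ T']) (rule inv)
  show "measure lborel (T ` boxB R) = measure lborel (T ` boxA R)"
    unfolding leb using tr[of "(2,0,0)" "(-1 - R, - R, - (R/10))" "(-1 + R, R, R/10)"] by simp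
  have "\<not> negligible (T ` boxA R)"
  proof
    assume neg: "negligible (T ` boxA R)"
    let ?U = "box (-1 - R, - R, - (R/10)) (-1 + R, R, R/10::real)"
    have "T ` U = T' -` U" for U 
    proof
      show "T' -` U \<subseteq> T ` U"
      proof
        fix y assume "y \<in> T' -` U"
        then have "T' y \<in> U" "y = T (T' y)" using inv(1) by simp_all
        then show "y \<in> T ` U" by blast
      qed
    qed (auto simp: inv)
    then have "open (T ` ?U)"
      using open_vimage[OF open_box linear_continuous_on[OF T']] by metis
    moreover have "(-1, 0, 0) \<in> ?U" using R by (simp add: mem_box Basis_prod_def)
    then have "T ` ?U \<noteq> {}" by blast
    moreover have "negligible (T ` ?U)" using neg by (rule negligible_subset) (intro image_mono box_subset_cbox)
    ultimately show False using open_not_negligible by blast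
  qed
  then show "measure lborel (T ` boxA R) > 0"
    unfolding leb using lm[of "(-1 - R, - R, - (R/10))" "(-1 + R, R, R/10)"]
    by (simp add: negligible_iff_measure zero_less_measure_iff)
  let ?a = "(- R, - (4/10 * R), - (R/10))" and ?b = "(R, 4/10 * R, R/10)"
  define k where "k = measure lebesgue (T ` cbox ?a ?b)"
  have "(0, 0, 0) \<in> cbox ?a ?b" using R unfolding mem_cbox_triple by simp
  then have ne: "cbox ?a ?b \<noteq> {}" by blast
  have "boxM R = (\<lambda>x. (11/10) *\<^sub>R x) ` cbox ?a ?b"
    unfolding image_smult_cbox using ne by simp
  then have "T ` boxM R = (\<lambda>x. (11/10) *\<^sub>R x + 0) ` (T ` cbox ?a ?b)"
    by (simp add: image_image T.scaleR)
  then have "measure lebesgue (T ` boxM R) = \<bar>11/10\<bar> ^ DIM(R3) * k"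
    by (simp only: measure_lebesgue_affine k_def)
  then have "measure lebesgue (T ` boxM R) = 1331/1000 * k" by (simp add: power_divide)
  moreover have "2 * k \<le> measure lebesgue (T ` boxA R)"
  proof -
    let ?c1 = "(-1, R/2, 0)" and ?c2 = "(-1, - R/2, 0)"
    let ?U1 = "T ` cbox (?c1 + ?a) (?c1 + ?b)" and ?U2 = "T ` cbox (?c2 + ?a) (?c2 + ?b)"
    have mem: "(x, y, z) \<in> cbox ((c1, c2, c3) + ?a) ((c1, c2, c3) + ?b) \<longleftrightarrow> c1 - R \<le> x \<and> x \<le> c1 + R \<and>
        c2 - 4/10 * R \<le> y \<and> y \<le> c2 + 4/10 * R \<and> c3 - R/10 \<le> z \<and> z \<le> c3 + R/10" for x y z c1 c2 c3
      by (simp add: mem_cbox_triple)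
    have "p \<notin> cbox (?c2 + ?a) (?c2 + ?b)" if "p \<in> cbox (?c1 + ?a) (?c1 + ?b)" for p
    proof -
      obtain x y z where p: "p = (x, y, z)" by (cases p)
      show ?thesis using that R unfolding p mem by linarith
    qed
    then have "cbox (?c1 + ?a) (?c1 + ?b) \<inter> cbox (?c2 + ?a) (?c2 + ?b) = {}" by blast
    then have dis: "?U1 \<inter> ?U2 = {}" unfolding image_Int[OF inj, symmetric] by simp
    have "p \<in> boxA R" if "p \<in> cbox (?c1 + ?a) (?c1 + ?b) \<or> p \<in> cbox (?c2 + ?a) (?c2 + ?b)" for p
    proof -
      obtain x y z where p: "p = (x, y, z)" by (cases p)
      show ?thesis using that R unfolding p mem mem_cbox_triple by linarith
    qed
    then have sub: "?U1 \<union> ?U2 \<subseteq> T ` boxA R" unfolding image_Un[symmetric] by (intro image_mono) blast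
    have "measure lebesgue (?U1 \<union> ?U2) = measure lebesgue ?U1 + measure lebesgue ?U2"
      by (rule measure_Union) (use dis fmeasurableD[OF lm] fmeasurableD2[OF lm] in auto)
    also have "\<dots> = 2 * k" unfolding tr k_def by simp
    finally have "2 * k = measure lebesgue (?U1 \<union> ?U2)" by simp
    also have "\<dots> \<le> measure lebesgue (T ` boxA R)"
      by (rule measure_mono_fmeasurable[OF sub _ lm]) (intro sets.Un fmeasurableD[OF lm])
    finally show ?thesis .
  qed
  ultimately show "measure lborel (T ` boxM R) \<le> 1331/2000 * measure lborel (T ` boxA R)"
    unfolding leb by simp
qed

lemma density_bounds:
  fixes \<rho> :: "'a::euclidean_space \<Rightarrow> real"
  assumes cont: "continuous_on UNIV \<rho>" and X: "X \<in> sets borel" "emeasure lborel X < \<infinity>"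
    and b: "\<And>p. p \<in> X \<Longrightarrow> lo \<le> \<rho> p \<and> \<rho> p \<le> hi" "0 \<le> lo" "0 \<le> hi"
  shows "ennreal (lo * measure lborel X) \<le> emeasure (density lborel (\<lambda>p. ennreal (\<rho> p))) X"
    "emeasure (density lborel (\<lambda>p. ennreal (\<rho> p))) X \<le> ennreal (hi * measure lborel X)"
proof -
  have "\<rho> \<in> borel_measurable borel" by (rule borel_measurable_continuous_onI[OF cont])
  then have em: "emeasure (density lborel (\<lambda>p. ennreal (\<rho> p))) X = (\<integral>\<^sup>+p. ennreal (\<rho> p) * indicator X p \<partial>lborel)"
    using X by (intro emeasure_density) auto
  have c: "(\<integral>\<^sup>+p. ennreal k * indicator X p \<partial>lborel) = ennreal (k * measure lborel X)" if "0 \<le> k" for k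
    using X that by (simp add: nn_integral_cmult_indicator emeasure_eq_ennreal_measure ennreal_mult less_top)
  show "ennreal (lo * measure lborel X) \<le> emeasure (density lborel (\<lambda>p. ennreal (\<rho> p))) X"
    unfolding em c[OF b(2), symmetric] by (intro nn_integral_mono) (auto simp: indicator_def b ennreal_leI)
  show "emeasure (density lborel (\<lambda>p. ennreal (\<rho> p))) X \<le> ennreal (hi * measure lborel X)"
    unfolding em c[OF b(3), symmetric] by (intro nn_integral_mono) (auto simp: indicator_def b ennreal_leI)
qed

text \<open>It suffices to find a nonempty Euclidean-open set inside each ball. The set used
  consists of points reached from \<open>p\<close> by short parabolas; it stays away from
  \<open>p\<close> because a parabola needs a nonzero x-displacement.\<close>

lemma spt_sf_dist:
  assumes n: "is_norm n" and cont: "continuous_on UNIV \<rho>" and pos: "\<And>p. \<rho> p > 0"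
  shows "spt (sf_dist n) (density lborel (\<lambda>p. ennreal (\<rho> p))) = UNIV"
proof -
  let ?M = "density lborel (\<lambda>p. ennreal (\<rho> p))"
  obtain C where C: "C > 0" "\<And>v. n v \<le> C * norm v" using is_norm_bound[OF n] by blast
  have "outer_meas ?M {q. sf_dist n p q < e} > 0" if e: "e > 0" for p e
  proof -
    obtain a b c where p: "p = (a,b,c)" by (cases p) auto
    \<comment> \<open>The controls of these parabolas have Euclidean norm at most 2 r + (r + 6 r) =
      9 r, so the length is at most \<open>9/10 * e\<close>.\<close>
    define r where "r = e / (10 * C)"
    have r: "r > 0" using e C by (simp add: r_def)
    define Z where "Z q = snd (snd q) - c - (a * (fst (snd q) - b) - b * (fst q - a)) / 2" for q :: R3
    define U where "U = {q. r < fst q - a} \<inter> {q. fst q - a < 2 * r} \<inter> {q. \<bar>fst (snd q) - b\<bar> < r} \<inter> {q. \<bar>Z q\<bar> < r\<^sup>2}"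
    have "open U" unfolding U_def Z_def
      by (intro open_Int open_Collect_less continuous_intros) simp_all
    then have Us: "U \<in> sets borel" by simp
    have "(a + 3/2 * r, b, c - b * (3/2 * r) / 2) \<in> U" using r by (simp add: U_def Z_def)
    then have Une: "U \<noteq> {}" by blast
    have "sf_dist n p q < e" if q: "q \<in> U" for q
    proof -
      define x y z where "x = fst q - a" and "y = fst (snd q) - b" and "z = Z q"
      have xyz: "r < x" "x < 2 * r" "\<bar>y\<bar> < r" "\<bar>z\<bar> < r\<^sup>2" using q by (auto simp: U_def x_def y_def z_def)
      have qe: "q = (a + x, b + y, c + (a * y - b * x) / 2 + z)"
        by (cases q) (simp add: x_def y_def z_def Z_def)
      have "\<bar>z\<bar> / x \<le> r\<^sup>2 / r" using xyz r by (intro frac_le) auto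
      then have zx: "\<bar>12 * z / x\<bar> \<le> 12 * r" using xyz r by (simp add: abs_mult abs_divide power2_eq_square)
      have "sf_dist n p q \<le> integral {0..1} (\<lambda>t. n (x, y + (12 * z / x) * (t - 1/2)))"
        unfolding p qe by (rule sf_dist_parabola[OF n]) (use xyz r in simp)
      also have "\<dots> \<le> integral {0..1} (\<lambda>t::real. C * (9 * r))"
      proof (rule integral_le)
        have "continuous_on {0..1} (\<lambda>t. n (x, y + (12 * z / x) * (t - 1/2)))"
          by (rule continuous_on_compose2[OF is_norm_continuous[OF n, of UNIV]]) (intro continuous_intros, simp)
        then show "(\<lambda>t. n (x, y + (12 * z / x) * (t - 1/2))) integrable_on {0..1}" by (rule integrable_continuous_real)
        show "(\<lambda>t::real. C * (9 * r)) integrable_on {0..1}" by (intro integrable_continuous_real continuous_intros)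
        fix t :: real assume t: "t \<in> {0..1}"
        have "\<bar>t - 1/2\<bar> \<le> 1/2" by (intro abs_leI) (use t in auto)
        then have "\<bar>(12 * z / x) * (t - 1/2)\<bar> \<le> 12 * r * (1/2)" by (intro abs_mult_le zx)
        then have "\<bar>y + (12 * z / x) * (t - 1/2)\<bar> \<le> 7 * r"
          using xyz(3) abs_triangle_ineq[of y "(12 * z / x) * (t - 1/2)"] by simp
        moreover have "\<bar>x\<bar> \<le> 2 * r" using xyz r by simp
        ultimately have "norm (x, y + (12 * z / x) * (t - 1/2)) \<le> 2 * r + 7 * r"
          using norm_Pair_le[of x "y + (12 * z / x) * (t - 1/2)"] unfolding real_norm_def by (meson add_mono order_trans)
        then have "norm (x, y + (12 * z / x) * (t - 1/2)) \<le> 9 * r" by simp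
        then have "C * norm (x, y + (12 * z / x) * (t - 1/2)) \<le> C * (9 * r)" using C(1) by (intro mult_left_mono) auto
        then show "n (x, y + (12 * z / x) * (t - 1/2)) \<le> C * (9 * r)" using C(2) order_trans by blast
      qed
      also have "\<dots> = 9/10 * e" using C(1) by (simp add: r_def)
      also have "\<dots> < e" using e by simp
      finally show ?thesis .
    qed
    then have sub: "U \<subseteq> {q. sf_dist n p q < e}" by blast
    have "emeasure ?M U \<noteq> 0"
    proof
      assume z: "emeasure ?M U = 0"
      have m: "(\<lambda>p. ennreal (\<rho> p)) \<in> borel_measurable lborel"
        using borel_measurable_continuous_onI[OF cont] by simp
      have "U \<in> null_sets ?M" using z Us by (auto simp: null_sets_def)
      then have "AE p in lborel. p \<in> U \<longrightarrow> ennreal (\<rho> p) = 0"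
        unfolding null_sets_density_iff[OF m] by blast
      moreover have "ennreal (\<rho> p) \<noteq> 0" for p using pos[of p] by (simp add: ennreal_eq_0_iff not_le)
      ultimately have "AE p in lborel. p \<notin> U" by simp
      then have "U \<in> null_sets lborel" using AE_iff_null_sets[of U lborel] Us by simp
      then have "negligible U" by (simp add: negligible_iff_null_sets null_sets_completionI)
      then show False using open_not_negligible \<open>open U\<close> Une by blast
    qed
    then have "0 < emeasure ?M U" by (simp add: zero_less_iff_neq_zero)
    also have "emeasure ?M U \<le> outer_meas ?M {q. sf_dist n p q < e}"
      unfolding outer_meas_def
    proof (rule INF_greatest)
      fix V assume "V \<in> {V \<in> sets ?M. {q. sf_dist n p q < e} \<subseteq> V}"
      then show "emeasure ?M U \<le> emeasure ?M V" using sub by (intro emeasure_mono) auto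
    qed
    finally show ?thesis .
  qed
  then show ?thesis unfolding spt_def by blast
qed

section \<open>Transfer to the given norm and contradiction\<close>

lemma midpoint_box:
  assumes n: "is_norm n" and det: "det2 f g \<noteq> 0" and L: "L > 0" and K: "K > 0" and R: "0 < R" "R \<le> 1/10000000"
    and e: "0 \<le> e" "e \<le> K * R\<^sup>2 / 1000000" and KR: "K * R \<le> L / 1000"
    and quad: "\<And>u. \<bar>u\<bar> \<le> 40 * R \<Longrightarrow> \<bar>n (lin2 f g (1, u)) - (L + K / 2 * u\<^sup>2)\<bar> \<le> e"
  shows "\<And>p q. \<lbrakk>p \<in> heis_aut f g ` boxA R; q \<in> heis_aut f g ` boxB R\<rbrakk> \<Longrightarrow> sf_dist n p q < 3 * L"
    "Mt (sf_dist n) (1/2) (heis_aut f g ` boxA R) (heis_aut f g ` boxB R) \<subseteq> heis_aut f g ` boxM R"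
proof -
  let ?n = "\<lambda>v. n (lin2 f g v)"
  have ep: "endpoint_setup ?n L K R e xp yp zp xq yq zq" if pA: "(xp,yp,zp) \<in> boxA R" and qB: "(xq,yq,zq) \<in> boxB R" for xp yp zp xq yq zq
  proof (rule endpoint_setup.intro)
    show "\<bar>xp + 1\<bar> \<le> R" "\<bar>yp\<bar> \<le> R" "\<bar>zp\<bar> \<le> R / 10" using pA unfolding mem_cbox_triple by linarith+
    show "\<bar>xq - 1\<bar> \<le> R" "\<bar>yq\<bar> \<le> R" "\<bar>zq\<bar> \<le> R / 10" using qB unfolding mem_cbox_triple by linarith+
    show "is_norm ?n" by (rule is_norm_lin2[OF n det])
    show "\<bar>?n (1, u) - (L + K / 2 * u\<^sup>2)\<bar> \<le> e" if "\<bar>u\<bar> \<le> 40 * R" for u by (rule quad[OF that])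
  qed (rule L K R e KR)+
  have ex: "\<exists>x y z. w = heis_aut f g (x, y, z) \<and> (x, y, z) \<in> X" if wX: "w \<in> heis_aut f g ` X" for w X
  proof -
    obtain p where "w = heis_aut f g p" "p \<in> X" using wX by blast
    then show ?thesis by (cases p) blast
  qed
  show "sf_dist n p q < 3 * L" if pA: "p \<in> heis_aut f g ` boxA R" and qB: "q \<in> heis_aut f g ` boxB R" for p q
  proof -
    obtain xp yp zp xq yq zq where p: "p = heis_aut f g (xp,yp,zp)" "(xp,yp,zp) \<in> boxA R"
      and q: "q = heis_aut f g (xq,yq,zq)" "(xq,yq,zq) \<in> boxB R" using ex[OF pA] ex[OF qB] by blast
    show ?thesis unfolding p(1) q(1) sf_dist_heis_aut[OF det]
      by (rule endpoint_setup.dpq_bound(2)[OF ep[OF p(2) q(2)]])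
  qed
  show "Mt (sf_dist n) (1/2) (heis_aut f g ` boxA R) (heis_aut f g ` boxB R) \<subseteq> heis_aut f g ` boxM R"
  proof
    fix w assume "w \<in> Mt (sf_dist n) (1/2) (heis_aut f g ` boxA R) (heis_aut f g ` boxB R)"
    then obtain \<gamma> where \<gamma>: "w = \<gamma> (1/2)" "geodesic (sf_dist n) \<gamma>" "\<gamma> 0 \<in> heis_aut f g ` boxA R" "\<gamma> 1 \<in> heis_aut f g ` boxB R"
      unfolding Mt_def by blast
    obtain xp yp zp xq yq zq where p: "\<gamma> 0 = heis_aut f g (xp,yp,zp)" "(xp,yp,zp) \<in> boxA R"
      and q: "\<gamma> 1 = heis_aut f g (xq,yq,zq)" "(xq,yq,zq) \<in> boxB R" using ex[OF \<gamma>(3)] ex[OF \<gamma>(4)] by blast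
    obtain f' g' where i: "\<And>p. heis_aut f g (heis_aut f' g' p) = p" using lin2_inverse[OF det] by metis
    obtain xm ym zm where xm: "heis_aut f' g' (\<gamma> (1/2)) = (xm, ym, zm)" by (rule prod_cases3)
    have m: "\<gamma> (1/2) = heis_aut f g (xm,ym,zm)" using i[of "\<gamma> (1/2)"] unfolding xm by simp
    have geo: "sf_dist n (\<gamma> s) (\<gamma> t) = \<bar>t - s\<bar> * sf_dist n (\<gamma> 0) (\<gamma> 1)" if "s \<in> {0..1}" "t \<in> {0..1}" for s t
      using \<gamma>(2) that unfolding geodesic_def by blast
    have "sf_dist n (\<gamma> 0) (\<gamma> (1/2)) = sf_dist n (\<gamma> 0) (\<gamma> 1) / 2" "sf_dist n (\<gamma> (1/2)) (\<gamma> 1) = sf_dist n (\<gamma> 0) (\<gamma> 1) / 2"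
      using geo[of 0 "1/2"] geo[of "1/2" 1] by simp_all
    then have d: "sf_dist ?n (xp,yp,zp) (xm,ym,zm) = sf_dist ?n (xp,yp,zp) (xq,yq,zq) / 2"
      "sf_dist ?n (xm,ym,zm) (xq,yq,zq) = sf_dist ?n (xp,yp,zp) (xq,yq,zq) / 2"
      unfolding p(1) q(1) m sf_dist_heis_aut[OF det] .
    have "midpoint_setup ?n L K R e xp yp zp xq yq zq xm ym zm"
      by (rule midpoint_setup.intro[OF ep[OF p(2) q(2)] midpoint_setup_axioms.intro[OF d]])
    then interpret midpoint_setup ?n L K R e xp yp zp xq yq zq xm ym zm .
    have "(xm, ym, zm) \<in> boxM R"
      using xm_bound(2) ym_bound zm_bound unfolding mem_cbox_triple by linarith
    then show "w \<in> heis_aut f g ` boxM R" unfolding \<gamma>(1) m by (rule imageI)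
  qed
qed

text \<open>Images of a fixed box shrink to the origin as \<open>S\<close> tends to 0, where the
  density is almost constant. The central coordinate carries \<open>S^2\<close>, which is at most
  \<open>S\<close>.\<close>

lemma norm_heis_aut_scaled:
  assumes S: "0 \<le> S" "S \<le> 1" and b: "\<bar>fst p\<bar> \<le> 2" "\<bar>fst (snd p)\<bar> \<le> 1" "\<bar>snd (snd p)\<bar> \<le> 1"
  shows "norm (heis_aut (S *\<^sub>R f) (S *\<^sub>R g) p) \<le> S * (2 * \<bar>fst f\<bar> + \<bar>fst g\<bar> + (2 * \<bar>snd f\<bar> + \<bar>snd g\<bar>) + \<bar>det2 f g\<bar>)"
proof -
  let ?q = "heis_aut (S *\<^sub>R f) (S *\<^sub>R g) p"
  have lin: "\<bar>fst p * (S * a) + fst (snd p) * (S * c)\<bar> \<le> S * (2 * \<bar>a\<bar> + \<bar>c\<bar>)" for a c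
  proof -
    have "\<bar>fst p * a\<bar> \<le> 2 * \<bar>a\<bar>" "\<bar>fst (snd p) * c\<bar> \<le> 1 * \<bar>c\<bar>" using b by (intro abs_mult_le; simp)+
    then have "\<bar>fst p * a + fst (snd p) * c\<bar> \<le> 2 * \<bar>a\<bar> + \<bar>c\<bar>" by linarith
    then have "S * \<bar>fst p * a + fst (snd p) * c\<bar> \<le> S * (2 * \<bar>a\<bar> + \<bar>c\<bar>)" using S by (intro mult_left_mono) auto
    moreover have "fst p * (S * a) + fst (snd p) * (S * c) = S * (fst p * a + fst (snd p) * c)" by (simp add: algebra_simps)
    ultimately show ?thesis using S by (simp add: abs_mult)
  qed
  have "snd (snd ?q) = S * (S * (det2 f g * snd (snd p)))" by (simp add: heis_aut_def det2_def algebra_simps)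
  then have "\<bar>snd (snd ?q)\<bar> = S * (S * (\<bar>det2 f g\<bar> * \<bar>snd (snd p)\<bar>))" using S by (simp add: abs_mult)
  also have "\<dots> \<le> S * (1 * (\<bar>det2 f g\<bar> * 1))" using S b by (intro mult_left_mono mult_mono) auto
  finally have 3: "\<bar>snd (snd ?q)\<bar> \<le> S * \<bar>det2 f g\<bar>" by simp
  have "norm ?q \<le> \<bar>fst ?q\<bar> + (\<bar>fst (snd ?q)\<bar> + \<bar>snd (snd ?q)\<bar>)"
    using norm_Pair_le[of "fst ?q" "snd ?q"] norm_Pair_le[of "fst (snd ?q)" "snd (snd ?q)"] by simp
  also have "\<dots> \<le> S * (2 * \<bar>fst f\<bar> + \<bar>fst g\<bar>) + (S * (2 * \<bar>snd f\<bar> + \<bar>snd g\<bar>) + S * \<bar>det2 f g\<bar>)"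
    using lin[of "fst f" "fst g"] lin[of "snd f" "snd g"] 3 by (intro add_mono) (simp_all add: heis_aut_def)
  finally show ?thesis by (simp add: algebra_simps)
qed

theorem theorem6p2:
  fixes nrm :: "real \<times> real \<Rightarrow> real" and \<rho> :: "real \<times> real \<times> real \<Rightarrow> real"
  assumes "is_norm nrm" and "C1_norm nrm" and "strongly_convex_norm nrm"
    and "smooth_fun \<rho>" and "\<forall>p. \<rho> p > 0"
  shows "\<forall>K::real. \<forall>N::real. N > 1 \<longrightarrow>
           \<not> BM (sf_dist nrm) (density lborel (\<lambda>p. ennreal (\<rho> p))) K N"
proof (intro allI impI notI)
  fix K' N :: real
  let ?m = "density lborel (\<lambda>p. ennreal (\<rho> p))"
  assume N: "N > 1" and BM: "BM (sf_dist nrm) ?m K' N"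
  note n = assms(1)
  have cont: "continuous_on UNIV \<rho>" using assms(4) unfolding smooth_fun_def by (metis Ck.simps(1))
  have pos: "\<rho> p > 0" for p using assms(5) by blast
  obtain f g L K R e where det: "det2 f g = 1" and L: "L > 0" and K: "K > 0" and R: "0 < R" "R \<le> 1/10000000"
    and e: "0 \<le> e" "e \<le> K * R\<^sup>2 / 1000000" and KR: "K * R \<le> L / 1000"
    and quad: "\<And>u. \<bar>u\<bar> \<le> 40 * R \<Longrightarrow> \<bar>nrm (lin2 f g (1, u)) - (L + K / 2 * u\<^sup>2)\<bar> \<le> e"
    using quadratic_window[OF assms(1-3)] by blast
  \<comment> \<open>Any number strictly between \<open>(3/4) powr (1/N)\<close> and 1 would
    do.\<close>
  define \<kappa> where "\<kappa> = ((3/4) powr (1/N) + 1) / 2"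
  have "(3/4::real) powr (1/N) < 1" using N powr_less_mono2[of "1/N" "3/4" 1] by simp
  then have \<kappa>: "(3/4) powr (1/N) < \<kappa>" "\<kappa> < 1" by (simp_all add: \<kappa>_def)
  have \<kappa>0: "0 < \<kappa>" unfolding \<kappa>_def by (intro divide_pos_pos add_pos_pos) simp_all
  obtain \<theta>0 where \<theta>0: "\<theta>0 > 0" "\<And>\<theta>. \<lbrakk>0 \<le> \<theta>; \<theta> \<le> \<theta>0\<rbrakk> \<Longrightarrow> \<exists>s. tau_KN K' N (1/2) \<theta> = ereal s \<and> \<kappa> / 2 \<le> s"
    using tau_KN_half_lower[OF N \<kappa>0 \<kappa>(2)] by blast
  \<comment> \<open>The tolerance 1/20 is small enough for (21/20)(1331/2000) \<le> (3/4)(19/20),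
    the comparison of volumes at the end.\<close>
  have "\<rho> 0 / 20 > 0" using pos[of 0] by simp
  moreover have "isCont \<rho> 0" using cont continuous_on_eq_continuous_at[OF open_UNIV] by blast
  ultimately obtain r0 where r0: "r0 > 0" "\<And>p. norm p < r0 \<Longrightarrow> \<bar>\<rho> p - \<rho> 0\<bar> < \<rho> 0 / 20"
    unfolding continuous_at_eps_delta dist_norm by (metis diff_zero real_norm_def)
  define C where "C = 2 * \<bar>fst f\<bar> + \<bar>fst g\<bar> + (2 * \<bar>snd f\<bar> + \<bar>snd g\<bar>) + \<bar>det2 f g\<bar>"
  have C: "C \<ge> 1" using det by (simp add: C_def)
  \<comment> \<open>The second bound puts the boxes within radius \<open>r0\<close>, where the
    density is controlled; the third makes the distances, which are below
    \<open>3 * (S * L)\<close>, at most \<open>\<theta>0\<close>.\<close>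
  define S where "S = min 1 (min (r0 / (2 * C)) (\<theta>0 / (3 * L)))"
  have S: "0 < S" "S \<le> 1" "S * C < r0" "3 * (S * L) \<le> \<theta>0"
  proof -
    show "0 < S" "S \<le> 1" using r0 C \<theta>0 L by (auto simp: S_def)
    have "S * C \<le> r0 / (2 * C) * C" using C by (intro mult_right_mono) (auto simp: S_def)
    also have "\<dots> < r0" using C r0 by simp
    finally show "S * C < r0" .
    have "S * L \<le> \<theta>0 / (3 * L) * L" using L by (intro mult_right_mono) (auto simp: S_def)
    then show "3 * (S * L) \<le> \<theta>0" using L by simp
  qed
  define F G where "F = S *\<^sub>R f" and "G = S *\<^sub>R g"
  define T where "T = heis_aut F G"
  have detS: "det2 F G \<noteq> 0" using S det by (simp add: F_def G_def det2_def right_diff_distrib[symmetric] mult.assoc mult.left_commute)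
  \<comment> \<open>Under dilation \<open>L\<close>, \<open>K\<close> and \<open>e\<close> are
    multiplied by \<open>S\<close> while \<open>R\<close> is unchanged, so the conditions of
    \<open>midpoint_box\<close> are scale invariant.\<close>
  have quadS: "\<bar>nrm (lin2 F G (1, u)) - (S * L + S * K / 2 * u\<^sup>2)\<bar> \<le> S * e" if "\<bar>u\<bar> \<le> 40 * R" for u
  proof -
    have "lin2 F G (1, u) = S *\<^sub>R lin2 f g (1, u)" by (simp add: lin2_def F_def G_def scaleR_add_right)
    then have "nrm (lin2 F G (1, u)) = S * nrm (lin2 f g (1, u))" using S by (simp only: is_normD(3)[OF n] abs_of_pos)
    then have "nrm (lin2 F G (1, u)) - (S * L + S * K / 2 * u\<^sup>2) = S * (nrm (lin2 f g (1, u)) - (L + K / 2 * u\<^sup>2))"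
      by (simp add: algebra_simps)
    then show ?thesis using mult_left_mono[OF quad[OF that], of S] S by (simp add: abs_mult)
  qed
  have "S * e \<le> S * (K * R\<^sup>2 / 1000000)" "S * (K * R) \<le> S * (L / 1000)" using e KR S by (auto intro!: mult_left_mono)
  then have eS: "S * e \<le> S * K * R\<^sup>2 / 1000000" "S * K * R \<le> S * L / 1000" by (simp_all add: mult.assoc)
  have SLK: "0 < S * L" "0 < S * K" "0 \<le> S * e" using S L K e by auto
  have dist_less: "sf_dist nrm p q < 3 * (S * L)" if "p \<in> T ` boxA R" "q \<in> T ` boxB R" for p q
    by (rule midpoint_box(1)[OF n detS SLK(1,2) R SLK(3) eS _ that[unfolded T_def]]) (rule quadS)
  have Mt_sub: "Mt (sf_dist nrm) (1/2) (T ` boxA R) (T ` boxB R) \<subseteq> T ` boxM R"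
    unfolding T_def by (rule midpoint_box(2)[OF n detS SLK(1,2) R SLK(3) eS]) (rule quadS)
  have Tlin: "bounded_linear T" unfolding T_def by (rule bounded_linear_heis_aut)
  obtain f' g' where inv: "\<And>p. T (heis_aut f' g' p) = p" "\<And>p. heis_aut f' g' (T p) = p"
    using lin2_inverse[OF detS] unfolding T_def by metis
  note vol = box_image_measure[OF Tlin bounded_linear_heis_aut inv R(1)]
  define \<nu> where "\<nu> = measure lborel (T ` boxA R)"
  have \<nu>: "\<nu> > 0" unfolding \<nu>_def by (rule vol)
  have comp: "compact (T ` cbox a b)" for a b
    by (intro compact_continuous_image compact_cbox linear_continuous_on Tlin)
  have borel: "T ` cbox a b \<in> sets borel" for a b by (rule borel_compact[OF comp])
  have fin: "emeasure lborel (T ` cbox a b) < \<infinity>" for a b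
    using emeasure_compact_finite[OF comp[of a b]] by simp
  have small: "19/20 * \<rho> 0 \<le> \<rho> (T p) \<and> \<rho> (T p) \<le> 21/20 * \<rho> 0"
    if "\<bar>fst p\<bar> \<le> 2" "\<bar>fst (snd p)\<bar> \<le> 1" "\<bar>snd (snd p)\<bar> \<le> 1" for p
  proof -
    have "norm (T p) \<le> S * C" unfolding T_def F_def G_def C_def
      by (rule norm_heis_aut_scaled) (use S that in auto)
    then have "norm (T p) < r0" using S by linarith
    from r0(2)[OF this] have "\<rho> (T p) - \<rho> 0 < \<rho> 0 / 20" "- (\<rho> (T p) - \<rho> 0) < \<rho> 0 / 20"
      by (simp_all only: abs_less_iff)
    then show ?thesis by (intro conjI) linarith+
  qed
  have near: "19/20 * \<rho> 0 \<le> \<rho> q \<and> \<rho> q \<le> 21/20 * \<rho> 0" if q: "q \<in> T ` cbox (a1, a2, a3) (b1, b2, b3)"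
    and ab: "-2 \<le> a1" "b1 \<le> 2" "-1 \<le> a2" "b2 \<le> 1" "-1 \<le> a3" "b3 \<le> 1" for q a1 a2 a3 b1 b2 b3
  proof -
    obtain p where p: "q = T p" "p \<in> cbox (a1, a2, a3) (b1, b2, b3)" using q by blast
    obtain x y z where xyz: "p = (x, y, z)" by (rule prod_cases3)
    have "\<bar>x\<bar> \<le> 2" "\<bar>y\<bar> \<le> 1" "\<bar>z\<bar> \<le> 1" using p(2) ab unfolding xyz mem_cbox_triple by linarith+
    then show ?thesis using small[of p] unfolding p(1) xyz by simp
  qed
  have rA: "19/20 * \<rho> 0 \<le> \<rho> q \<and> \<rho> q \<le> 21/20 * \<rho> 0" if "q \<in> T ` boxA R" for q
    by (rule near[OF that]) (use R in linarith)+
  have rB: "19/20 * \<rho> 0 \<le> \<rho> q \<and> \<rho> q \<le> 21/20 * \<rho> 0" if "q \<in> T ` boxB R" for q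
    by (rule near[OF that]) (use R in linarith)+
  have rM: "19/20 * \<rho> 0 \<le> \<rho> q \<and> \<rho> q \<le> 21/20 * \<rho> 0" if "q \<in> T ` boxM R" for q
    by (rule near[OF that]) (use R in linarith)+
  have r0n: "0 \<le> 19/20 * \<rho> 0" "0 \<le> 21/20 * \<rho> 0" using pos[of 0] by simp_all
  define a where "a = 19/20 * \<rho> 0 * \<nu>"
  show False
  proof (rule BM_half_fails[OF BM N borel borel _ _ _ _ _ \<theta>0(2) \<kappa>(1)])
    show "T ` boxA R \<noteq> {}" "T ` boxB R \<noteq> {}" using R by (auto simp: cbox_Pair_eq)
    show "T ` boxA R \<subseteq> spt (sf_dist nrm) ?m" "T ` boxB R \<subseteq> spt (sf_dist nrm) ?m"
      using spt_sf_dist[OF n cont pos] by simp_all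
    show "0 \<le> sf_dist nrm p q \<and> sf_dist nrm p q \<le> \<theta>0" if "p \<in> T ` boxA R" "q \<in> T ` boxB R" for p q
      using sf_dist_nonneg[OF n, of p q] dist_less[OF that] S(4) by linarith
    show "a > 0" using pos[of 0] \<nu> by (simp add: a_def)
    show "ennreal a \<le> emeasure ?m (T ` boxA R)"
      unfolding a_def \<nu>_def by (rule density_bounds(1)[OF cont borel fin rA r0n])
    show "ennreal a \<le> emeasure ?m (T ` boxB R)"
      unfolding a_def \<nu>_def vol(1)[symmetric] by (rule density_bounds(1)[OF cont borel fin rB r0n])
    have "outer_meas ?m (Mt (sf_dist nrm) (1/2) (T ` boxA R) (T ` boxB R)) \<le> emeasure ?m (T ` boxM R)"
      unfolding outer_meas_def by (rule INF_lower) (use Mt_sub borel in auto)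
    also have "\<dots> \<le> ennreal (21/20 * \<rho> 0 * measure lborel (T ` boxM R))"
      by (rule density_bounds(2)[OF cont borel fin rM r0n])
    also have "\<dots> \<le> ennreal (3/4 * a)"
    proof (rule ennreal_leI)
      have "21/20 * \<rho> 0 * measure lborel (T ` boxM R) \<le> 21/20 * \<rho> 0 * (1331/2000 * \<nu>)"
        using vol(3) r0n by (intro mult_left_mono) (auto simp: \<nu>_def)
      also have "\<dots> \<le> 3/4 * a" using pos[of 0] \<nu> by (simp add: a_def)
      finally show "21/20 * \<rho> 0 * measure lborel (T ` boxM R) \<le> 3/4 * a" .
    qed
    finally show "outer_meas ?m (Mt (sf_dist nrm) (1/2) (T ` boxA R) (T ` boxB R)) \<le> ennreal (3/4 * a)" .
  qed
qed

end
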